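(* There exists a thin (integrable) representation of the quantum toroidal algebra $\mathcal U_q(sl_4^{tor})$ whose $q$-character is the sum of the monomials occurring in $$\overline{\mathcal M}(e^{2\varpi_1}Y_{1,1}Y_{1,-1}Y_{0,2}^{-1}Y_{0,0}^{-1})=\bigoplus_{s\in\mathbb N}\mathcal M(e^{2\varpi_1+s\delta}Y_{1,1}Y_{1,-1-4s}Y_{0,2}^{-1}Y_{0,-4s}^{-1}),$$ each with multiplicity one.
   Context: Here $\mathbb N=\{0,1,2,\dots\}$. Root data. Let $n=3$, $I=\{0,1,2,3\}$ identified with $\mathbb Z/4\mathbb Z$, $C=(C_{i,j})_{i,j\in I}$ the Cartan matrix of type $A_3^{(1)}$ ($C_{i,i}=2$, $C_{i,i\pm1}=-1$, other entries $0$), $\mathfrak h=\bigoplus_{i\in I}\mathbb Q h_i\oplus\mathbb Q d$; $\alpha_i(h_j)=C_{j,i}$, $\alpha_i(d)=\delta_{0,i}$, $\Lambda_i(h_j)=\delta_{i,j}$, $\Lambda_i(d)=0$; $\delta=\sum_i\alpha_i$, $P=\{\lambda\in\mathfrak h^*:\lambda(h_i)\in\mathbb Z\ \forall i\}$, $\varpi_1=\Lambda_1-\Lambda_0$. Fix $q=e^t\in\mathbb C^*$ not a root of unity, $q^x=e^{tx}$ for $x\in\mathbb Q$, $[l]_q=\frac{q^l-q^{-l}}{q-q^{-1}}$. Monomial crystal. Consider monomials $m=e^{\omega(m)}\prod_{i\in I,l\in\mathbb Z}Y_{i,l}^{u_{i,l}(m)}$ with $u_{i,l}(m)\in\mathbb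 Z$ (finitely many non-zero), $\omega(m)\in P$, $\sum_l u_{i,l}(m)=\omega(m)(h_i)$. Put $A_{i,l}=e^{\alpha_i}Y_{i,l-1}Y_{i,l+1}Y_{i-1,l}^{-1}Y_{i+1,l}^{-1}$. $\mathcal M$ is the group of monomials with $u_{i,l}(m)=0$ whenever $l\not\equiv i\bmod 2$. Set $\mathrm{wt}(m)=\omega(m)$, $\varphi_{i,L}(m)=\sum_{l\le L}u_{i,l}(m)$, $\varphi_i(m)=\max_L\varphi_{i,L}(m)$, $\varepsilon_{i,L}(m)=-\sum_{l\ge L}u_{i,l}(m)$, $\varepsilon_i(m)=\max_L\varepsilon_{i,L}(m)$, $p_i(m)=\max\{L:\varepsilon_{i,L}(m)=\varepsilon_i(m)\}$, $q_i(m)=\min\{L:\varphi_{i,L}(m)=\varphi_i(m)\}$; $\tilde e_i\cdot m=0$ if $\varepsilon_i(m)=0$, else $\tilde e_i\cdot m=mA_{i,p_i(m)-1}$; $\tilde f_i\cdot m=0$ if $\varphi_i(m)=0$, else $\tilde f_i\cdot m=mA_{i,q_i(m)+1}^{-1}$. $\mathcal M(m)$ is the connected subcrystal generated by $m$. Quantum toroidal algebra. $\mathcal U_q(sl_4^{tor})$ is the $\mathbb C$-algebra with generators $x_{i,r}^\pm$ ($i\in I,r\in\mathbb Z$), $k_h$ ($h\in\mathfrak h$), $h_{i,m}$ ($i\in I,m\in\mathbb Z\setminus\{0\}$) and relations: $k_hk_{h'}=k_{h+h'}$, $k_0=1$, $[k_h,h_{j,m}]=0$, $[h_{i,m},h_{j,m'}]=0$;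 $k_hx_{j,r}^\pm k_{-h}=q^{\pm\alpha_j(h)}x_{j,r}^\pm$; $[h_{i,m},x_{j,r}^\pm]=\pm\frac1m[mC_{i,j}]_qx_{j,m+r}^\pm$; $[x_{i,r}^+,x_{j,r'}^-]=\delta_{ij}\frac{\phi^+_{i,r+r'}-\phi^-_{i,r+r'}}{q-q^{-1}}$; $x_{i,r+1}^\pm x_{j,r'}^\pm-q^{\pm C_{ij}}x_{j,r'}^\pm x_{i,r+1}^\pm=q^{\pm C_{ij}}x_{i,r}^\pm x_{j,r'+1}^\pm-x_{j,r'+1}^\pm x_{i,r}^\pm$; for $j=i+1$ and $j=i-1$ the expression $x_{i,r_1}^\pm x_{i,r_2}^\pm x_{j,r'}^\pm-(q+q^{-1})x_{i,r_1}^\pm x_{j,r'}^\pm x_{i,r_2}^\pm+x_{j,r'}^\pm x_{i,r_1}^\pm x_{i,r_2}^\pm$ plus the same expression with $r_1,r_2$ exchanged is $0$; $[x_{i,r_1}^\pm,x_{j,r_2}^\pm]=0$ if $i\ne j,j\pm1$. Here $\phi_i^\pm(z)=\sum_{m\ge0}\phi^\pm_{i,\pm m}z^{\pm m}=k_{h_i}^{\pm1}\exp\big(\pm(q-q^{-1})\sum_{m'\ge1}h_{i,\pm m'}z^{\pm m'}\big)$, $\phi^+_{i,m}=0$ for $m<0$, $\phi^-_{i,m}=0$ for $m>0$. $\mathcal U_q(\hat{\mathfrak h})$ is the commutative subalgebra generated by all $k_h$, $h_{i,m}$. Representations. For $\nu\in P$, $V_\nu=\{v:k_hv=q^{\nu(h)}v\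 \forall h\in\mathfrak h\}$. $V$ is integrable if $V=\bigoplus_{\nu\in P}V_\nu$ and all $x_{i,0}^\pm$ are locally nilpotent. $V$ is thin if $\mathcal U_q(\hat{\mathfrak h})$ acts by diagonalizable operators and the joint spectrum is simple (one-dimensional joint eigenspaces). For a monomial $m$, $V_m$ is the subspace of $V_{\omega(m)}$ on which, for every $i$, $\phi_i^\pm(z)$ has generalized eigenvalue the expansion in $z^{\pm1}$ of $\prod_l\big(q\frac{1-zq^{l-1}}{1-zq^{l+1}}\big)^{u_{i,l}(m)}$. When $V$ is the direct sum of the $V_m$ with each $V_m$ finite-dimensional, $\chi_q(V)=\sum_m\dim(V_m)\,m$. *)

theory Defs
  imports
    "HOL-Analysis.Analysis"
    "HOL-Library.Poly_Mapping"
    "HOL-Computational_Algebra.Formal_Power_Series"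
    "HOL-Algebra.QuotRing"
    "HOL-Algebra.Generated_Rings"
begin

section \<open>Root data of type \<open>A\<^sub>3\<^sup>(\<^sup>1\<^sup>)\<close>\<close>

text \<open>The index set \<open>I = \<int>/4\<int>\<close> is the ring type \<^typ>\<open>4\<close>, so \<open>i + 1\<close> and \<open>i - 1\<close> are
  computed modulo 4.  An element \<open>(a, b)\<close> of \<open>\<hh>\<close> stands for \<open>\<Sum>\<^sub>i a\<^sub>i h\<^sub>i + b d\<close>.\<close>

type_synonym cartan = "(rat ^ 4) \<times> rat"
type_synonym weight = "cartan \<Rightarrow> rat"

definition cartan_scale :: "rat \<Rightarrow> cartan \<Rightarrow> cartan" where
  "cartan_scale c h = (c *s fst h, c * snd h)"

definition coroot :: "4 \<Rightarrow> cartan" where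
  "coroot i = (axis i 1, 0)"

definition cartan_entry :: "4 \<Rightarrow> 4 \<Rightarrow> int" where
  "cartan_entry i j = (if i = j then 2 else if j = i + 1 \<or> j = i - 1 then -1 else 0)"

definition simple_root :: "4 \<Rightarrow> weight" where
  "simple_root i = (\<lambda>h. (\<Sum>j\<in>UNIV. of_int (cartan_entry j i) * fst h $ j) + (if i = 0 then snd h else 0))"

definition fund_weight :: "4 \<Rightarrow> weight" where
  "fund_weight i = (\<lambda>h. fst h $ i)"

definition delta :: weight where
  "delta = (\<lambda>h. \<Sum>i\<in>UNIV. simple_root i h)"

definition varpi1 :: weight where
  "varpi1 = (\<lambda>h. fund_weight 1 h - fund_weight 0 h)"

definition weight_lattice :: "weight set" where
  "weight_lattice = {\<nu>. Vector_Spaces.linear cartan_scale (*) \<nu> \<and> (\<forall>i. \<nu> (coroot i) \<in> \<int>)}"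

section \<open>The monomial crystal\<close>

text \<open>The type below consists of all formal products of an exponential and of powers of the \<open>Y\<^sub>i\<^sub>,\<^sub>l\<close>;
  the set \<open>monomials\<close> singles out those with finite support and compatible weight.\<close>

datatype monomial = Monomial (wt: weight) (expo: "4 \<Rightarrow> int \<Rightarrow> int")

instantiation monomial :: "{comm_monoid_mult, inverse}"
begin

definition "(1 :: monomial) = Monomial (\<lambda>h. 0) (\<lambda>i l. 0)"

definition "(m :: monomial) * m' =
  Monomial (\<lambda>h. wt m h + wt m' h) (\<lambda>i l. expo m i l + expo m' i l)"

definition "inverse (m :: monomial) = Monomial (\<lambda>h. - wt m h) (\<lambda>i l. - expo m i l)"

definition "(m :: monomial) div m' = m * inverse m'"

instance
  by standard (auto simp: one_monomial_def times_monomial_def algebra_simps)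

end

definition mexp :: "weight \<Rightarrow> monomial" where
  "mexp \<nu> = Monomial \<nu> (\<lambda>i l. 0)"

definition Ymon :: "4 \<Rightarrow> int \<Rightarrow> monomial" where
  "Ymon i l = Monomial (\<lambda>h. 0) (\<lambda>j k. if j = i \<and> k = l then 1 else 0)"

definition Amon :: "4 \<Rightarrow> int \<Rightarrow> monomial" where
  "Amon i l = mexp (simple_root i) * Ymon i (l - 1) * Ymon i (l + 1) * inverse (Ymon (i - 1) l) * inverse (Ymon (i + 1) l)"

definition monomials :: "monomial set" where
  "monomials = {m. wt m \<in> weight_lattice \<and> finite {(i, l). expo m i l \<noteq> 0} \<and>
     (\<forall>i. of_int (\<Sum>l | expo m i l \<noteq> 0. expo m i l) = wt m (coroot i))}"

text \<open>For \<open>i \<in> \<int>/4\<int>\<close> the condition \<open>l \<equiv> i mod 2\<close> says that the class of \<open>l\<close> is \<open>i\<close> or \<open>i + 2\<close>.\<close>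

definition crystal_monomials :: "monomial set" where
  "crystal_monomials = {m \<in> monomials.
     \<forall>i l. \<not> (of_int l = i \<or> of_int l = i + 2) \<longrightarrow> expo m i l = 0}"

definition phiL :: "4 \<Rightarrow> int \<Rightarrow> monomial \<Rightarrow> int" where
  "phiL i L m = (\<Sum>l | l \<le> L \<and> expo m i l \<noteq> 0. expo m i l)"

definition cphi :: "4 \<Rightarrow> monomial \<Rightarrow> int" where
  "cphi i m = Max (range (\<lambda>L. phiL i L m))"

definition epsL :: "4 \<Rightarrow> int \<Rightarrow> monomial \<Rightarrow> int" where
  "epsL i L m = - (\<Sum>l | L \<le> l \<and> expo m i l \<noteq> 0. expo m i l)"

definition ceps :: "4 \<Rightarrow> monomial \<Rightarrow> int" where
  "ceps i m = Max (range (\<lambda>L. epsL i L m))"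

text \<open>\<open>crystal_p\<close> and \<open>crystal_q\<close> are meaningful only if \<open>\<epsilon>\<^sub>i(m) > 0\<close>, resp. \<open>\<phi>\<^sub>i(m) > 0\<close>.  The sets
  involved may be infinite on the other side, whence \<open>GREATEST\<close> instead of \<open>Max\<close>.\<close>

definition crystal_p :: "4 \<Rightarrow> monomial \<Rightarrow> int" where
  "crystal_p i m = (GREATEST L. epsL i L m = ceps i m)"

definition crystal_q :: "4 \<Rightarrow> monomial \<Rightarrow> int" where
  "crystal_q i m = (LEAST L. phiL i L m = cphi i m)"

definition e_tilde :: "4 \<Rightarrow> monomial \<Rightarrow> monomial option" where
  "e_tilde i m = (if ceps i m = 0 then None else Some (m * Amon i (crystal_p i m - 1)))"

definition f_tilde :: "4 \<Rightarrow> monomial \<Rightarrow> monomial option" where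
  "f_tilde i m = (if cphi i m = 0 then None else Some (m * inverse (Amon i (crystal_q i m + 1))))"

definition crystal_edges :: "(monomial \<times> monomial) set" where
  "crystal_edges = {(m, m'). m \<in> crystal_monomials \<and> m' \<in> crystal_monomials \<and>
     (\<exists>i. e_tilde i m = Some m' \<or> f_tilde i m = Some m')}"

definition subcrystal :: "monomial \<Rightarrow> monomial set" where
  "subcrystal m = {m'. (m, m') \<in> crystal_edges\<^sup>*}"

definition Mbar :: "monomial set" where
  "Mbar = (\<Union>s::nat. subcrystal
     (mexp (\<lambda>h. 2 * varpi1 h + of_nat s * delta h) *
      Ymon 1 1 * Ymon 1 (-1 - 4 * int s) * inverse (Ymon 0 2) * inverse (Ymon 0 (-4 * int s))))"

section \<open>The quantum toroidal algebra\<close>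

typedef nzint = "{m::int. m \<noteq> 0}"
  by (rule exI[of _ 1]) simp

datatype sgn = PlusS | MinusS

fun sg :: "sgn \<Rightarrow> int" where
  "sg PlusS = 1"
| "sg MinusS = -1"

text \<open>The generators \<open>x\<^sup>\<plusminus>\<^sub>i\<^sub>,\<^sub>r\<close>, \<open>k\<^sub>h\<close> and \<open>h\<^sub>i\<^sub>,\<^sub>m\<close>.\<close>

datatype generator = GX sgn 4 int | GK cartan | GH 4 nzint

text \<open>The free monoid on \<open>'a\<close>, written additively (concatenation is \<open>+\<close>), so that
  \<open>'a free_monoid \<Rightarrow>\<^sub>0 complex\<close> with its convolution product is the free associative
  unital algebra on \<open>'a\<close>.\<close>

datatype 'a free_monoid = Word (letters: "'a list")

instantiation free_monoid :: (type) monoid_add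
begin

definition "0 = Word []"

definition "v + w = Word (letters v @ letters w)"

instance
  by standard (auto simp: zero_free_monoid_def plus_free_monoid_def)

end

type_synonym free_alg = "generator free_monoid \<Rightarrow>\<^sub>0 complex"

definition scal :: "complex \<Rightarrow> free_alg" where
  "scal c = Poly_Mapping.single 0 c"

definition gen :: "generator \<Rightarrow> free_alg" where
  "gen g = Poly_Mapping.single (Word [g]) 1"

abbreviation xgen :: "sgn \<Rightarrow> 4 \<Rightarrow> int \<Rightarrow> free_alg" where
  "xgen s i r \<equiv> gen (GX s i r)"

abbreviation kgen :: "cartan \<Rightarrow> free_alg" where
  "kgen h \<equiv> gen (GK h)"

abbreviation hgen :: "4 \<Rightarrow> nzint \<Rightarrow> free_alg" where
  "hgen i m \<equiv> gen (GH i m)"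

definition bracket :: "free_alg \<Rightarrow> free_alg \<Rightarrow> free_alg" where
  "bracket a b = a * b - b * a"

text \<open>The parameter is \<open>t\<close> with \<open>q = e\<^sup>t\<close>, and \<open>qpow t x\<close> is \<open>q\<^sup>x = e\<^sup>t\<^sup>x\<close> for rational \<open>x\<close>.\<close>

definition qpow :: "complex \<Rightarrow> rat \<Rightarrow> complex" where
  "qpow t x = exp (t * of_rat x)"

definition qnum :: "complex \<Rightarrow> int \<Rightarrow> complex" where
  "qnum t l = (qpow t (of_int l) - qpow t (of_int (- l))) / (qpow t 1 - qpow t (-1))"

text \<open>Exponential of a power series without constant term.\<close>

definition series_exp :: "free_alg fps \<Rightarrow> free_alg fps" where
  "series_exp F = Abs_fps (\<lambda>n. \<Sum>k\<le>n. scal (1 / fact k) * fps_nth (F ^ k) n)"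

text \<open>\<open>phi_series t s i\<close> is \<open>\<phi>\<^sup>\<plusminus>\<^sub>i(z)\<close> as a power series in \<open>z\<^sup>\<plusminus>\<^sup>1\<close>; hence its \<open>n\<close>-th coefficient
  is \<open>\<phi>\<^sup>\<plusminus>\<^sub>i\<^sub>,\<^sub>\<plusminus>\<^sub>n\<close>.\<close>

definition phi_series :: "complex \<Rightarrow> sgn \<Rightarrow> 4 \<Rightarrow> free_alg fps" where
  "phi_series t s i = fps_const (kgen (cartan_scale (of_int (sg s)) (coroot i))) *
     series_exp (fps_const (scal (of_int (sg s) * (qpow t 1 - qpow t (-1)))) *
       Abs_fps (\<lambda>n. if n = 0 then 0 else hgen i (Abs_nzint (sg s * int n))))"

definition phi :: "complex \<Rightarrow> sgn \<Rightarrow> 4 \<Rightarrow> int \<Rightarrow> free_alg" where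
  "phi t s i m = (if sg s * m \<ge> 0 then fps_nth (phi_series t s i) (nat (sg s * m)) else 0)"

definition serre :: "complex \<Rightarrow> sgn \<Rightarrow> 4 \<Rightarrow> 4 \<Rightarrow> int \<Rightarrow> int \<Rightarrow> int \<Rightarrow> free_alg" where
  "serre t s i j r1 r2 r' =
     xgen s i r1 * xgen s i r2 * xgen s j r'
     - scal (qpow t 1 + qpow t (-1)) * xgen s i r1 * xgen s j r' * xgen s i r2
     + xgen s j r' * xgen s i r1 * xgen s i r2"

text \<open>A relation \<open>a = b\<close> is recorded as the element \<open>a - b\<close>.\<close>

inductive_set toroidal_relations :: "complex \<Rightarrow> free_alg set" for t :: complex where
  k_mult: "kgen h * kgen h' - kgen (h + h') \<in> toroidal_relations t"
| k_zero: "kgen 0 - 1 \<in> toroidal_relations t"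
| k_h: "bracket (kgen h) (hgen j m) \<in> toroidal_relations t"
| h_h: "bracket (hgen i m) (hgen j m') \<in> toroidal_relations t"
| k_x: "kgen h * xgen s j r * kgen (- h) - scal (qpow t (of_int (sg s) * simple_root j h)) * xgen s j r
    \<in> toroidal_relations t"
| h_x: "bracket (hgen i m) (xgen s j r)
    - scal (of_int (sg s) * (1 / of_int (Rep_nzint m)) * qnum t (Rep_nzint m * cartan_entry i j))
      * xgen s j (Rep_nzint m + r) \<in> toroidal_relations t"
| x_x: "bracket (xgen PlusS i r) (xgen MinusS j r')
    - (if i = j then scal (1 / (qpow t 1 - qpow t (-1))) * (phi t PlusS i (r + r') - phi t MinusS i (r + r'))
       else 0) \<in> toroidal_relations t"
| x_quad: "xgen s i (r + 1) * xgen s j r'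
    - scal (qpow t (of_int (sg s * cartan_entry i j))) * xgen s j r' * xgen s i (r + 1)
    - (scal (qpow t (of_int (sg s * cartan_entry i j))) * xgen s i r * xgen s j (r' + 1)
       - xgen s j (r' + 1) * xgen s i r) \<in> toroidal_relations t"
| x_serre: "j = i + 1 \<or> j = i - 1 \<Longrightarrow>
    serre t s i j r1 r2 r' + serre t s i j r2 r1 r' \<in> toroidal_relations t"
| x_far: "i \<noteq> j \<Longrightarrow> i \<noteq> j + 1 \<Longrightarrow> i \<noteq> j - 1 \<Longrightarrow>
    bracket (xgen s i r1) (xgen s j r2) \<in> toroidal_relations t"

definition free_ring :: "free_alg ring" where
  "free_ring = \<lparr>carrier = UNIV, mult = (*), one = 1, zero = 0, add = (+)\<rparr>"

definition toroidal_ideal :: "complex \<Rightarrow> free_alg set" where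
  "toroidal_ideal t = Idl\<^bsub>free_ring\<^esub> (toroidal_relations t)"

definition toroidal :: "complex \<Rightarrow> free_alg set ring" where
  "toroidal t = free_ring Quot (toroidal_ideal t)"

definition cls :: "complex \<Rightarrow> free_alg \<Rightarrow> free_alg set" where
  "cls t a = toroidal_ideal t +>\<^bsub>free_ring\<^esub> a"

definition toroidal_cartan :: "complex \<Rightarrow> free_alg set set" where
  "toroidal_cartan t = generate_ring (toroidal t)
     (range (\<lambda>c. cls t (scal c)) \<union> range (\<lambda>h. cls t (kgen h)) \<union> range (\<lambda>(i, m). cls t (hgen i m)))"

section \<open>Representations\<close>

text \<open>A representation lives on a complex vector space given by a type \<open>'v\<close> with scalar
  multiplication \<open>sc\<close>; it is a homomorphism \<open>\<rho>\<close> of \<open>\<complex>\<close>-algebras to the linear endomorphisms.\<close>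

definition End_ring :: "(complex \<Rightarrow> 'v::ab_group_add \<Rightarrow> 'v) \<Rightarrow> ('v \<Rightarrow> 'v) ring" where
  "End_ring sc = \<lparr>carrier = {f. Vector_Spaces.linear sc sc f}, mult = (\<circ>), one = id,
     zero = (\<lambda>v. 0), add = (\<lambda>f g v. f v + g v)\<rparr>"

definition representation ::
  "complex \<Rightarrow> (complex \<Rightarrow> 'v::ab_group_add \<Rightarrow> 'v) \<Rightarrow> (free_alg set \<Rightarrow> 'v \<Rightarrow> 'v) \<Rightarrow> bool" where
  "representation t sc \<rho> \<longleftrightarrow> vector_space sc \<and> \<rho> \<in> ring_hom (toroidal t) (End_ring sc) \<and>
     (\<forall>c. \<rho> (cls t (scal c)) = sc c)"

definition is_direct_sum ::
  "(complex \<Rightarrow> 'v::ab_group_add \<Rightarrow> 'v) \<Rightarrow> 'j set \<Rightarrow> ('j \<Rightarrow> 'v set) \<Rightarrow> bool" where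
  "is_direct_sum sc J U \<longleftrightarrow> (\<forall>j\<in>J. module.subspace sc (U j)) \<and>
     module.span sc (\<Union>j\<in>J. U j) = UNIV \<and>
     (\<forall>F v. finite F \<and> F \<subseteq> J \<and> (\<forall>j\<in>F. v j \<in> U j) \<and> (\<Sum>j\<in>F. v j) = 0 \<longrightarrow> (\<forall>j\<in>F. v j = 0))"

definition weight_space ::
  "complex \<Rightarrow> (complex \<Rightarrow> 'v::ab_group_add \<Rightarrow> 'v) \<Rightarrow> (free_alg set \<Rightarrow> 'v \<Rightarrow> 'v) \<Rightarrow> weight \<Rightarrow> 'v set" where
  "weight_space t sc \<rho> \<nu> = {v. \<forall>h. \<rho> (cls t (kgen h)) v = sc (qpow t (\<nu> h)) v}"

definition integrable_rep ::
  "complex \<Rightarrow> (complex \<Rightarrow> 'v::ab_group_add \<Rightarrow> 'v) \<Rightarrow> (free_alg set \<Rightarrow> 'v \<Rightarrow> 'v) \<Rightarrow> bool" where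
  "integrable_rep t sc \<rho> \<longleftrightarrow> is_direct_sum sc weight_lattice (weight_space t sc \<rho>) \<and>
     (\<forall>s i v. \<exists>N. (\<rho> (cls t (xgen s i 0)) ^^ N) v = 0)"

definition diagonalizable :: "(complex \<Rightarrow> 'v::ab_group_add \<Rightarrow> 'v) \<Rightarrow> ('v \<Rightarrow> 'v) \<Rightarrow> bool" where
  "diagonalizable sc f \<longleftrightarrow> module.span sc {v. \<exists>c. f v = sc c v} = UNIV"

definition joint_eigenspace ::
  "complex \<Rightarrow> (complex \<Rightarrow> 'v::ab_group_add \<Rightarrow> 'v) \<Rightarrow> (free_alg set \<Rightarrow> 'v \<Rightarrow> 'v)
     \<Rightarrow> (free_alg set \<Rightarrow> complex) \<Rightarrow> 'v set" where
  "joint_eigenspace t sc \<rho> \<theta> = {v. \<forall>a\<in>toroidal_cartan t. \<rho> a v = sc (\<theta> a) v}"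

definition thin ::
  "complex \<Rightarrow> (complex \<Rightarrow> 'v::ab_group_add \<Rightarrow> 'v) \<Rightarrow> (free_alg set \<Rightarrow> 'v \<Rightarrow> 'v) \<Rightarrow> bool" where
  "thin t sc \<rho> \<longleftrightarrow> (\<forall>a\<in>toroidal_cartan t. diagonalizable sc (\<rho> a)) \<and>
     (\<forall>\<theta>. joint_eigenspace t sc \<rho> \<theta> \<noteq> {0} \<longrightarrow>
       vector_space.dim sc (joint_eigenspace t sc \<rho> \<theta>) = 1)"

text \<open>The expansion of \<open>q (1 - z q\<^sup>l\<^sup>-\<^sup>1) / (1 - z q\<^sup>l\<^sup>+\<^sup>1)\<close> in \<open>z\<close>, resp. in \<open>w = z\<^sup>-\<^sup>1\<close>; in the
  latter case numerator and denominator are first multiplied by \<open>w\<close>.\<close>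

fun Y_eigenvalue :: "complex \<Rightarrow> sgn \<Rightarrow> int \<Rightarrow> complex fps" where
  "Y_eigenvalue t PlusS l = fps_const (qpow t 1) *
     (1 - fps_const (qpow t (of_int (l - 1))) * fps_X) *
     inverse (1 - fps_const (qpow t (of_int (l + 1))) * fps_X)"
| "Y_eigenvalue t MinusS l = fps_const (qpow t 1) *
     (fps_X - fps_const (qpow t (of_int (l - 1)))) *
     inverse (fps_X - fps_const (qpow t (of_int (l + 1))))"

definition monomial_eigenvalue :: "complex \<Rightarrow> sgn \<Rightarrow> monomial \<Rightarrow> 4 \<Rightarrow> complex fps" where
  "monomial_eigenvalue t s m i = (\<Prod>l | expo m i l \<noteq> 0. Y_eigenvalue t s l powi expo m i l)"

definition monomial_space ::
  "complex \<Rightarrow> (complex \<Rightarrow> 'v::ab_group_add \<Rightarrow> 'v) \<Rightarrow> (free_alg set \<Rightarrow> 'v \<Rightarrow> 'v) \<Rightarrow> monomial \<Rightarrow> 'v set" where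
  "monomial_space t sc \<rho> m = {v \<in> weight_space t sc \<rho> (wt m). \<forall>s i n. \<exists>N.
     ((\<lambda>w. \<rho> (cls t (fps_nth (phi_series t s i) n)) w
           - sc (fps_nth (monomial_eigenvalue t s m i) n) w) ^^ N) v = 0}"

text \<open>A \<open>q\<close>-character is a formal, possibly infinite, sum of monomials with coefficients in
  \<open>\<nat>\<close>, i.e. a function giving the multiplicity of each monomial.\<close>

definition has_q_character ::
  "complex \<Rightarrow> (complex \<Rightarrow> 'v::ab_group_add \<Rightarrow> 'v) \<Rightarrow> (free_alg set \<Rightarrow> 'v \<Rightarrow> 'v)
     \<Rightarrow> (monomial \<Rightarrow> nat) \<Rightarrow> bool" where
  "has_q_character t sc \<rho> \<theta> \<longleftrightarrow> is_direct_sum sc monomials (monomial_space t sc \<rho>) \<and>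
     (\<forall>m\<in>monomials. (\<exists>B. finite B \<and> monomial_space t sc \<rho> m \<subseteq> module.span sc B) \<and>
       vector_space.dim sc (monomial_space t sc \<rho> m) = \<theta> m) \<and>
     (\<forall>m. m \<notin> monomials \<longrightarrow> \<theta> m = 0)"

text \<open>The space \<open>\<complex>\<^sup>(\<^sup>\<nat>\<^sup>)\<close> of countable dimension.  As there are only countably many monomials, every
  representation possessing a \<open>q\<close>-character has countable dimension.\<close>

definition fin_scale :: "complex \<Rightarrow> (nat \<Rightarrow>\<^sub>0 complex) \<Rightarrow> (nat \<Rightarrow>\<^sub>0 complex)" where
  "fin_scale c = Poly_Mapping.map ((*) c)"

end

theory Submission
  imports Defs
begin

text \<open>
  Put \<open>q = e\<^sup>t\<close>.  The module is made from two copies of the vector representation.  The vector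
  representation has a basis of boxes indexed by \<open>a \<in> \<int>\<close>: the box \<open>a\<close> carries the monomial
  \<open>Y\<^bsub>a,a\<^esub> Y\<^bsub>a-1,a+1\<^esub>\<^sup>-\<^sup>1\<close>, with colours read modulo 4, and \<open>x\<^sup>-\<close> of colour \<open>a\<close> moves it to the box
  \<open>a + 1\<close>.  Shift the spectral parameter of a second copy by \<open>q\<^sup>-\<^sup>2\<close> and form the tensor product with
  respect to the Drinfeld coproduct.  Its basis vector \<open>w\<^bsub>a,b\<^esub>\<close> carries the monomial
  \<open>M(a,b) = Y\<^bsub>a,a\<^esub> Y\<^bsub>a-1,a+1\<^esub>\<^sup>-\<^sup>1 Y\<^bsub>b,b-2\<^esub> Y\<^bsub>b-1,b-1\<^esub>\<^sup>-\<^sup>1\<close>.  The coefficient of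
  every move that would leave the region \<open>b \<le> a\<close> vanishes, because the boxes are shifted against each
  other by the power of \<open>q\<close> at which \<open>\<phi>\<close> of one box has a zero.  Hence the \<open>w\<^bsub>a,b\<^esub>\<close> with \<open>b \<le> a\<close> span
  a module.  With \<open>n = a - b\<close> it
  reads

  \<open>x\<^sup>-\<^bsub>i,r\<^esub> w\<^bsub>a,b\<^esub> = [i = a] q\<^bsup>(a+1)r\<^esup> w\<^bsub>a+1,b\<^esub> + [i = b] g(n) q\<^bsup>(b-1)r\<^esup> w\<^bsub>a,b+1\<^esub>\<close>,

  \<open>x\<^sup>+\<^bsub>i,r\<^esub> w\<^bsub>a,b\<^esub> = [i = b - 1] q\<^bsup>(b-2)r\<^esup> w\<^bsub>a,b-1\<^esub> + [i = a - 1] g(n) q\<^bsup>ar\<^esup> w\<^bsub>a-1,b\<^esub>\<close>,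

  where \<open>g(n)\<close> is the eigenvalue of \<open>\<phi>\<close> on one box, evaluated at the spectral parameter at which
  the other box moves.  The two formulas correspond to each other under \<open>(a, b) \<mapsto> (-b, -a)\<close>, so
  that the relations among the \<open>x\<^sup>+\<close> and those among the \<open>x\<^sup>-\<close> are treated together.

  The quadratic relations amount to one exchange identity between \<open>g(n)\<close> and \<open>g(n + 1)\<close>
  (\<open>g_exchange\<close>), the Serre relations to \<open>g(n) + g(n + 1) = q + q\<^sup>-\<^sup>1\<close> for \<open>n\<close> divisible by 4
  (\<open>g_serre\<close>).  The commutator of \<open>x\<^sup>+\<close> and \<open>x\<^sup>-\<close> is diagonal because the moves of different boxes
  commute, and its diagonal entries are the residues of the eigenvalue of \<open>\<phi>\<^sub>i\<close>, which \<open>jump_pair\<close>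
  computes by partial fractions.

  The \<open>h\<^bsub>i,m\<^esub>\<close> act diagonally, by the power sums \<open>\<Sum>\<^sub>l u\<^bsub>i,l\<^esub> q\<^bsup>lm\<^esup>\<close> of the exponents of \<open>M(a,b)\<close> up to
  a factor depending on \<open>m\<close> alone.  Exponentiating gives the rational functions that the monomial prescribes for \<open>\<phi>\<close>
  (\<open>monomial_eigenvalue_eq\<close>).  As \<open>q\<close> is not a root of unity, the powers of \<open>q\<close> are distinct, and a
  Vandermonde argument recovers the monomial from its power sums (\<open>h_eigenvalue_inj\<close>).  Since
  \<open>(a, b) \<mapsto> M(a,b)\<close> is injective on \<open>b \<le> a\<close>, the joint spectrum is simple and every non-zero
  \<open>V\<^sub>m\<close> is a line.

  It remains to see that the \<open>M(a,b)\<close> with \<open>b \<le> a\<close> are the monomials of the crystal (\<open>Mbar_eq\<close>).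
  The crystal operators move one of the boxes by one step and respect \<open>b \<le> a\<close>; the generator with
  index \<open>s\<close> is \<open>M(1, 1 - 4s)\<close>, and \<open>M(a,b)\<close> is reached from the one with \<open>s = (a - b) div 4\<close>.
\<close>

section \<open>Linear operators and actions of the free algebra\<close>

type_synonym vec = "nat \<Rightarrow>\<^sub>0 complex"

abbreviation basis_vec :: "nat \<Rightarrow> vec" where
  "basis_vec k \<equiv> Poly_Mapping.single k 1"

abbreviation lookup where "lookup \<equiv> Poly_Mapping.lookup"
abbreviation keys where "keys \<equiv> Poly_Mapping.keys"

lemma lookup_fin_scale [simp]: "lookup (fin_scale c v) k = c * lookup v k"
  unfolding fin_scale_def by (simp add: Poly_Mapping.map.rep_eq when_def)

interpretation fin: vector_space fin_scale
  by standard (auto intro!: poly_mapping_eqI simp: lookup_add algebra_simps)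

lemma lookup_basis_vec: "lookup (basis_vec k) j = (if j = k then 1 else 0)"
  by (auto simp: lookup_single when_def)

abbreviation lin :: "(vec \<Rightarrow> vec) \<Rightarrow> bool" where
  "lin \<equiv> Vector_Spaces.linear fin_scale fin_scale"

lemma lin_iff: "lin f \<longleftrightarrow> (\<forall>u v. f (u + v) = f u + f v) \<and> (\<forall>c v. f (fin_scale c v) = fin_scale c (f v))"
  by (auto simp: Vector_Spaces.linear_iff fin.vector_space_axioms)

lemma lin_add: "lin f \<Longrightarrow> f (u + v) = f u + f v"
  and lin_scale: "lin f \<Longrightarrow> f (fin_scale c v) = fin_scale c (f v)"
  by (auto simp: lin_iff)

lemma lin_0: "lin f \<Longrightarrow> f 0 = 0"
  using lin_scale[of f 0 0] by simp

lemma lin_sum: "lin f \<Longrightarrow> f (sum g A) = (\<Sum>a\<in>A. f (g a))"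
  by (induction A rule: infinite_finite_induct) (auto simp: lin_0 lin_add)

lemma vec_expand: "v = (\<Sum>k\<in>keys v. fin_scale (lookup v k) (basis_vec k))"
  by (rule poly_mapping_eqI) (auto simp: lookup_sum lookup_basis_vec in_keys_iff mult_delta_right)

lemma lin_eqI:
  assumes "lin f" "lin g" "\<And>k. f (basis_vec k) = g (basis_vec k)"
  shows "f v = g v"
proof -
  have "f v = f (\<Sum>k\<in>keys v. fin_scale (lookup v k) (basis_vec k))" using vec_expand[of v] by simp
  also have "\<dots> = (\<Sum>k\<in>keys v. fin_scale (lookup v k) (g (basis_vec k)))"
    using assms by (simp add: lin_sum lin_scale)
  also have "\<dots> = g (\<Sum>k\<in>keys v. fin_scale (lookup v k) (basis_vec k))"
    using assms by (simp add: lin_sum lin_scale)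
  also have "\<dots> = g v" using vec_expand[of v] by simp
  finally show ?thesis .
qed

definition linext :: "(nat \<Rightarrow> vec) \<Rightarrow> vec \<Rightarrow> vec" where
  "linext u v = (\<Sum>k\<in>keys v. fin_scale (lookup v k) (u k))"

lemma linext_superset: "finite S \<Longrightarrow> keys v \<subseteq> S \<Longrightarrow> linext u v = (\<Sum>k\<in>S. fin_scale (lookup v k) (u k))"
  unfolding linext_def by (rule sum.mono_neutral_left) (auto simp: in_keys_iff)

lemma lin_linext: "lin (linext u)"
proof -
  have "linext u (v + w) = linext u v + linext u w" for v w
    using keys_add[of v w]
    by (simp add: linext_superset[of "keys v \<union> keys w"] lookup_add fin.scale_left_distrib sum.distrib)
  moreover have "linext u (fin_scale c v) = fin_scale c (linext u v)" for c v
    by (subst linext_superset[of "keys v"])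
      (auto simp: linext_def in_keys_iff fin.scale_sum_right)
  ultimately show ?thesis by (simp add: lin_iff)
qed

lemma linext_basis [simp]: "linext u (basis_vec k) = u k"
  by (simp add: linext_def)

definition diag :: "(nat \<Rightarrow> complex) \<Rightarrow> vec \<Rightarrow> vec" where
  "diag f = linext (\<lambda>k. fin_scale (f k) (basis_vec k))"

lemma lin_diag: "lin (diag f)"
  by (simp add: diag_def lin_linext)

lemma lookup_diag: "lookup (diag f v) k = f k * lookup v k"
  by (auto simp: diag_def linext_def lookup_sum lookup_basis_vec in_keys_iff mult_delta_right)

lemma diag_basis: "diag f (basis_vec k) = fin_scale (f k) (basis_vec k)"
  by (simp add: diag_def)

fun word_act :: "('g \<Rightarrow> vec \<Rightarrow> vec) \<Rightarrow> 'g list \<Rightarrow> vec \<Rightarrow> vec" where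
  "word_act G [] = id"
| "word_act G (g # gs) = G g \<circ> word_act G gs"

definition alg_act :: "('g \<Rightarrow> vec \<Rightarrow> vec) \<Rightarrow> ('g free_monoid \<Rightarrow>\<^sub>0 complex) \<Rightarrow> vec \<Rightarrow> vec" where
  "alg_act G a v = (\<Sum>w\<in>keys a. fin_scale (lookup a w) (word_act G (letters w) v))"

lemma word_act_append: "word_act G (u @ w) v = word_act G u (word_act G w v)"
  by (induction u) auto

lemma alg_act_superset:
  "finite S \<Longrightarrow> keys a \<subseteq> S \<Longrightarrow> alg_act G a v = (\<Sum>w\<in>S. fin_scale (lookup a w) (word_act G (letters w) v))"
  unfolding alg_act_def by (rule sum.mono_neutral_left) (auto simp: in_keys_iff)

lemma alg_act_add: "alg_act G (a + b) v = alg_act G a v + alg_act G b v"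
  using keys_add[of a b]
  by (simp add: alg_act_superset[of "keys a \<union> keys b"] lookup_add fin.scale_left_distrib sum.distrib)

lemma alg_act_0 [simp]: "alg_act G 0 v = 0"
  by (simp add: alg_act_def)

lemma alg_act_uminus: "alg_act G (- a) v = - alg_act G a v"
  using alg_act_add[of G a "- a" v] by (simp add: eq_neg_iff_add_eq_0 add.commute)

lemma alg_act_diff: "alg_act G (a - b) v = alg_act G a v - alg_act G b v"
  using alg_act_add[of G a "- b" v] by (simp add: alg_act_uminus)

lemma alg_act_sum: "alg_act G (sum f A) v = (\<Sum>x\<in>A. alg_act G (f x) v)"
  by (induction A rule: infinite_finite_induct) (auto simp: alg_act_add)

lemma alg_act_single: "alg_act G (Poly_Mapping.single w c) v = fin_scale c (word_act G (letters w) v)"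
  by (simp add: alg_act_def)

lemma alg_act_gen: "alg_act G (gen g) v = G g v"
  by (simp add: alg_act_single gen_def)

lemma alg_act_scal: "alg_act G (scal c) v = fin_scale c v"
  by (simp add: alg_act_single scal_def zero_free_monoid_def)

lemma alg_act_1: "alg_act G 1 v = v"
  using alg_act_single[of G 0 1 v] unfolding single_one by (simp add: zero_free_monoid_def)

lemma poly_mapping_add_induct [case_names single add]:
  fixes a :: "'a \<Rightarrow>\<^sub>0 'b::ab_group_add"
  assumes "\<And>w c. P (Poly_Mapping.single w c)" "\<And>a b. P a \<Longrightarrow> P b \<Longrightarrow> P (a + b)"
  shows "P a"
proof (induction a rule: update_induct)
  case const
  show ?case using assms(1)[of undefined 0] by simp
next
  case (update f a b)
  have "Poly_Mapping.update a b f = Poly_Mapping.single a b + f"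
    using update(1)
    by (intro poly_mapping_eqI) (auto simp: lookup_update lookup_add lookup_single when_def in_keys_iff)
  then show ?case using assms update by simp
qed

context
  fixes G :: "'g \<Rightarrow> vec \<Rightarrow> vec"
  assumes lin_G: "\<And>g. lin (G g)"
begin

lemma lin_word_act: "lin (word_act G w)"
  using lin_G by (induction w) (auto simp: lin_iff)

lemma lin_alg_act: "lin (alg_act G a)"
  unfolding lin_iff alg_act_def
  by (auto simp: lin_add[OF lin_word_act] lin_scale[OF lin_word_act] fin.scale_right_distrib
      sum.distrib fin.scale_sum_right mult.commute)

lemma alg_act_mult: "alg_act G (a * b) v = alg_act G a (alg_act G b v)"
proof (induction a rule: poly_mapping_add_induct)
  case (single w c)
  show ?case
  proof (induction b rule: poly_mapping_add_induct)
    case (single w' c')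
    show ?case
      by (simp add: mult_single alg_act_single plus_free_monoid_def word_act_append
          lin_scale[OF lin_word_act])
  next
    case (add a b)
    then show ?case by (simp add: distrib_left alg_act_add lin_add[OF lin_alg_act])
  qed
next
  case (add a b)
  then show ?case by (simp add: distrib_right alg_act_add)
qed

end

section \<open>Passing to the quotient algebra\<close>

lemma ring_free_ring: "ring free_ring"
  unfolding free_ring_def
  by (rule ringI; (rule abelian_groupI)?; (rule monoidI)?) 
    (auto simp: algebra_simps intro: exI[of _ "- x" for x])

lemma free_ring_simps [simp]:
  "carrier free_ring = UNIV" "mult free_ring = (*)" "one free_ring = 1" "zero free_ring = 0" "add free_ring = (+)"
  by (auto simp: free_ring_def)

text \<open>The choice of the representative \<open>a\<close> does not matter as soon as the relations act by zero; see
  \<open>quotient_act_cls\<close>.\<close>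

definition quotient_act :: "complex \<Rightarrow> (generator \<Rightarrow> vec \<Rightarrow> vec) \<Rightarrow> free_alg set \<Rightarrow> vec \<Rightarrow> vec" where
  "quotient_act t G X = alg_act G (SOME a. X = cls t a)"

lemma ideal_toroidal: "ideal (toroidal_ideal t) free_ring"
  unfolding toroidal_ideal_def by (rule ring.genideal_ideal[OF ring_free_ring]) simp

lemma carrier_toroidal: "carrier (toroidal t) = range (cls t)"
  by (auto simp: toroidal_def FactRing_def A_RCOSETS_def' cls_def)

lemma toroidal_ops:
  "cls t a \<otimes>\<^bsub>toroidal t\<^esub> cls t b = cls t (a * b)"
  "cls t a \<oplus>\<^bsub>toroidal t\<^esub> cls t b = cls t (a + b)"
  "\<one>\<^bsub>toroidal t\<^esub> = cls t 1"
proof -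
  interpret ideal "toroidal_ideal t" free_ring by (rule ideal_toroidal)
  show "cls t a \<otimes>\<^bsub>toroidal t\<^esub> cls t b = cls t (a * b)"
    using rcoset_mult_add[of a b] by (simp add: toroidal_def FactRing_def cls_def)
  show "cls t a \<oplus>\<^bsub>toroidal t\<^esub> cls t b = cls t (a + b)"
    using a_rcos_sum[of a b] by (simp add: toroidal_def FactRing_def cls_def)
  show "\<one>\<^bsub>toroidal t\<^esub> = cls t 1"
    by (simp add: toroidal_def FactRing_def cls_def)
qed

lemma ring_toroidal: "ring (toroidal t)"
  unfolding toroidal_def by (rule ideal.quotient_is_ring[OF ideal_toroidal])

locale generator_action =
  fixes t :: complex and G :: "generator \<Rightarrow> vec \<Rightarrow> vec"
  assumes lin_G: "\<And>g. lin (G g)"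
    and relations: "\<And>a v. a \<in> toroidal_relations t \<Longrightarrow> alg_act G a v = 0"
begin

text \<open>The elements acting by zero form a two-sided ideal, which contains the relations.\<close>

lemma alg_act_ideal: "a \<in> toroidal_ideal t \<Longrightarrow> alg_act G a v = 0"
proof -
  interpret ring free_ring by (rule ring_free_ring)
  have "ideal {a. \<forall>v. alg_act G a v = 0} free_ring"
  proof (rule idealI)
    show "subgroup {a. \<forall>v. alg_act G a v = 0} (add_monoid free_ring)"
    proof (rule add.subgroupI)
      fix a assume "a \<in> {a. \<forall>v. alg_act G a v = 0}"
      moreover have "\<ominus>\<^bsub>free_ring\<^esub> a = - a"
        by (rule minus_equality) auto
      ultimately show "\<ominus>\<^bsub>free_ring\<^esub> a \<in> {a. \<forall>v. alg_act G a v = 0}"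
        by (simp add: alg_act_uminus)
    qed (auto simp: alg_act_add intro: exI[of _ 0])
  qed (auto simp: alg_act_mult[OF lin_G] lin_0[OF lin_alg_act[OF lin_G]] ring_axioms)
  then have "toroidal_ideal t \<subseteq> {a. \<forall>v. alg_act G a v = 0}"
    unfolding toroidal_ideal_def using relations by (intro genideal_minimal) auto
  then show "a \<in> toroidal_ideal t \<Longrightarrow> alg_act G a v = 0" by auto
qed

lemma quotient_act_cls: "quotient_act t G (cls t a) = alg_act G a"
proof -
  define b where "b = (SOME b. cls t a = cls t b)"
  have "cls t a = cls t b" unfolding b_def by (rule someI[of _ a]) simp
  moreover have "b \<in> cls t b"
    using additive_subgroup.zero_closed[OF ideal.axioms(1)[OF ideal_toroidal]]
    by (auto simp: cls_def a_r_coset_def' intro!: bexI[of _ 0])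
  ultimately have "b \<in> toroidal_ideal t +>\<^bsub>free_ring\<^esub> a"
    by (simp add: cls_def)
  then obtain h where "h \<in> toroidal_ideal t" "b = h + a"
    by (auto simp: a_r_coset_def')
  then have "alg_act G b v = alg_act G a v" for v by (simp add: alg_act_add alg_act_ideal)
  then show ?thesis by (auto simp: quotient_act_def b_def)
qed

lemma quotient_act_hom: "quotient_act t G \<in> ring_hom (toroidal t) (End_ring fin_scale)"
  by (rule ring_hom_memI)
    (auto simp: carrier_toroidal quotient_act_cls toroidal_ops End_ring_def lin_alg_act[OF lin_G]
      alg_act_mult[OF lin_G] alg_act_add alg_act_1 fun_eq_iff)

lemma representation_quotient_act: "representation t fin_scale (quotient_act t G)"
  unfolding representation_def
  by (auto simp: quotient_act_hom fin.vector_space_axioms quotient_act_cls alg_act_scal fun_eq_iff)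

end

section \<open>Exponentials of power series\<close>

abbreviation fps_coefficient :: "'a fps \<Rightarrow> nat \<Rightarrow> 'a" (infixl "$$" 75) where
  "f $$ n \<equiv> fps_nth f n"

text \<open>The composition \<open>exp \<circ> f\<close>.  Over \<open>\<complex>\<close> it has the coefficients by which \<open>series_exp\<close> is defined, and it
  can be handled through its differential equation \<open>fexp_deriv\<close>.\<close>

definition fexp :: "complex fps \<Rightarrow> complex fps" where
  "fexp f = fps_compose (fps_exp 1) f"

lemma fexp_nth: "fexp f $$ n = (\<Sum>k\<le>n. 1 / fact k * (f ^ k) $$ n)"
  by (simp add: fexp_def fps_compose_nth atLeast0AtMost)

lemma fexp_nth_0 [simp]: "fexp f $$ 0 = 1"
  by (simp add: fexp_def)

lemma fexp_deriv: "f $$ 0 = 0 \<Longrightarrow> fps_deriv (fexp f) = fexp f * fps_deriv f"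
  by (simp add: fexp_def fps_compose_deriv)

lemma fps_deriv_0_eq_1: "fps_deriv f = 0 \<Longrightarrow> f $$ 0 = 1 \<Longrightarrow> f = (1 :: complex fps)"
  by simp

lemma fexp_0 [simp]: "fexp 0 = 1"
  by (intro fps_deriv_0_eq_1) (simp_all add: fexp_deriv)

lemma fexp_minus: assumes "f $$ 0 = 0" shows "fexp f * fexp (- f) = 1"
  using assms by (intro fps_deriv_0_eq_1) (simp_all add: fexp_deriv algebra_simps)

text \<open>The product \<open>exp f \<cdot> exp g \<cdot> exp (-(f + g))\<close> has derivative zero and constant term 1.\<close>

lemma fexp_add:
  assumes "f $$ 0 = 0" "g $$ 0 = 0"
  shows "fexp (f + g) = fexp f * fexp g"
proof -
  have 1: "fexp f * fexp g * fexp (- (f + g)) = 1"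
    using assms by (intro fps_deriv_0_eq_1) (simp_all add: fexp_deriv algebra_simps)
  have 2: "fexp (f + g) * fexp (- (f + g)) = 1"
    using assms by (intro fexp_minus) simp
  have "fexp (f + g) = fexp (f + g) * (fexp f * fexp g * fexp (- (f + g)))" by (simp only: 1 mult_1_right)
  also have "\<dots> = fexp f * fexp g * (fexp (f + g) * fexp (- (f + g)))" by (simp only: mult_ac)
  finally show ?thesis by (simp only: 2 mult_1_right)
qed

lemma fexp_sum:
  assumes "\<And>x. x \<in> A \<Longrightarrow> f x $$ 0 = 0"
  shows "fexp (\<Sum>x\<in>A. f x) = (\<Prod>x\<in>A. fexp (f x))"
  using assms by (induction A rule: infinite_finite_induct) (auto simp: fexp_add fps_sum_nth)

lemma fexp_of_nat_mult:
  assumes "f $$ 0 = 0"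
  shows "fexp (of_nat n * f) = fexp f ^ n"
  using assms by (induction n) (simp_all add: ring_distribs fexp_add)

lemma fexp_inj:
  assumes "fexp f = fexp g" "f $$ 0 = 0" "g $$ 0 = 0"
  shows "f = g"
proof -
  have "fexp f \<noteq> 0" by (metis fexp_nth_0 fps_zero_nth zero_neq_one)
  then have "fps_deriv f = fps_deriv g"
    using assms fexp_deriv[of f] fexp_deriv[of g] by auto
  then show ?thesis using assms by (simp add: fps_deriv_eq_iff)
qed

text \<open>The series \<open>-log (1 - c X)\<close>; the division by zero makes its constant term vanish.\<close>

definition flog :: "complex \<Rightarrow> complex fps" where
  "flog c = Abs_fps (\<lambda>n. c ^ n / of_nat n)"

lemma flog_nth [simp]: "flog c $$ n = c ^ n / of_nat n"
  by (simp add: flog_def)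

lemma fexp_flog: "fexp (flog c) * (1 - fps_const c * fps_X) = 1"
proof (rule fps_deriv_0_eq_1)
  have "fps_deriv (flog c) * (1 - fps_const c * fps_X) = fps_const c"
  proof (rule fps_ext)
    fix n
    have "fps_deriv (flog c) $$ k = c ^ Suc k" for k
      by (simp del: of_nat_Suc power_Suc)
    then show "(fps_deriv (flog c) * (1 - fps_const c * fps_X)) $$ n = fps_const c $$ n"
      by (cases n) (simp_all add: right_diff_distrib mult.left_commute[of _ "fps_const c"] del: fps_deriv_nth)
  qed
  then have *: "fexp (flog c) * (fps_deriv (flog c) * (1 - fps_const c * fps_X)) = fexp (flog c) * fps_const c"
    by simp
  then show "fps_deriv (fexp (flog c) * (1 - fps_const c * fps_X)) = 0"
    by (simp add: fexp_deriv algebra_simps)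
qed simp

lemma fexp_minus_flog: "fexp (- flog c) = 1 - fps_const c * fps_X"
proof -
  have "fexp (- flog c) = fexp (- flog c) * (fexp (flog c) * (1 - fps_const c * fps_X))"
    by (simp add: fexp_flog)
  also have "\<dots> = fexp (flog c) * fexp (- flog c) * (1 - fps_const c * fps_X)"
    by (simp add: mult_ac)
  finally show ?thesis by (simp add: fexp_minus)
qed

lemma inverse_geometric: "inverse (1 - fps_const c * fps_X) = fexp (flog c)"
  using fexp_flog[of c] by (intro fps_inverse_unique) (simp add: mult.commute)

section \<open>Powers of \<open>q\<close>\<close>

lemma qpow_of_int: "qpow t (of_int k) = exp t powi k"
  by (simp add: qpow_def exp_power_int mult.commute)

lemma qpow_add: "qpow t (x + y) = qpow t x * qpow t y"
  by (simp add: qpow_def of_rat_add ring_distribs exp_add)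

lemma qpow_0 [simp]: "qpow t 0 = 1"
  by (simp add: qpow_def)

lemma qpow_1: "qpow t 1 = exp t" 
  by (simp add: qpow_def)

lemma qpow_neg1: "qpow t (-1) = inverse (exp t)"
  by (simp add: qpow_def exp_minus of_rat_minus)

lemma qpow_nz [simp]: "qpow t x \<noteq> 0"
  by (simp add: qpow_def)

lemma qpow_uminus: "qpow t (- x) = inverse (qpow t x)"
  by (simp add: qpow_def of_rat_minus exp_minus)

lemma sg_nz [simp]: "sg s \<noteq> 0"
  by (cases s) simp_all

locale generic =
  fixes t :: complex
  assumes not_root: "\<forall>n::nat. n > 0 \<longrightarrow> exp t ^ n \<noteq> 1"
begin

definition q :: complex where "q = exp t"

lemma q_nz [simp]: "q \<noteq> 0" by (simp add: q_def)

lemma qpow_int: "qpow t (of_int k) = q powi k"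
  by (simp add: q_def qpow_of_int)

lemma powi_add: "q powi (k + l) = q powi k * q powi l"
  by (simp add: power_int_add)

lemma powi_sum: "q powi (\<Sum>x\<in>A. f x) = (\<Prod>x\<in>A. q powi f x)"
  by (induction A rule: infinite_finite_induct) (simp_all add: powi_add)

lemma powi_eq_1_iff [simp]: "q powi k = 1 \<longleftrightarrow> k = 0"
proof
  assume *: "q powi k = 1"
  show "k = 0"
  proof (rule ccontr)
    assume "k \<noteq> 0"
    then consider "k > 0" | "k < 0" by linarith
    then show False
    proof cases
      case 1
      then show False using * not_root[rule_format, of "nat k"] by (simp add: power_int_def q_def)
    next
      case 2
      then show False using * not_root[rule_format, of "nat (- k)"]
        by (simp add: power_int_def q_def power_inverse)
    qed
  qed
qed simp

lemma powi_inj [simp]: "q powi k = q powi l \<longleftrightarrow> k = l"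
  using powi_eq_1_iff[of "k - l"] by (simp add: power_int_diff del: powi_eq_1_iff)

definition qq :: complex where "qq = q - inverse q"

lemma qq_nz [simp]: "qq \<noteq> 0"
  using powi_eq_1_iff[of 2] by (auto simp: qq_def field_simps power2_eq_square)

lemma qpow_qq: "qpow t 1 - qpow t (- 1) = qq"
  by (simp add: qq_def qpow_1 qpow_neg1 q_def)

lemma qnum_eq: "qnum t k = (q powi k - q powi (- k)) / qq"
  unfolding qnum_def qpow_qq by (simp only: qpow_int)

lemma qnum_nz: "k \<noteq> 0 \<Longrightarrow> qnum t k \<noteq> 0"
  by (simp add: qnum_eq)

section \<open>Eigenvalues attached to a monomial\<close>

text \<open>The eigenvalue of \<open>h\<^bsub>i,n\<^esub>\<close>.  It is forced by the eigenvalue of \<open>\<phi>\<^sub>i(z)\<close>: the logarithm of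
  \<open>(1 - z q\<^bsup>l-1\<^esup>) / (1 - z q\<^bsup>l+1\<^esup>)\<close> has \<open>n\<close>-th coefficient \<open>q\<^bsup>ln\<^esup> (q\<^sup>n - q\<^bsup>-n\<^esup>) / n\<close>.\<close>

definition h_eigenvalue :: "4 \<Rightarrow> int \<Rightarrow> monomial \<Rightarrow> complex" where
  "h_eigenvalue i n m = (\<Sum>l | expo m i l \<noteq> 0. of_int (expo m i l) * q powi (l * n)) * qnum t n / of_int n"

definition log_eigenvalue :: "sgn \<Rightarrow> 4 \<Rightarrow> monomial \<Rightarrow> complex fps" where
  "log_eigenvalue s i m = Abs_fps (\<lambda>n. if n = 0 then 0 else of_int (sg s) * qq * h_eigenvalue i (sg s * int n) m)"

definition Y_log :: "sgn \<Rightarrow> int \<Rightarrow> complex fps" where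
  "Y_log s l = flog (q powi (sg s * (l + 1))) - flog (q powi (sg s * (l - 1)))"

lemma Y_log_0 [simp]: "Y_log s l $$ 0 = 0"
  by (simp add: Y_log_def)

text \<open>For the minus sign both \<open>w - q\<^bsup>l-1\<^esup>\<close> and \<open>w - q\<^bsup>l+1\<^esup>\<close> are normalised to constant term 1, which produces the
  factor \<open>q \<cdot> q\<^bsup>l-1\<^esup> \<cdot> q\<^bsup>-l-1\<^esup> = q\<^sup>-\<^sup>1\<close>; the exponents then only change sign.\<close>

lemma Y_eigenvalue_eq: "Y_eigenvalue t s l = fps_const (q powi sg s) * fexp (Y_log s l)"
proof -
  have *: "fexp (Y_log s l) = (1 - fps_const (q powi (sg s * (l - 1))) * fps_X) * inverse (1 - fps_const (q powi (sg s * (l + 1))) * fps_X)"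
  proof -
    have "fexp (Y_log s l) = fexp (flog (q powi (sg s * (l + 1)))) * fexp (- flog (q powi (sg s * (l - 1))))"
      unfolding Y_log_def diff_conv_add_uminus by (rule fexp_add) simp_all
    then show ?thesis unfolding fexp_minus_flog inverse_geometric by (simp only: mult.commute)
  qed
  show ?thesis
  proof (cases s)
    case PlusS
    then show ?thesis unfolding * by (simp only: Y_eigenvalue.simps qpow_int) (simp add: qpow_1 q_def mult_ac)
  next
    case MinusS
    have fac: "fps_X - fps_const (q powi k) = - fps_const (q powi k) * (1 - fps_const (q powi (- k)) * fps_X)" for k
      by (rule fps_ext) (auto simp: power_int_minus ring_distribs fps_X_def)
    have inv: "inverse (- fps_const (q powi k) * f) = - fps_const (q powi (- k)) * inverse f" for k and f :: "complex fps"
      by (subst fps_inverse_mult) (simp add: fps_const_neg fps_const_inverse power_int_minus flip: fps_const_neg)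
    have "q powi (- 1) = q powi (1 + ((l - 1) + - (l + 1)))" by simp
    also have "\<dots> = q * (q powi (l - 1) * q powi (- (l + 1)))" unfolding powi_add by simp
    finally have c: "q * (q powi (l - 1) * q powi (- (l + 1))) = q powi (- 1)" by simp
    have "Y_eigenvalue t MinusS l = fps_const q * (fps_X - fps_const (q powi (l - 1))) * inverse (fps_X - fps_const (q powi (l + 1)))"
      by (simp only: Y_eigenvalue.simps qpow_int) (simp add: qpow_1 q_def)
    also have "\<dots> = fps_const (q * (q powi (l - 1) * q powi (- (l + 1)))) * ((1 - fps_const (q powi (- (l - 1))) * fps_X) * inverse (1 - fps_const (q powi (- (l + 1))) * fps_X))"
      unfolding fac inv by (simp add: mult_ac flip: fps_const_mult)
    finally show ?thesis unfolding * c using MinusS by simp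
  qed
qed

lemma inverse_Y_eigenvalue: "inverse (Y_eigenvalue t s l) = fps_const (q powi (- sg s)) * fexp (- Y_log s l)"
proof (rule fps_inverse_unique)
  have "Y_eigenvalue t s l * (fps_const (q powi (- sg s)) * fexp (- Y_log s l)) =
    (fps_const (q powi sg s) * fps_const (q powi (- sg s))) * (fexp (Y_log s l) * fexp (- Y_log s l))"
    unfolding Y_eigenvalue_eq by (simp only: mult_ac)
  then show "Y_eigenvalue t s l * (fps_const (q powi (- sg s)) * fexp (- Y_log s l)) = 1"
    by (simp add: fexp_minus power_int_minus)
qed

text \<open>Power series do not form a field, so that negative exponents are reduced to \<open>inverse_Y_eigenvalue\<close>.\<close>

lemma Y_eigenvalue_powi:
  "Y_eigenvalue t s l powi k = fps_const (q powi (sg s * k)) * fexp (of_int k * Y_log s l)"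
proof (cases "k \<ge> 0")
  case True
  then obtain n where k: "k = int n" using nonneg_int_cases by blast
  show ?thesis
    by (simp add: k Y_eigenvalue_eq power_mult_distrib fexp_of_nat_mult power_int_mult)
next
  case False
  then obtain n where k: "k = - int n" by (metis int_cases4 linorder_not_le order_less_imp_le of_nat_0_le_iff)
  have "Y_eigenvalue t s l powi k = inverse (Y_eigenvalue t s l) ^ n"
    using False by (simp add: k power_int_def)
  also have "\<dots> = fps_const ((q powi (- sg s)) ^ n) * fexp (of_nat n * - Y_log s l)"
    unfolding inverse_Y_eigenvalue power_mult_distrib by (subst fexp_of_nat_mult) simp_all
  also have "(q powi (- sg s)) ^ n = q powi (sg s * k)"
    by (simp add: k power_int_mult power_int_minus power_inverse)
  finally show ?thesis by (simp add: k)
qed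

lemma log_eigenvalue_sum:
  "log_eigenvalue s i m = (\<Sum>l | expo m i l \<noteq> 0. of_int (expo m i l) * Y_log s l)"
proof (rule fps_ext)
  fix n
  show "log_eigenvalue s i m $$ n = (\<Sum>l | expo m i l \<noteq> 0. of_int (expo m i l) * Y_log s l) $$ n"
  proof (cases "n = 0")
    case True
    then show ?thesis by (simp add: log_eigenvalue_def fps_sum_nth)
  next
    case False
    have 1: "(of_int u * Y_log s l) $$ n = of_int u * Y_log s l $$ n" for u l
      by (simp flip: fps_of_int)
    have 2: "Y_log s l $$ n = of_int (sg s) * (q powi (l * (sg s * int n)) * qq * qnum t (sg s * int n) / of_int (sg s * int n))" for l
    proof -
      have pw: "(q powi (sg s * k)) ^ n = q powi (k * (sg s * int n))" for k
        by (metis mult.assoc mult.commute power_int_mult power_int_of_nat)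
      have "(q powi (sg s * (l + 1))) ^ n = q powi (l * (sg s * int n)) * q powi (sg s * int n)"
        "(q powi (sg s * (l - 1))) ^ n = q powi (l * (sg s * int n)) * q powi (- (sg s * int n))"
        unfolding pw powi_add[symmetric] by (simp_all add: algebra_simps)
      then have "Y_log s l $$ n = q powi (l * (sg s * int n)) * (q powi (sg s * int n) - q powi (- (sg s * int n))) / of_nat n"
        by (simp add: Y_log_def right_diff_distrib diff_divide_distrib)
      also have "q powi (sg s * int n) - q powi (- (sg s * int n)) = qq * qnum t (sg s * int n)"
        by (simp add: qnum_eq)
      finally show ?thesis using False by (cases s) simp_all
    qed
    show ?thesis using False
      by (simp add: log_eigenvalue_def fps_sum_nth h_eigenvalue_def 1 2 sum_distrib_left sum_distrib_right sum_divide_distrib algebra_simps)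
  qed
qed

lemma log_eigenvalue_0 [simp]: "log_eigenvalue s i m $$ 0 = 0"
  by (simp add: log_eigenvalue_def)

lemma monomials_finite: "m \<in> monomials \<Longrightarrow> finite {l. expo m i l \<noteq> 0}"
proof -
  assume "m \<in> monomials"
  then have "finite (snd ` {(i, l). expo m i l \<noteq> 0})" by (auto simp: monomials_def)
  moreover have "{l. expo m i l \<noteq> 0} \<subseteq> snd ` {(i, l). expo m i l \<noteq> 0}" by force
  ultimately show ?thesis by (rule finite_subset[rotated])
qed

lemma monomial_eigenvalue_eq:
  assumes "m \<in> monomials"
  shows "monomial_eigenvalue t s m i =
    fps_const (qpow t (of_int (sg s) * wt m (coroot i))) * fexp (log_eigenvalue s i m)"
proof -
  let ?S = "{l. expo m i l \<noteq> 0}"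
  have pc: "(\<Prod>l\<in>A. fps_const (f l)) = fps_const (\<Prod>l\<in>A. f l)" for A :: "int set" and f :: "int \<Rightarrow> complex"
    by (induction A rule: infinite_finite_induct) auto
  have "wt m (coroot i) = of_int (\<Sum>l\<in>?S. expo m i l)" using assms by (simp add: monomials_def)
  then have "qpow t (of_int (sg s) * wt m (coroot i)) = q powi (sg s * (\<Sum>l\<in>?S. expo m i l))"
    using qpow_int[of "sg s * (\<Sum>l\<in>?S. expo m i l)"] by simp
  also have "\<dots> = (\<Prod>l\<in>?S. q powi (sg s * expo m i l))"
    by (simp add: sum_distrib_left powi_sum)
  finally show ?thesis
    unfolding monomial_eigenvalue_def log_eigenvalue_sum
    by (simp add: Y_eigenvalue_powi prod.distrib pc fexp_sum)
qed

section \<open>A monomial is determined by its eigenvalues\<close>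

text \<open>A Vandermonde argument: by linearity \<open>\<Sum> e\<^sub>x c\<^sub>x p(c\<^sub>x) = 0\<close> for all polynomials \<open>p\<close>, and \<open>p\<close> can be
  chosen to vanish at all the points except one.\<close>

lemma power_sums_zero:
  fixes e :: "'a \<Rightarrow> complex"
  assumes "finite S" "inj_on c S" "\<And>n. n > 0 \<Longrightarrow> (\<Sum>x\<in>S. e x * c x ^ n) = 0" "x \<in> S" "c x \<noteq> 0"
  shows "e x = 0"
proof -
  have P: "(\<Sum>x\<in>S. e x * c x * poly p (c x)) = 0" for p
  proof -
    have "(\<Sum>x\<in>S. e x * c x * poly p (c x)) = (\<Sum>x\<in>S. \<Sum>k\<le>degree p. Polynomial.coeff p k * (e x * c x ^ Suc k))"
      by (simp add: poly_altdef sum_distrib_left mult_ac)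
    also have "\<dots> = (\<Sum>k\<le>degree p. Polynomial.coeff p k * (\<Sum>x\<in>S. e x * c x ^ Suc k))"
      by (subst sum.swap) (simp add: sum_distrib_left)
    also have "\<dots> = 0" using assms(3)[of "Suc _"] by (simp del: power_Suc)
    finally show ?thesis .
  qed
  \<comment> \<open>The factor \<open>c\<^sub>x\<close> in front accounts for the missing equation for \<open>n = 0\<close>.\<close>
  define p where "p = (\<Prod>y\<in>S - {x}. [:- c y, 1:])"
  have "(\<Sum>y\<in>S. e y * c y * poly p (c y)) = (\<Sum>y\<in>S. if y = x then e x * c x * poly p (c x) else 0)"
    using assms(1) by (intro sum.cong) (auto simp: p_def poly_prod)
  also have "\<dots> = e x * c x * poly p (c x)" using assms by simp
  finally have "e x * c x * poly p (c x) = 0" using P by simp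
  moreover have "poly p (c x) \<noteq> 0"
    using assms by (auto simp: p_def poly_prod inj_on_def)
  ultimately show ?thesis using assms by simp
qed

lemma h_eigenvalue_inj:
  assumes "finite {l. expo m i l \<noteq> 0}" "finite {l. expo m' i l \<noteq> 0}"
    and "\<And>n. n > 0 \<Longrightarrow> h_eigenvalue i n m = h_eigenvalue i n m'"
  shows "expo m i l = expo m' i l"
proof -
  let ?S = "{l. expo m i l \<noteq> 0} \<union> {l. expo m' i l \<noteq> 0}"
  have ext: "(\<Sum>l | expo m i l \<noteq> 0. of_int (expo m i l) * q powi (l * n)) = (\<Sum>l\<in>?S. of_int (expo m i l) * q powi (l * n))"
    "(\<Sum>l | expo m' i l \<noteq> 0. of_int (expo m' i l) * q powi (l * n)) = (\<Sum>l\<in>?S. of_int (expo m' i l) * q powi (l * n))" for n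
    using assms(1,2) by (auto intro!: sum.mono_neutral_left)
  have "of_int (expo m i l - expo m' i l) = (0::complex)" if "l \<in> ?S"
  proof (rule power_sums_zero[where e = "\<lambda>l. of_int (expo m i l - expo m' i l)" and c = "\<lambda>l. q powi l"])
    fix n :: nat assume n: "n > 0"
    have "(\<Sum>l\<in>?S. of_int (expo m i l) * q powi (l * int n)) = (\<Sum>l\<in>?S. of_int (expo m' i l) * q powi (l * int n))"
      using assms(3)[of "int n"] qnum_nz[of "int n"] n unfolding h_eigenvalue_def ext by simp
    then show "(\<Sum>l\<in>?S. of_int (expo m i l - expo m' i l) * (q powi l) ^ n) = 0"
      by (simp add: power_int_mult ring_distribs sum_subtractf)
  qed (use assms that in \<open>auto simp: inj_on_def\<close>)
  then show ?thesis by (cases "l \<in> ?S") auto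
qed

text \<open>For \<open>x \<noteq> 0\<close> the scaling \<open>c = 1 / x\<close> would give \<open>q = 1\<close>.\<close>

lemma qpow_inj_scaled:
  assumes "\<And>c. qpow t (c * x) = 1"
  shows "x = 0"
proof (rule ccontr)
  assume x: "x \<noteq> 0"
  have "qpow t 1 = 1" using assms[of "1 / x"] x by simp
  then show False using not_root[rule_format, of 1] by (simp add: qpow_1)
qed

text \<open>Evaluating at all rational multiples of \<open>h\<close> excludes that \<open>\<nu>(h)\<close> and \<open>\<nu>'(h)\<close> differ by a period of
  \<open>x \<mapsto> q\<^sup>x\<close>.\<close>

lemma weight_inj:
  assumes "\<nu> \<in> weight_lattice" "\<nu>' \<in> weight_lattice" "\<And>h. qpow t (\<nu> h) = qpow t (\<nu>' h)"
  shows "\<nu> = \<nu>'"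
proof
  fix h
  have "qpow t (c * (\<nu> h - \<nu>' h)) = 1" for c
  proof -
    have "c * \<nu> h = \<nu> (cartan_scale c h)" "c * \<nu>' h = \<nu>' (cartan_scale c h)"
      using assms(1,2) by (cases h; simp add: weight_lattice_def Vector_Spaces.linear_iff)+
    then have "c * (\<nu> h - \<nu>' h) = \<nu> (cartan_scale c h) + - \<nu>' (cartan_scale c h)"
      by (simp add: algebra_simps)
    then show ?thesis by (simp only: qpow_add qpow_uminus assms(3)) simp
  qed
  then show "\<nu> h = \<nu>' h" using qpow_inj_scaled[of "\<nu> h - \<nu>' h"] by simp
qed

lemma monomial_determined:
  assumes "m \<in> monomials" "m' \<in> monomials" "\<And>h. qpow t (wt m h) = qpow t (wt m' h)"
    and "\<And>i n. monomial_eigenvalue t PlusS m i $$ n = monomial_eigenvalue t PlusS m' i $$ n"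
  shows "m = m'"
proof (rule monomial.expand, intro conjI)
  show w: "wt m = wt m'" using assms by (intro weight_inj) (auto simp: monomials_def)
  show "expo m = expo m'"
  proof (intro ext)
    fix i l
    have "monomial_eigenvalue t PlusS m i = monomial_eigenvalue t PlusS m' i"
      using assms(4) by (intro fps_ext)
    then have "fexp (log_eigenvalue PlusS i m) = fexp (log_eigenvalue PlusS i m')"
      using assms(1,2) w by (simp add: monomial_eigenvalue_eq)
    then have e: "log_eigenvalue PlusS i m = log_eigenvalue PlusS i m'" by (rule fexp_inj) simp_all
    show "expo m i l = expo m' i l"
    proof (rule h_eigenvalue_inj)
      fix n :: int assume "n > 0"
      then show "h_eigenvalue i n m = h_eigenvalue i n m'"
        using arg_cong[OF e, of "\<lambda>f. f $$ nat n"] by (simp add: log_eigenvalue_def)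
    qed (use assms monomials_finite in auto)
  qed
qed

end

section \<open>The monomial crystal\<close>

lemma exhaust4: "(x::4) = 0 \<or> x = 1 \<or> x = 2 \<or> x = 3"
  using exhaust_4[of x] by auto

lemma sum4: "(\<Sum>j\<in>UNIV. f (j::4)) = f 0 + f 1 + f 2 + (f 3 :: 'a::comm_monoid_add)"
proof -
  have "(UNIV :: 4 set) = {0, 1, 2, 3}" using exhaust4 by blast
  then have "(\<Sum>j\<in>UNIV. f j) = (\<Sum>j\<in>{0, 1, 2, 3}. f j)" by (rule arg_cong)
  also have "\<dots> = f 0 + (f 1 + (f 2 + f 3))" by (subst sum.insert; simp)+
  finally show ?thesis by (simp only: add.assoc)
qed

lemma numerals4: "(4::4) = 0" "(5::4) = 1" "- 1 = (3::4)" "- 2 = (2::4)" "- 3 = (1::4)"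
  by simp_all

lemma of_int4_mod: "(of_int a :: 4) = of_int (a mod 4)"
proof -
  have "(of_int a :: 4) = of_int (4 * (a div 4) + a mod 4)" by simp
  also have "\<dots> = of_int (a mod 4)" unfolding of_int_add of_int_mult of_int_numeral numerals4 by simp
  finally show ?thesis .
qed

lemma of_int4_eq_iff: "(of_int a :: 4) = of_int b \<longleftrightarrow> a mod 4 = b mod 4"
proof -
  have *: "x mod 4 = 0 \<or> x mod 4 = 1 \<or> x mod 4 = 2 \<or> x mod 4 = 3" for x :: int by presburger
  show ?thesis
    by (subst of_int4_mod, subst of_int4_mod[of b]) (use *[of a] *[of b] in auto)
qed

text \<open>The weight of the box \<open>a\<close> is \<open>\<Lambda>\<^sub>a - \<Lambda>\<^bsub>a-1\<^esub> - \<lfloor>(a - 1) / 4\<rfloor> \<delta>\<close>: the step from \<open>a\<close> to \<open>a + 1\<close> subtracts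
  \<open>\<alpha>\<^sub>a\<close>, and a full turn of four steps subtracts \<open>\<delta>\<close>.\<close>

definition box_weight :: "int \<Rightarrow> weight" where
  "box_weight a h = fst h $ of_int a - fst h $ (of_int a - 1) - of_int ((a - 1) div 4) * snd h"

definition box_expo :: "int \<Rightarrow> 4 \<Rightarrow> int \<Rightarrow> int" where
  "box_expo a i l = (if i = of_int a \<and> l = a then 1 else 0) - (if i = of_int a - 1 \<and> l = a + 1 then 1 else 0)"

text \<open>The shift \<open>l + 2\<close> lowers the spectral parameters of the second box by 2.\<close>

definition pair_monomial :: "int \<Rightarrow> int \<Rightarrow> monomial" where
  "pair_monomial a b = Monomial (\<lambda>h. box_weight a h + box_weight b h) (\<lambda>i l. box_expo a i l + box_expo b i (l + 2))"

lemma simple_root_eq: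
  "simple_root i h = 2 * fst h $ i - fst h $ (i - 1) - fst h $ (i + 1) + (if i = 0 then snd h else 0)"
  using exhaust4[of i] by (auto simp: simple_root_def sum4 cartan_entry_def numerals4)

lemma box_weight_step: "box_weight (a + 1) h = box_weight a h - simple_root (of_int a) h"
proof -
  have "a div 4 = (a - 1) div 4 + (if (of_int a :: 4) = 0 then 1 else 0)"
    using of_int4_eq_iff[of a 0] by simp presburger
  then show ?thesis by (simp add: box_weight_def simple_root_eq algebra_simps)
qed

lemma wt_mult [simp]: "wt (m * m') h = wt m h + wt m' h"
  and expo_mult [simp]: "expo (m * m') i l = expo m i l + expo m' i l"
  and wt_inverse [simp]: "wt (inverse m) h = - wt m h"
  and expo_inverse [simp]: "expo (inverse m) i l = - expo m i l"
  by (simp_all add: times_monomial_def inverse_monomial_def)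

lemma wt_Amon [simp]: "wt (Amon i l) h = simple_root i h"
  by (simp add: Amon_def mexp_def Ymon_def)

lemma expo_Amon: "expo (Amon i l) j k =
   (if j = i \<and> (k = l - 1 \<or> k = l + 1) then 1 else if (j = i - 1 \<or> j = i + 1) \<and> k = l then - 1 else 0)"
  using exhaust4[of i] exhaust4[of j] by (elim disjE) (simp_all add: Amon_def mexp_def Ymon_def)

lemma monomial_eqI: "(\<And>h. wt m h = wt m' h) \<Longrightarrow> (\<And>i l. expo m i l = expo m' i l) \<Longrightarrow> m = m'"
  by (rule monomial.expand) (auto simp: fun_eq_iff)

lemma box_expo_step: "box_expo (a + 1) i l = box_expo a i l - expo (Amon (of_int a) (a + 1)) i l"
  unfolding box_expo_def expo_Amon of_int_add of_int_1
  using exhaust4[of "of_int a"] exhaust4[of i] by (elim disjE) simp_all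

lemma Amon_shift: "expo (Amon i l) j (k + d) = expo (Amon i (l - d)) j k"
  by (auto simp: expo_Amon)

lemma pair_step_a: "pair_monomial a b * inverse (Amon (of_int a) (a + 1)) = pair_monomial (a + 1) b"
  by (rule monomial_eqI) (simp_all add: pair_monomial_def box_weight_step box_expo_step)

lemma pair_step_b: "pair_monomial a b * inverse (Amon (of_int b) (b - 1)) = pair_monomial a (b + 1)"
  by (rule monomial_eqI) (simp_all add: pair_monomial_def box_weight_step box_expo_step Amon_shift)

lemma monomial_cancel: "m * inverse n = m' \<Longrightarrow> m' * n = (m :: monomial)"
  by (rule monomial_eqI) auto

lemma pair_back_a: "pair_monomial a b * Amon (of_int a - 1) a = pair_monomial (a - 1) b"
  using monomial_cancel[OF pair_step_a[of "a - 1" b]] by simp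

lemma pair_back_b: "pair_monomial a b * Amon (of_int b - 1) (b - 2) = pair_monomial a (b - 1)"
  using monomial_cancel[OF pair_step_b[of a "b - 1"]] by simp

lemma expo_pair: "expo (pair_monomial a b) i l =
  (if l = a then (if i = of_int a then 1 else 0) else 0) - (if l = a + 1 then (if i = of_int a - 1 then 1 else 0) else 0)
  + (if l = b - 2 then (if i = of_int b then 1 else 0) else 0) - (if l = b - 1 then (if i = of_int b - 1 then 1 else 0) else 0)"
  by (auto simp: pair_monomial_def box_expo_def)

lemma pair_support: "{l. expo (pair_monomial a b) i l \<noteq> 0} \<subseteq> {a, a + 1, b - 2, b - 1}"
  by (auto simp: expo_pair split: if_splits)

text \<open>The four factors of the monomial may share a variable \<open>Y\<^bsub>i,l\<^esub>\<close>; the sum over the support is nevertheless the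
  sum of the four contributions.\<close>

lemma expo_pair_sum:
  fixes f :: "int \<Rightarrow> 'a::comm_ring_1"
  shows "(\<Sum>l | P l \<and> expo (pair_monomial a b) i l \<noteq> 0. of_int (expo (pair_monomial a b) i l) * f l) =
   (if P a \<and> i = of_int a then f a else 0) - (if P (a + 1) \<and> i = of_int a - 1 then f (a + 1) else 0)
  + (if P (b - 2) \<and> i = of_int b then f (b - 2) else 0) - (if P (b - 1) \<and> i = of_int b - 1 then f (b - 1) else 0)"
proof -
  let ?S = "{a, a + 1, b - 2, b - 1}"
  have ind: "(\<Sum>l\<in>?S. (if l = c then x else 0) * g l) = x * g c" if "c \<in> ?S" for c x and g :: "int \<Rightarrow> 'a"
  proof -
    have "(\<Sum>l\<in>?S. (if l = c then x else 0) * g l) = (\<Sum>l\<in>?S. if l = c then x * g c else 0)"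
      by (rule sum.cong) auto
    then show ?thesis using that by (simp only: sum.delta finite.intros if_True)
  qed
  have "(\<Sum>l | P l \<and> expo (pair_monomial a b) i l \<noteq> 0. of_int (expo (pair_monomial a b) i l) * f l)
    = (\<Sum>l\<in>?S. of_int (expo (pair_monomial a b) i l) * (if P l then f l else 0))"
    using pair_support[of a b i] by (intro sum.mono_neutral_cong_left) auto
  also have "\<dots> = (\<Sum>l\<in>?S. (if l = a then (if i = of_int a then 1 else 0) else 0) * (if P l then f l else 0))
     - (\<Sum>l\<in>?S. (if l = a + 1 then (if i = of_int a - 1 then 1 else 0) else 0) * (if P l then f l else 0))
     + (\<Sum>l\<in>?S. (if l = b - 2 then (if i = of_int b then 1 else 0) else 0) * (if P l then f l else 0))
     - (\<Sum>l\<in>?S. (if l = b - 1 then (if i = of_int b - 1 then 1 else 0) else 0) * (if P l then f l else 0))"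
    unfolding expo_pair sum.distrib[symmetric] sum_subtractf[symmetric]
    by (rule sum.cong) (simp_all add: algebra_simps)
  also have "\<dots> = (if i = of_int a then 1 else 0) * (if P a then f a else 0)
     - (if i = of_int a - 1 then 1 else 0) * (if P (a + 1) then f (a + 1) else 0)
     + (if i = of_int b then 1 else 0) * (if P (b - 2) then f (b - 2) else 0)
     - (if i = of_int b - 1 then 1 else 0) * (if P (b - 1) then f (b - 1) else 0)"
    by (subst (1 2 3 4) ind) auto
  finally show ?thesis by simp
qed

lemma vector_space_cartan_scale: "vector_space cartan_scale"
  by standard (auto simp: cartan_scale_def algebra_simps vec_eq_iff)

lemma pair_monomial_monomials: "pair_monomial a b \<in> monomials"
proof -
  have "wt (pair_monomial a b) \<in> weight_lattice"
    unfolding weight_lattice_def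
    by (auto simp: Vector_Spaces.linear_iff vector_space_cartan_scale pair_monomial_def box_weight_def
       cartan_scale_def coroot_def axis_def algebra_simps)
       (unfold_locales, auto simp: algebra_simps)
  moreover have "finite {(i, l). expo (pair_monomial a b) i l \<noteq> 0}"
    by (rule finite_subset[of _ "UNIV \<times> {a, a + 1, b - 2, b - 1}"]) (use pair_support[of a b] in auto)
  moreover have "of_int (\<Sum>l | expo (pair_monomial a b) i l \<noteq> 0. expo (pair_monomial a b) i l) = wt (pair_monomial a b) (coroot i)" for i
    using expo_pair_sum[where P = "\<lambda>_. True" and a = a and b = b and i = i and f = "\<lambda>_. 1::rat"]
    by (simp add: pair_monomial_def box_weight_def coroot_def axis_def)
  ultimately show ?thesis by (simp add: monomials_def)
qed

lemma pair_monomial_crystal: "pair_monomial a b \<in> crystal_monomials"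
proof -
  have 1: "x - 2 = x + (2::4)" "x + 1 - (x - 1) = (2::4)" for x using exhaust4[of x] by auto
  then show ?thesis
    using 1(2)[of "of_int a"] 1(2)[of "of_int b"] 
    by (auto simp: crystal_monomials_def pair_monomial_monomials expo_pair algebra_simps)
qed

lemma phiL_pair: "phiL i L (pair_monomial a b) =
   (if a \<le> L \<and> i = of_int a then 1 else 0) - (if a + 1 \<le> L \<and> i = of_int a - 1 then 1 else 0)
  + (if b - 2 \<le> L \<and> i = of_int b then 1 else 0) - (if b - 1 \<le> L \<and> i = of_int b - 1 then 1 else 0)"
  using expo_pair_sum[where P = "\<lambda>l. l \<le> L" and a = a and b = b and i = i and f = "\<lambda>_. 1::int"] by (simp add: phiL_def)

lemma epsL_pair: "epsL i L (pair_monomial a b) =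
   - (if L \<le> a \<and> i = of_int a then 1 else 0) + (if L \<le> a + 1 \<and> i = of_int a - 1 then 1 else 0)
  - (if L \<le> b - 2 \<and> i = of_int b then 1 else 0) + (if L \<le> b - 1 \<and> i = of_int b - 1 then 1 else 0)"
  using expo_pair_sum[where P = "\<lambda>l. L \<le> l" and a = a and b = b and i = i and f = "\<lambda>_. 1::int"] by (simp add: epsL_def)

lemma finite_range_bounded: "(\<And>L. f L \<in> {-2..2::int}) \<Longrightarrow> finite (range f)"
  by (rule finite_subset[of _ "{-2..2}"]) auto

text \<open>The values of \<open>\<phi>\<^bsub>i,L\<^esub>\<close> lie between \<open>-2\<close> and \<open>2\<close>, so that the maximum over the infinite index set is
  attained.\<close>

lemma cphi_pairI:
  assumes "\<And>L. phiL i L (pair_monomial a b) \<le> c" "phiL i Q (pair_monomial a b) = c"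
  shows "cphi i (pair_monomial a b) = c"
  unfolding cphi_def
  by (rule Max_eqI) (use assms in \<open>auto intro!: finite_range_bounded simp: phiL_pair\<close>)

lemma ceps_pairI:
  assumes "\<And>L. epsL i L (pair_monomial a b) \<le> c" "epsL i Q (pair_monomial a b) = c"
  shows "ceps i (pair_monomial a b) = c"
  unfolding ceps_def
  by (rule Max_eqI) (use assms in \<open>auto intro!: finite_range_bounded simp: epsL_pair\<close>)

lemma f_tilde_pair_NoneI:
  assumes "\<And>L. phiL i L (pair_monomial a b) \<le> 0"
  shows "f_tilde i (pair_monomial a b) = None"
proof -
  have "phiL i (min a b - 3) (pair_monomial a b) = 0" by (auto simp: phiL_pair)
  then show ?thesis using cphi_pairI[OF assms] by (simp add: f_tilde_def)
qed

lemma e_tilde_pair_NoneI: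
  assumes "\<And>L. epsL i L (pair_monomial a b) \<le> 0"
  shows "e_tilde i (pair_monomial a b) = None"
proof -
  have "epsL i (max a b + 3) (pair_monomial a b) = 0" by (auto simp: epsL_pair)
  then show ?thesis using ceps_pairI[OF assms] by (simp add: e_tilde_def)
qed

lemma f_tilde_pair_SomeI:
  assumes "\<And>L. phiL i L (pair_monomial a b) \<le> c" "phiL i Q (pair_monomial a b) = c"
    "\<And>L. L < Q \<Longrightarrow> phiL i L (pair_monomial a b) < c" "c > 0"
  shows "f_tilde i (pair_monomial a b) = Some (pair_monomial a b * inverse (Amon i (Q + 1)))"
proof -
  have c: "cphi i (pair_monomial a b) = c" by (rule cphi_pairI[OF assms(1,2)])
  have "crystal_q i (pair_monomial a b) = Q"
    unfolding crystal_q_def c by (rule Least_equality) (use assms in \<open>force simp: not_less[symmetric]\<close>)+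
  then show ?thesis using c assms(4) by (simp add: f_tilde_def)
qed

lemma e_tilde_pair_SomeI:
  assumes "\<And>L. epsL i L (pair_monomial a b) \<le> c" "epsL i Q (pair_monomial a b) = c"
    "\<And>L. L > Q \<Longrightarrow> epsL i L (pair_monomial a b) < c" "c > 0"
  shows "e_tilde i (pair_monomial a b) = Some (pair_monomial a b * Amon i (Q - 1))"
proof -
  have c: "ceps i (pair_monomial a b) = c" by (rule ceps_pairI[OF assms(1,2)])
  have "crystal_p i (pair_monomial a b) = Q"
    unfolding crystal_p_def c by (rule Greatest_equality) (use assms in \<open>force simp: not_less[symmetric]\<close>)+
  then show ?thesis using c assms(4) by (simp add: e_tilde_def)
qed

lemma color_neq: "x + 1 \<noteq> (x::4)" "x - 1 \<noteq> x" "x \<noteq> x + 1" "x \<noteq> x - 1"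
  by auto

text \<open>A positive factor of colour \<open>i\<close> allows a move.  If both boxes have one, the box \<open>a\<close> moves, since
  its factor has the larger spectral parameter and \<open>\<phi>\<^bsub>i,L\<^esub>\<close> reaches its maximum 2 there.  If \<open>i = a = b - 1\<close>, the factor
  \<open>Y\<^bsub>i,b-1\<^esub>\<^sup>-\<^sup>1\<close> comes before \<open>Y\<^bsub>i,a\<^esub>\<close> and blocks it.\<close>

lemma f_tilde_pair:
  assumes "b \<le> a"
  shows "f_tilde i (pair_monomial a b) =
    (if i = of_int a \<and> i \<noteq> of_int b - 1 then Some (pair_monomial (a + 1) b)
     else if i = of_int b \<and> i \<noteq> of_int a then Some (pair_monomial a (b + 1)) else None)"
proof -
  consider "i = of_int a" "i \<noteq> of_int b - 1" | "i = of_int b" "i \<noteq> of_int a" 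
    | "i = of_int a" "i = of_int b - 1" | "i \<noteq> of_int a" "i \<noteq> of_int b" by blast
  then show ?thesis
  proof cases
    case 1
    have "f_tilde i (pair_monomial a b) = Some (pair_monomial a b * inverse (Amon i (a + 1)))"
      by (rule f_tilde_pair_SomeI[where c = "if i = of_int b then 2 else 1"])
        (use 1 assms in \<open>auto simp: phiL_pair\<close>)
    then show ?thesis using 1 by (simp add: pair_step_a)
  next
    case 2
    have "f_tilde i (pair_monomial a b) = Some (pair_monomial a b * inverse (Amon i (b - 2 + 1)))"
      by (rule f_tilde_pair_SomeI[where c = 1]) (use 2 assms in \<open>auto simp: phiL_pair\<close>)
    then show ?thesis using 2 by (simp add: pair_step_b)
  next
    case 3
    have "f_tilde i (pair_monomial a b) = None"
      by (rule f_tilde_pair_NoneI) (use 3 assms in \<open>auto simp: phiL_pair\<close>)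
    then show ?thesis using 3 by (auto simp: algebra_simps)
  next
    case 4
    have "f_tilde i (pair_monomial a b) = None"
      by (rule f_tilde_pair_NoneI) (use 4 assms in \<open>auto simp: phiL_pair\<close>)
    then show ?thesis using 4 by auto
  qed
qed

lemma e_tilde_pair:
  assumes "b \<le> a"
  shows "e_tilde i (pair_monomial a b) =
    (if i = of_int b - 1 \<and> i \<noteq> of_int a then Some (pair_monomial a (b - 1))
     else if i = of_int a - 1 \<and> i \<noteq> of_int b - 1 then Some (pair_monomial (a - 1) b) else None)"
proof -
  consider "i = of_int b - 1" "i \<noteq> of_int a" | "i = of_int a - 1" "i \<noteq> of_int b - 1" 
    | "i = of_int a" "i = of_int b - 1" | "i \<noteq> of_int a - 1" "i \<noteq> of_int b - 1" by blast
  then show ?thesis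
  proof cases
    case 1
    have "e_tilde i (pair_monomial a b) = Some (pair_monomial a b * Amon i (b - 1 - 1))"
      by (rule e_tilde_pair_SomeI[where c = "if i = of_int a - 1 then 2 else 1"])
        (use 1 assms in \<open>auto simp: epsL_pair\<close>)
    then show ?thesis using 1 by (simp add: pair_back_b)
  next
    case 2
    have "e_tilde i (pair_monomial a b) = Some (pair_monomial a b * Amon i (a + 1 - 1))"
      by (rule e_tilde_pair_SomeI[where c = 1]) (use 2 assms in \<open>auto simp: epsL_pair\<close>)
    then show ?thesis using 2 by (auto simp: pair_back_a)
  next
    case 3
    have "e_tilde i (pair_monomial a b) = None"
      by (rule e_tilde_pair_NoneI) (use 3 assms in \<open>auto simp: epsL_pair\<close>)
    then show ?thesis using 3 by (auto simp: algebra_simps)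
  next
    case 4
    have "e_tilde i (pair_monomial a b) = None"
      by (rule e_tilde_pair_NoneI) (use 4 assms in \<open>auto simp: epsL_pair\<close>)
    then show ?thesis using 4 by auto
  qed
qed

definition pair_monomials :: "monomial set" where
  "pair_monomials = {pair_monomial a b | a b. b \<le> a}"

text \<open>A move can leave the region \<open>b \<le> a\<close> only for \<open>a = b\<close>, where both boxes have the same colours and the
  operators choose the box whose move increases \<open>a - b\<close>.\<close>

lemma crystal_edges_pair:
  assumes "(m, m') \<in> crystal_edges" "m \<in> pair_monomials"
  shows "m' \<in> pair_monomials"
proof -
  obtain a b where ab: "m = pair_monomial a b" "b \<le> a" using assms(2) by (auto simp: pair_monomials_def)
  have mem: "b' \<le> a' \<Longrightarrow> pair_monomial a' b' \<in> pair_monomials" for a' b'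
    by (auto simp: pair_monomials_def)
  obtain i where "e_tilde i m = Some m' \<or> f_tilde i m = Some m'"
    using assms(1) by (auto simp: crystal_edges_def)
  then show ?thesis
  proof
    assume "e_tilde i m = Some m'"
    then have "m' = pair_monomial a (b - 1) \<or> m' = pair_monomial (a - 1) b \<and> a \<noteq> b"
      unfolding ab(1) e_tilde_pair[OF ab(2)] by (metis option.inject option.distinct(1))
    then show ?thesis using ab(2) mem[of "b - 1" a] mem[of b "a - 1"] by auto
  next
    assume "f_tilde i m = Some m'"
    then have "m' = pair_monomial (a + 1) b \<or> m' = pair_monomial a (b + 1) \<and> a \<noteq> b"
      unfolding ab(1) f_tilde_pair[OF ab(2)] by (metis option.inject option.distinct(1))
    then show ?thesis using ab(2) mem[of b "a + 1"] mem[of "b + 1" a] by auto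
  qed
qed

lemma generator_pair:
  "mexp (\<lambda>h. 2 * varpi1 h + of_nat s * delta h) * Ymon 1 1 * Ymon 1 (-1 - 4 * int s) *
     inverse (Ymon 0 2) * inverse (Ymon 0 (-4 * int s)) = pair_monomial 1 (1 - 4 * int s)"
proof (rule monomial_eqI)
  have c: "of_int (1 - 4 * int s) = (1::4)" using of_int4_eq_iff[of "1 - 4 * int s" 1] by simp presburger
  have dv: "(1 - 4 * int s - 1) div 4 = - int s" by simp
  have d: "delta h = snd h" for h
    by (simp add: delta_def sum4 simple_root_eq numerals4)
  show "wt (mexp (\<lambda>h. 2 * varpi1 h + of_nat s * delta h) * Ymon 1 1 * Ymon 1 (-1 - 4 * int s) *
     inverse (Ymon 0 2) * inverse (Ymon 0 (-4 * int s))) h = wt (pair_monomial 1 (1 - 4 * int s)) h" for h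
    unfolding pair_monomial_def monomial.sel box_weight_def c dv
    by (simp add: mexp_def Ymon_def varpi1_def fund_weight_def d)
  show "expo (mexp (\<lambda>h. 2 * varpi1 h + of_nat s * delta h) * Ymon 1 1 * Ymon 1 (-1 - 4 * int s) *
     inverse (Ymon 0 2) * inverse (Ymon 0 (-4 * int s))) i l = expo (pair_monomial 1 (1 - 4 * int s)) i l" for i l
    unfolding expo_pair c by (simp add: mexp_def Ymon_def) 
qed

lemma crystal_edge_f: "b \<le> a \<Longrightarrow> f_tilde i (pair_monomial a b) = Some (pair_monomial a' b') \<Longrightarrow>
   (pair_monomial a b, pair_monomial a' b') \<in> crystal_edges"
  by (auto simp: crystal_edges_def pair_monomial_crystal)

lemma crystal_edge_e: "b \<le> a \<Longrightarrow> e_tilde i (pair_monomial a b) = Some (pair_monomial a' b') \<Longrightarrow>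
   (pair_monomial a b, pair_monomial a' b') \<in> crystal_edges"
  by (auto simp: crystal_edges_def pair_monomial_crystal)

text \<open>Two moves lead from \<open>M(c, c - 4s)\<close> to \<open>M(c \<plusminus> 1, c \<plusminus> 1 - 4s)\<close>, and up to three further moves of
  the first box increase the difference \<open>4s\<close> to \<open>4s + k\<close> with \<open>k \<le> 3\<close>.\<close>

lemma Mbar_eq: "Mbar = pair_monomials"
proof
  have "m' \<in> pair_monomials" if "(m, m') \<in> crystal_edges\<^sup>*" "m \<in> pair_monomials" for m m'
    using that by induction (auto intro: crystal_edges_pair)
  moreover have gen: "pair_monomial 1 (1 - 4 * int s) \<in> pair_monomials" for s
    unfolding pair_monomials_def by (rule CollectI, rule exI[of _ 1], rule exI[of _ "1 - 4 * int s"]) simp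
  ultimately show "Mbar \<subseteq> pair_monomials"
    unfolding Mbar_def subcrystal_def generator_pair using gen by blast
next
  show "pair_monomials \<subseteq> Mbar"
  proof
    fix m assume "m \<in> pair_monomials"
    then obtain a b where m: "m = pair_monomial a b" "b \<le> a" by (auto simp: pair_monomials_def)
    define s where "s = nat ((a - b) div 4)"
    define c where "c = b + 4 * int s"
    have s: "c \<le> a" "a < c + 4" "b = c - 4 * int s" using m(2) by (auto simp: s_def c_def)
    let ?g = "pair_monomial 1 (1 - 4 * int s)"
    have col: "of_int (d - 4 * int s) = (of_int d::4)" for d
      using of_int4_eq_iff[of "d - 4 * int s" d] by simp presburger
    have le: "d - 4 * int s \<le> d" for d by simp
    have base: "(?g, pair_monomial d (d - 4 * int s)) \<in> crystal_edges\<^sup>*" for d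
    proof (induction d rule: int_induct[where k = 1])
      case base
      show ?case by simp
    next
      case (step1 d)
      have "(pair_monomial d (d - 4 * int s), pair_monomial (d + 1) (d - 4 * int s)) \<in> crystal_edges"
        using f_tilde_pair[OF le, of "of_int d" d] by (intro crystal_edge_f[of _ _ "of_int d"]) (simp_all only: col le color_neq refl simp_thms if_True if_False)
      moreover have "(pair_monomial (d + 1) (d - 4 * int s), pair_monomial (d + 1) (d + 1 - 4 * int s)) \<in> crystal_edges"
        using f_tilde_pair[of "d - 4 * int s" "d + 1" "of_int d"] col[of d]
        by (intro crystal_edge_f[of _ _ "of_int d"]) (auto simp: algebra_simps)
      ultimately show ?case using step1 by (meson rtrancl.rtrancl_into_rtrancl)
    next
      case (step2 d)
      have "(pair_monomial d (d - 4 * int s), pair_monomial d (d - 1 - 4 * int s)) \<in> crystal_edges"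
        using e_tilde_pair[of "d - 4 * int s" d "of_int d - 1"] col[of d]
        by (intro crystal_edge_e[of _ _ "of_int d - 1"]) (auto simp: algebra_simps)
      moreover have "(pair_monomial d (d - 1 - 4 * int s), pair_monomial (d - 1) (d - 1 - 4 * int s)) \<in> crystal_edges"
        using e_tilde_pair[of "d - 1 - 4 * int s" d "of_int d - 1"] col[of "d - 1"]
        by (intro crystal_edge_e[of _ _ "of_int d - 1"]) (auto simp: algebra_simps)
      ultimately show ?case using step2 by (meson rtrancl.rtrancl_into_rtrancl)
    qed
    have up: "(pair_monomial (c + k) (c - 4 * int s), pair_monomial (c + k + 1) (c - 4 * int s)) \<in> crystal_edges" if "k \<in> {0, 1, 2}" for k
    proof -
      have "(of_int (c + k) :: 4) \<noteq> of_int c - 1" using that exhaust4[of "of_int c"] by auto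
      then show ?thesis using f_tilde_pair[of "c - 4 * int s" "c + k" "of_int (c + k)"] col[of c] that
        by (intro crystal_edge_f[of _ _ "of_int (c + k)"]) auto
    qed
    have "(?g, pair_monomial (c + k) (c - 4 * int s)) \<in> crystal_edges\<^sup>*" if "k \<in> {0, 1, 2, 3}" for k
      using that base[of c] up[of 0] up[of 1] up[of 2]
      by (auto simp: add.assoc intro: rtrancl.rtrancl_into_rtrancl)
    moreover have "a - c \<in> {0, 1, 2, 3}" using s(1,2) by simp linarith
    ultimately have "(?g, pair_monomial (c + (a - c)) (c - 4 * int s)) \<in> crystal_edges\<^sup>*" by blast
    then have "(?g, m) \<in> crystal_edges\<^sup>*" unfolding m(1) s(3) by simp
    then show "m \<in> Mbar" unfolding Mbar_def subcrystal_def generator_pair by blast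
  qed
qed

text \<open>In the places \<open>(i, l)\<close> with \<open>i\<close> the class of \<open>l\<close>, only \<open>Y\<^bsub>a,a\<^esub>\<close> and \<open>Y\<^bsub>b-1,b-1\<^esub>\<^sup>-\<^sup>1\<close> are visible, and they
  do not cancel as \<open>b - 1 < a\<close>.\<close>

lemma pair_monomial_inj:
  assumes "b \<le> a" "b' \<le> a'" "expo (pair_monomial a b) = expo (pair_monomial a' b')"
  shows "a = a' \<and> b = b'"
proof -
  have "expo (pair_monomial a b) (of_int x) x = (if x = a then 1 else 0) - (if x = b - 1 then 1 else 0)" for a b x
  proof -
    have "(of_int (a + 1) :: 4) \<noteq> of_int a - 1" "(of_int (b - 2) :: 4) \<noteq> of_int b"
      using exhaust4[of "of_int a"] exhaust4[of "of_int b"] by auto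
    then show ?thesis by (auto simp: expo_pair)
  qed
  then have *: "(if x = a then 1 else 0) - (if x = b - 1 then 1 else 0) =
    (if x = a' then 1 else 0) - (if x = b' - 1 then 1 else (0::int))" for x
    using assms(3) by metis
  show ?thesis using *[of a] *[of "b - 1"] assms(1,2) by (auto split: if_splits)
qed

section \<open>The module\<close>

text \<open>The pairs with \<open>b \<le> a\<close> are numbered by way of \<open>(b, a - b) \<in> \<int> \<times> \<nat>\<close>.\<close>

definition enc :: "int \<Rightarrow> int \<Rightarrow> nat" where
  "enc a b = prod_encode (int_encode b, nat (a - b))"

definition low :: "nat \<Rightarrow> int" where
  "low k = int_decode (fst (prod_decode k))"

definition high :: "nat \<Rightarrow> int" where
  "high k = low k + int (snd (prod_decode k))"

lemma low_le_high [simp]: "low k \<le> high k"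
  by (simp add: high_def)

lemma low_enc [simp]: "low (enc a b) = b"
  by (simp add: low_def enc_def)

lemma high_enc [simp]: "b \<le> a \<Longrightarrow> high (enc a b) = a"
  by (simp add: high_def low_def enc_def)

lemma enc_high_low [simp]: "enc (high k) (low k) = k"
  by (simp add: high_def low_def enc_def)

definition pair_vec :: "int \<Rightarrow> int \<Rightarrow> vec" where
  "pair_vec a b = (if b \<le> a then basis_vec (enc a b) else 0)"

definition label :: "nat \<Rightarrow> monomial" where
  "label k = pair_monomial (high k) (low k)"

lemma basis_vec_eq: "basis_vec k = pair_vec (high k) (low k)"
  by (simp add: pair_vec_def)

lemma diag_pair_vec: "diag (\<lambda>k. f (label k)) (pair_vec a b) = fin_scale (f (pair_monomial a b)) (pair_vec a b)"
  by (simp add: pair_vec_def diag_basis label_def lin_0[OF lin_diag])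

text \<open>The formulas for \<open>x\<^sup>+\<close> arise from those for \<open>x\<^sup>-\<close> by \<open>(a, b) \<mapsto> (-b, -a)\<close>.  In the new coordinates
  \<open>(L, T)\<close> both signs raise the leading index \<open>L\<close> with a coefficient free of \<open>g\<close>, or the trailing
  index \<open>T\<close> with a coefficient involving \<open>g(L - T)\<close>; as before, \<open>T \<le> L\<close>.\<close>

fun signed :: "(int \<Rightarrow> int \<Rightarrow> 'a) \<Rightarrow> sgn \<Rightarrow> int \<Rightarrow> int \<Rightarrow> 'a" where
  "signed f MinusS L T = f L T"
| "signed f PlusS L T = f (- T) (- L)"

fun color :: "sgn \<Rightarrow> int \<Rightarrow> 4" where
  "color MinusS x = of_int x"
| "color PlusS x = - of_int x - 1"

text \<open>The step \<open>L \<mapsto> L + 1\<close> takes place at the spectral parameter \<open>q\<^bsup>param L\<^esup>\<close>.  The trailing box is shifted by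
  \<open>-2\<close> against the leading one, so that the step \<open>T \<mapsto> T + 1\<close> takes place at \<open>q\<^bsup>param (T - 2)\<^esup>\<close>.\<close>

fun param :: "sgn \<Rightarrow> int \<Rightarrow> int" where
  "param MinusS x = x + 1"
| "param PlusS x = - x - 2"

fun lead_index :: "sgn \<Rightarrow> nat \<Rightarrow> int" where
  "lead_index MinusS k = high k"
| "lead_index PlusS k = - low k"

fun trail_index :: "sgn \<Rightarrow> nat \<Rightarrow> int" where
  "trail_index MinusS k = low k"
| "trail_index PlusS k = - high k"

lemma trail_le_lead: "trail_index s k \<le> lead_index s k"
  by (cases s) auto

lemma basis_vec_signed: "basis_vec k = signed pair_vec s (lead_index s k) (trail_index s k)"
  by (cases s) (simp_all add: basis_vec_eq)

text \<open>The exchange identity for \<open>x = q\<^sup>n\<close> with \<open>n\<close> congruent to 0, 1 and 3 modulo 4, for both signs; for \<open>n\<close>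
  congruent to 2 the two coefficients agree.\<close>

lemma exchange_mod_0:
  fixes q x :: complex
  assumes "q \<noteq> 0" "x \<noteq> 0" "x * q ^ 2 \<noteq> 1"
  shows "q * (1 - x) / (1 - x * q ^ 2) * (x * q ^ 2 - 1 / q ^ 2) + (1 - x * q ^ 4) / (q * (1 - x * q ^ 2)) * (1 - 1 / q ^ 2 * (x * q ^ 2)) = 0"
    and "q * (1 - x) / (1 - x * q ^ 2) * (1 / (x * q ^ 2) - q ^ 2) + (1 - x * q ^ 4) / (q * (1 - x * q ^ 2)) * (1 - q ^ 2 * (1 / (x * q ^ 2))) = 0"
  using assms by (simp add: divide_simps, simp add: algebra_simps eval_nat_numeral)+

lemma exchange_mod_1:
  fixes q x :: complex
  assumes "q \<noteq> 0" "x \<noteq> 0" "x * q \<noteq> 1"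
  shows "(1 - x * q ^ 3) / (q * (1 - x * q)) * (x * q ^ 2 - q) + 1 * (1 - q * (x * q ^ 2)) = 0"
    and "(1 - x * q ^ 3) / (q * (1 - x * q)) * (1 / (x * q ^ 2) - 1 / q) + 1 * (1 - 1 / q * (1 / (x * q ^ 2))) = 0"
  using assms by (simp add: divide_simps, simp add: algebra_simps eval_nat_numeral)+

lemma exchange_mod_3:
  fixes q x :: complex
  assumes "q \<noteq> 0" "x \<noteq> 0" "x * q ^ 3 \<noteq> 1"
  shows "1 * (x * q ^ 2 - q) + q * (1 - x * q) / (1 - x * q ^ 3) * (1 - q * (x * q ^ 2)) = 0"
    and "1 * (1 / (x * q ^ 2) - 1 / q) + q * (1 - x * q) / (1 - x * q ^ 3) * (1 - 1 / q * (1 / (x * q ^ 2))) = 0"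
  using assms by (simp add: divide_simps, simp add: algebra_simps eval_nat_numeral)+

context generic
begin

text \<open>The eigenvalue of \<open>\<phi>\<^sub>i(z)\<close> on one box, at the value of \<open>z\<close> at which the other box moves; it depends only
  on the distance \<open>n\<close> of the boxes.  The formula in the case \<open>4 dvd n\<close> vanishes at \<open>n = 0\<close>, which keeps the
  boxes in order; its values at negative \<open>n\<close> occur only next to a factor \<open>g(0)\<close>.\<close>

definition g :: "int \<Rightarrow> complex" where
  "g n = (if n \<le> 0 then 0
     else if n mod 4 = 0 then q * (1 - q powi n) / (1 - q powi (n + 2))
     else if n mod 4 = 1 then (1 - q powi (n + 3)) / (q * (1 - q powi (n + 1)))
     else 1)"

lemma g_0: "0 \<le> n \<Longrightarrow> n mod 4 = 0 \<Longrightarrow> g n = q * (1 - q powi n) / (1 - q powi (n + 2))"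
  and g_1: "0 \<le> n \<Longrightarrow> n mod 4 = 1 \<Longrightarrow> g n = (1 - q powi (n + 3)) / (q * (1 - q powi (n + 1)))"
  and g_23: "0 \<le> n \<Longrightarrow> n mod 4 \<noteq> 0 \<Longrightarrow> n mod 4 \<noteq> 1 \<Longrightarrow> g n = 1"
  by (auto simp: g_def)

lemma g_nonpos [simp]: "n \<le> 0 \<Longrightarrow> g n = 0"
  by (simp add: g_def)

definition lead_coeff :: "sgn \<Rightarrow> 4 \<Rightarrow> int \<Rightarrow> int \<Rightarrow> complex" where
  "lead_coeff s i r L = (if i = color s L then q powi (param s L * r) else 0)"

definition trail_coeff :: "sgn \<Rightarrow> 4 \<Rightarrow> int \<Rightarrow> int \<Rightarrow> int \<Rightarrow> complex" where
  "trail_coeff s i r L T = (if i = color s T then g (L - T) * q powi (param s (T - 2) * r) else 0)"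

definition step :: "sgn \<Rightarrow> 4 \<Rightarrow> int \<Rightarrow> int \<Rightarrow> int \<Rightarrow> vec" where
  "step s i r L T = fin_scale (lead_coeff s i r L) (signed pair_vec s (L + 1) T)
     + fin_scale (trail_coeff s i r L T) (signed pair_vec s L (T + 1))"

definition x_act :: "sgn \<Rightarrow> 4 \<Rightarrow> int \<Rightarrow> vec \<Rightarrow> vec" where
  "x_act s i r = linext (\<lambda>k. step s i r (lead_index s k) (trail_index s k))"

fun act :: "generator \<Rightarrow> vec \<Rightarrow> vec" where
  "act (GX s i r) = x_act s i r"
| "act (GK h) = diag (\<lambda>k. qpow t (wt (label k) h))"
| "act (GH i m) = diag (\<lambda>k. h_eigenvalue i (Rep_nzint m) (label k))"

lemma lin_x_act: "lin (x_act s i r)"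
  by (simp add: x_act_def lin_linext)

lemma lin_act: "lin (act x)"
  by (cases x) (simp_all add: lin_x_act lin_diag)

lemmas x_act_lin = lin_add[OF lin_x_act] lin_scale[OF lin_x_act]
lemmas diag_lin = lin_add[OF lin_diag] lin_scale[OF lin_diag]

lemma x_act_signed: "T \<le> L \<Longrightarrow> x_act s i r (signed pair_vec s L T) = step s i r L T"
  by (cases s) (simp_all add: x_act_def pair_vec_def)

lemma trail_coeff_0: "L \<le> T \<Longrightarrow> trail_coeff s i r L T = 0"
  by (simp add: trail_coeff_def)

text \<open>For \<open>L = T\<close> the vector on the left is zero but the step on the right is not; the coefficient
  vanishes in this case since \<open>g(0) = 0\<close>.\<close>

lemma x_act_trail:
  assumes "T \<le> L"
  shows "fin_scale (trail_coeff s j r' L T) (x_act s i r (signed pair_vec s L (T + 1))) =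
    fin_scale (trail_coeff s j r' L T) (step s i r L (T + 1))"
  using assms by (cases "L = T") (simp_all add: x_act_signed trail_coeff_0)

text \<open>The matrix coefficients of a product of two generators \<open>x\<^bsub>i,r\<^esub> x\<^bsub>j,r'\<^esub>\<close>: two steps of the leading index, one of
  each, two of the trailing index.  The generator with colour \<open>j\<close> acts first.\<close>

definition LL :: "sgn \<Rightarrow> 4 \<Rightarrow> int \<Rightarrow> 4 \<Rightarrow> int \<Rightarrow> int \<Rightarrow> int \<Rightarrow> complex" where
  "LL s i r j r' L T = lead_coeff s j r' L * lead_coeff s i r (L + 1)"

definition LT :: "sgn \<Rightarrow> 4 \<Rightarrow> int \<Rightarrow> 4 \<Rightarrow> int \<Rightarrow> int \<Rightarrow> int \<Rightarrow> complex" where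
  "LT s i r j r' L T = lead_coeff s j r' L * trail_coeff s i r (L + 1) T + trail_coeff s j r' L T * lead_coeff s i r L"

definition TT :: "sgn \<Rightarrow> 4 \<Rightarrow> int \<Rightarrow> 4 \<Rightarrow> int \<Rightarrow> int \<Rightarrow> int \<Rightarrow> complex" where
  "TT s i r j r' L T = trail_coeff s j r' L T * trail_coeff s i r L (T + 1)"

lemma x_act2:
  assumes "T \<le> L"
  shows "x_act s i r (x_act s j r' (signed pair_vec s L T)) =
    fin_scale (LL s i r j r' L T) (signed pair_vec s (L + 2) T)
    + fin_scale (LT s i r j r' L T) (signed pair_vec s (L + 1) (T + 1))
    + fin_scale (TT s i r j r' L T) (signed pair_vec s L (T + 2))"
proof -
  have "x_act s i r (x_act s j r' (signed pair_vec s L T)) =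
    fin_scale (lead_coeff s j r' L) (step s i r (L + 1) T) + fin_scale (trail_coeff s j r' L T) (step s i r L (T + 1))"
    using assms by (simp add: x_act_signed step_def[of s j] x_act_lin x_act_trail)
  also have "\<dots> = fin_scale (LL s i r j r' L T) (signed pair_vec s (L + 2) T)
    + fin_scale (LT s i r j r' L T) (signed pair_vec s (L + 1) (T + 1))
    + fin_scale (TT s i r j r' L T) (signed pair_vec s L (T + 2))"
    by (rule poly_mapping_eqI) (simp add: step_def LL_def LT_def TT_def lookup_add algebra_simps)
  finally show ?thesis .
qed

lemma x_act3:
  assumes "T \<le> L"
  shows "x_act s i r (x_act s j r' (x_act s l r'' (signed pair_vec s L T))) =
    fin_scale (LL s j r' l r'' L T * lead_coeff s i r (L + 2)) (signed pair_vec s (L + 3) T)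
    + fin_scale (LL s j r' l r'' L T * trail_coeff s i r (L + 2) T + LT s j r' l r'' L T * lead_coeff s i r (L + 1))
       (signed pair_vec s (L + 2) (T + 1))
    + fin_scale (LT s j r' l r'' L T * trail_coeff s i r (L + 1) (T + 1) + TT s j r' l r'' L T * lead_coeff s i r L)
       (signed pair_vec s (L + 1) (T + 2))
    + fin_scale (TT s j r' l r'' L T * trail_coeff s i r L (T + 2)) (signed pair_vec s L (T + 3))"
proof -
  have "fin_scale (TT s j r' l r'' L T) (x_act s i r (signed pair_vec s L (T + 2)))
    = fin_scale (TT s j r' l r'' L T) (step s i r L (T + 2))"
  proof (cases "T + 2 \<le> L")
    case False
    then have "TT s j r' l r'' L T = 0" by (simp add: TT_def trail_coeff_0)
    then show ?thesis by simp
  qed (simp add: x_act_signed)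
  then have "x_act s i r (x_act s j r' (x_act s l r'' (signed pair_vec s L T))) =
    fin_scale (LL s j r' l r'' L T) (step s i r (L + 2) T)
    + fin_scale (LT s j r' l r'' L T) (step s i r (L + 1) (T + 1))
    + fin_scale (TT s j r' l r'' L T) (step s i r L (T + 2))"
    using assms by (simp only: x_act2[OF assms] x_act_lin) (simp add: x_act_signed)
  then show ?thesis
    by (simp only:) (rule poly_mapping_eqI, simp add: step_def lookup_add algebra_simps)
qed

lemma param_Suc: "param s (x + 1) = param s x - sg s"
  by (cases s) simp_all

text \<open>Each step of an index changes the colour by one, in the same direction for both
  indices, so that the Cartan matrix entry depends on the distance modulo 4 only.\<close>

lemma cartan_color:
  "cartan_entry (color s L) (color s T) =
    (if (L - T) mod 4 = 0 then 2 else if (L - T) mod 4 = 2 then 0 else - 1)"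
proof -
  have C: "cartan_entry (color s L) (color s T) =
      (if d = 0 then 2 else if d = 1 \<or> d = 3 then - 1 else 0)" if "d = of_int L - of_int T" for d :: 4
  proof -
    have "of_int L = d + of_int T" using that by simp
    then show ?thesis using exhaust4[of d]
      by (cases s; elim disjE) (simp_all add: cartan_entry_def numerals4 eq_neg_iff_add_eq_0 algebra_simps)
  qed
  have "(of_int L - of_int T :: 4) = of_int ((L - T) mod 4)"
    by (simp flip: of_int4_mod)
  moreover have "(L - T) mod 4 = 0 \<or> (L - T) mod 4 = 1 \<or> (L - T) mod 4 = 2 \<or> (L - T) mod 4 = 3"
    by presburger
  ultimately show ?thesis unfolding C[OF refl] by auto
qed

lemma cartan_sym: "cartan_entry i j = cartan_entry j i"
  by (auto simp: cartan_entry_def)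

lemma color_eq_iff: "color s L = color s T \<longleftrightarrow> (L - T) mod 4 = 0"
  by (cases s) (simp_all add: of_int4_eq_iff, presburger+)

section \<open>Identities for the coefficients\<close>

text \<open>With \<open>z\<close> and \<open>w\<close> the parameters of the two moves, this is \<open>g(n) (z - Q w) + g(n + 1) (w - Q z) = 0\<close>.
  The trailing box contributes \<open>g(n)\<close> if it moves first and \<open>g(n + 1)\<close> if it moves second.  As \<open>z / w\<close> is
  \<open>q\<^bsup>n+2\<^esup>\<close> or its inverse, only the class of \<open>n\<close> modulo 4 has to be distinguished.\<close>

lemma g_exchange:
  fixes s :: sgn
  assumes "T \<le> L"
  defines "Q \<equiv> q powi (sg s * cartan_entry (color s L) (color s T))"
  shows "g (L - T) * (q powi param s L - Q * q powi param s (T - 2)) +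
    g (L - T + 1) * (q powi param s (T - 2) - Q * q powi param s L) = 0"
proof -
  define n where "n = L - T"
  define x where "x = q powi n"
  have n: "0 \<le> n" using assms(1) by (simp add: n_def)
  have x: "x \<noteq> 0" by (simp add: x_def)
  have e: "q powi (n + 1) = x * q" "q powi (n + 2) = x * q ^ 2" "q powi (n + 3) = x * q ^ 3" "q powi (n + 4) = x * q ^ 4"
    by (simp_all add: x_def powi_add)
  have nz: "x * q \<noteq> 1" "x * q ^ 2 \<noteq> 1" "x * q ^ 3 \<noteq> 1"
    using n unfolding e[symmetric] by simp_all
  have P: "q powi param s L = q powi param s (T - 2) * q powi (- sg s * (n + 2))"
    unfolding powi_add[symmetric] by (cases s) (simp_all add: n_def)
  have D: "q powi (- sg s * (n + 2)) = (case s of MinusS \<Rightarrow> x * q ^ 2 | PlusS \<Rightarrow> 1 / (x * q ^ 2))"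
    using e(2) power_int_minus[of q "n + 2"] by (cases s) (simp_all add: divide_inverse)
  have Qe: "Q = q powi (sg s * (if n mod 4 = 0 then 2 else if n mod 4 = 2 then 0 else - 1))"
    by (simp only: Q_def cartan_color n_def)
  have "n mod 4 = 0 \<or> n mod 4 = 1 \<or> n mod 4 = 2 \<or> n mod 4 = 3" by presburger
  then consider "n mod 4 = 0" | "n mod 4 = 1" | "n mod 4 = 2" | "n mod 4 = 3" by blast
  then have "g n * (q powi (- sg s * (n + 2)) - Q) + g (n + 1) * (1 - Q * q powi (- sg s * (n + 2))) = 0"
  proof cases
    case 1
    then have m: "(n + 1) mod 4 = 1" by presburger
    have Q: "Q = (case s of MinusS \<Rightarrow> 1 / q ^ 2 | PlusS \<Rightarrow> q ^ 2)" using 1 by (cases s) (simp_all add: Qe power_int_minus divide_inverse)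
    have g: "g n = q * (1 - x) / (1 - x * q ^ 2)" "g (n + 1) = (1 - x * q ^ 4) / (q * (1 - x * q ^ 2))"
      using 1 m n e by (simp_all add: g_0 g_1 add.assoc x_def)
    show ?thesis unfolding g D Q by (cases s) (simp_all only: sgn.case exchange_mod_0[OF q_nz x nz(2)])
  next
    case 2
    then have m: "(n + 1) mod 4 = 2" by presburger
    have Q: "Q = (case s of MinusS \<Rightarrow> q | PlusS \<Rightarrow> 1 / q)" using 2 by (cases s) (simp_all add: Qe power_int_minus divide_inverse)
    have g: "g n = (1 - x * q ^ 3) / (q * (1 - x * q))" "g (n + 1) = 1"
      using 2 m n e by (simp_all add: g_1 g_23)
    show ?thesis unfolding g D Q by (cases s) (simp_all only: sgn.case exchange_mod_1[OF q_nz x nz(1)])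
  next
    case 3
    then have m: "(n + 1) mod 4 = 3" by presburger
    have "Q = 1" using 3 by (simp add: Qe)
    then show ?thesis using 3 m n by (simp add: g_23)
  next
    case 4
    then have m: "(n + 1) mod 4 = 0" by presburger
    have Q: "Q = (case s of MinusS \<Rightarrow> q | PlusS \<Rightarrow> 1 / q)" using 4 by (cases s) (simp_all add: Qe power_int_minus divide_inverse)
    have g: "g n = 1" "g (n + 1) = q * (1 - x * q) / (1 - x * q ^ 3)"
      using 4 m n e by (simp_all add: g_0 g_23 add.assoc)
    show ?thesis unfolding g D Q by (cases s) (simp_all only: sgn.case exchange_mod_3[OF q_nz x nz(3)])
  qed
  then have "q powi param s (T - 2) * (g n * (q powi (- sg s * (n + 2)) - Q) + g (n + 1) * (1 - Q * q powi (- sg s * (n + 2)))) = 0"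
    by simp
  then show ?thesis unfolding P n_def[symmetric] by (simp add: algebra_simps)
qed

lemma g_serre:
  assumes "0 \<le> n" "n mod 4 = 0"
  shows "g n + g (n + 1) = q + 1 / q"
proof -
  define x where "x = q powi n"
  have e: "q powi (n + 2) = x * q ^ 2" "q powi (n + 4) = x * q ^ 4"
    by (simp_all add: x_def powi_add)
  have nz: "x * q ^ 2 \<noteq> 1"
    using assms unfolding e[symmetric] by simp
  have m: "(n + 1) mod 4 = 1" using assms(2) by presburger
  show ?thesis using assms m nz
    by (simp add: g_0 g_1 e add.assoc flip: x_def) (simp add: divide_simps, simp add: algebra_simps eval_nat_numeral)
qed

lemma if_of_bool: "(if P then x else 0) = of_bool P * (x :: complex)"
  by simp

section \<open>Relations among generators of one sign\<close>

lemma color_next: "color s (x + 1) \<noteq> color s x" "color s (x + 2) \<noteq> color s x" "color s (x + 2) \<noteq> color s (x + 1)"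
  by (simp_all add: color_eq_iff)

lemma param_ratio: "q powi param s (x + 1) = q powi (- sg s) * q powi param s x"
  by (simp add: param_Suc flip: powi_add)

lemma cartan_next: "cartan_entry (color s x) (color s (x + 1)) = - 1"
  using cartan_color[of s x "x + 1"] by simp

lemma param_pow: "q powi (param s x * (r + 1)) = q powi param s x * q powi (param s x * r)"
  by (simp add: ring_distribs powi_add mult.commute)

lemma three_terms_zero:
  assumes "c20 = 0" "c11 = 0" "c02 = 0"
  shows "fin_scale c20 u + fin_scale c11 v + fin_scale c02 w = 0"
  using assms by simp

lemma exchange_same:
  assumes "c = - 1" "Q = q powi (sg s * c)"
  shows "q powi param s (x + 1) = Q * q powi param s x"
  using assms by (simp add: param_ratio)

text \<open>Two steps of one index occur in one order only, and their parameters differ by the factor \<open>Q\<close>; so the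
  two terms with this order of the colours cancel.\<close>

lemma quad_LL:
  "LL s i (r + 1) j r' L T - Q * LL s j r' i (r + 1) L T - Q * LL s i r j (r' + 1) L T + LL s j (r' + 1) i r L T = 0"
  if "Q = q powi (sg s * cartan_entry i j)"
proof -
  consider "j = color s L" "i = color s (L + 1)" | "i = color s L" "j = color s (L + 1)"
    | "\<not> (j = color s L \<and> i = color s (L + 1))" "\<not> (i = color s L \<and> j = color s (L + 1))" by blast
  then show ?thesis
  proof cases
    case 1
    have "q powi param s (L + 1) = Q * q powi param s L"
      using that by (intro exchange_same[OF _ refl, of "- 1", THEN trans]) (simp_all add: 1 cartan_next cartan_sym[of "color s (L + 1)"])
    then show ?thesis using color_next[of s L]
      by (simp add: LL_def lead_coeff_def 1 param_pow)
  next
    case 2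
    have "q powi param s (L + 1) = Q * q powi param s L"
      using that by (intro exchange_same[OF _ refl, of "- 1", THEN trans]) (simp_all add: 2 cartan_next)
    then show ?thesis using color_next[of s L]
      by (simp add: LL_def lead_coeff_def 2 param_pow)
  next
    case 3
    then show ?thesis by (auto simp: LL_def lead_coeff_def)
  qed
qed

lemma quad_TT:
  "TT s i (r + 1) j r' L T - Q * TT s j r' i (r + 1) L T - Q * TT s i r j (r' + 1) L T + TT s j (r' + 1) i r L T = 0"
  if "Q = q powi (sg s * cartan_entry i j)"
proof -
  have P: "q powi param s (T + 1 - 2) = q powi (- sg s) * q powi param s (T - 2)"
    using param_ratio[of s "T - 2"] by simp
  consider "j = color s T" "i = color s (T + 1)" | "i = color s T" "j = color s (T + 1)"
    | "\<not> (j = color s T \<and> i = color s (T + 1))" "\<not> (i = color s T \<and> j = color s (T + 1))" by blast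
  then show ?thesis
  proof cases
    case 1
    have "q powi param s (T + 1 - 2) = Q * q powi param s (T - 2)"
      unfolding P using that by (simp add: 1 cartan_next cartan_sym[of "color s (T + 1)"])
    then show ?thesis using color_next[of s T]
      by (simp add: TT_def trail_coeff_def 1 param_pow)
  next
    case 2
    have "q powi param s (T + 1 - 2) = Q * q powi param s (T - 2)"
      unfolding P using that by (simp add: 2 cartan_next)
    then show ?thesis using color_next[of s T]
      by (simp add: TT_def trail_coeff_def 2 param_pow)
  next
    case 3
    then show ?thesis by (auto simp: TT_def trail_coeff_def)
  qed
qed

lemma LT_eq: "LT s i r j r' L T =
   (if j = color s L \<and> i = color s T then g (L - T + 1) * q powi (param s L * r') * q powi (param s (T - 2) * r) else 0)
 + (if i = color s L \<and> j = color s T then g (L - T) * q powi (param s L * r) * q powi (param s (T - 2) * r') else 0)"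
proof -
  have "L + 1 - T = L - T + 1" by simp
  then show ?thesis
    by (simp only: LT_def lead_coeff_def trail_coeff_def if_of_bool of_bool_conj mult_ac)
qed

lemma exchange_collect:
  fixes A B :: complex
  shows "A * (g1 * X * (pT * Y)) + B * (g0 * (pL * U) * V)
   - Q * (B * (g1 * (pL * U) * V) + A * (g0 * X * (pT * Y)))
   - Q * (A * (g1 * (pL * X) * Y) + B * (g0 * U * (pT * V)))
   + (B * (g1 * U * (pT * V)) + A * (g0 * (pL * X) * Y)) =
   A * ((g0 * (pL - Q * pT) + g1 * (pT - Q * pL)) * X * Y) + B * ((g0 * (pL - Q * pT) + g1 * (pT - Q * pL)) * U * V)"
  by (simp add: algebra_simps)

lemma two_ifs_zero:
  fixes K :: complex
  shows "(P \<Longrightarrow> K = 0) \<Longrightarrow> (P' \<Longrightarrow> K = 0) \<Longrightarrow> (if P then K * x * y else 0) + (if P' then K * u * v else 0) = 0"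
  by auto

lemma quad_LT:
  assumes "T \<le> L" "Q = q powi (sg s * cartan_entry i j)"
  shows "LT s i (r + 1) j r' L T - Q * LT s j r' i (r + 1) L T - Q * LT s i r j (r' + 1) L T + LT s j (r' + 1) i r L T = 0"
proof -
  let ?pL = "q powi param s L" and ?pT = "q powi param s (T - 2)"
  let ?K = "g (L - T) * (?pL - Q * ?pT) + g (L - T + 1) * (?pT - Q * ?pL)"
  have 1: "?K = 0" if "i = color s T" "j = color s L"
    using g_exchange[OF assms(1), of s] assms(2) that cartan_sym[of i j] by simp
  have 2: "?K = 0" if "i = color s L" "j = color s T"
    using g_exchange[OF assms(1), of s] assms(2) that by simp
  have "LT s i (r + 1) j r' L T - Q * LT s j r' i (r + 1) L T - Q * LT s i r j (r' + 1) L T + LT s j (r' + 1) i r L T =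
    (if j = color s L \<and> i = color s T then ?K * q powi (param s L * r') * q powi (param s (T - 2) * r) else 0)
  + (if i = color s L \<and> j = color s T then ?K * q powi (param s L * r) * q powi (param s (T - 2) * r') else 0)"
    unfolding LT_eq param_pow if_of_bool by (rule exchange_collect)
  also have "\<dots> = 0" by (rule two_ifs_zero) (use 1 2 in blast)+
  finally show ?thesis .
qed

lemma bracket_act: "alg_act act (bracket a b) v = alg_act act a (alg_act act b v) - alg_act act b (alg_act act a v)"
  by (simp add: bracket_def alg_act_diff alg_act_mult[OF lin_act])

lemmas act_simps = alg_act_diff alg_act_add alg_act_mult[OF lin_act] alg_act_gen alg_act_scal alg_act_1 act.simps

lemma lin_alg: "lin (alg_act act a)"
  by (rule lin_alg_act[OF lin_act])

lemma vanish_on_basis: "(\<And>k. alg_act act a (basis_vec k) = 0) \<Longrightarrow> alg_act act a v = 0"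
  by (rule lin_eqI[where g = "\<lambda>_. 0", OF lin_alg]) (auto simp: lin_iff)

lemma vanish_on_signed:
  assumes "\<And>L T. T \<le> L \<Longrightarrow> alg_act act a (signed pair_vec s L T) = 0"
  shows "alg_act act a v = 0"
  by (rule vanish_on_basis) (simp add: basis_vec_signed[of _ s] assms trail_le_lead)

lemma vanishes_quad:
  "alg_act act (xgen s i (r + 1) * xgen s j r'
    - scal (qpow t (of_int (sg s * cartan_entry i j))) * xgen s j r' * xgen s i (r + 1)
    - (scal (qpow t (of_int (sg s * cartan_entry i j))) * xgen s i r * xgen s j (r' + 1)
       - xgen s j (r' + 1) * xgen s i r)) v = 0"
proof (rule vanish_on_signed[where s = s])
  fix L T :: int assume TL: "T \<le> L"
  define Q where "Q = q powi (sg s * cartan_entry i j)"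
  let ?c = "\<lambda>F. F s i (r + 1) j r' L T - Q * F s j r' i (r + 1) L T - Q * F s i r j (r' + 1) L T + F s j (r' + 1) i r L T"
  have "?c LL = 0" "?c LT = 0" "?c TT = 0"
    using quad_LL[OF Q_def] quad_LT[OF TL Q_def] quad_TT[OF Q_def] by simp_all
  then have "fin_scale (?c LL) (signed pair_vec s (L + 2) T) + fin_scale (?c LT) (signed pair_vec s (L + 1) (T + 1))
    + fin_scale (?c TT) (signed pair_vec s L (T + 2)) = 0" by (rule three_terms_zero)
  then show "alg_act act (xgen s i (r + 1) * xgen s j r'
    - scal (qpow t (of_int (sg s * cartan_entry i j))) * xgen s j r' * xgen s i (r + 1)
    - (scal (qpow t (of_int (sg s * cartan_entry i j))) * xgen s i r * xgen s j (r' + 1)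
       - xgen s j (r' + 1) * xgen s i r)) (signed pair_vec s L T) = 0"
    unfolding qpow_int Q_def[symmetric] act_simps x_act2[OF TL]
    by (simp only: poly_mapping_eq_iff fun_eq_iff) (simp add: lookup_add lookup_minus algebra_simps)
qed

lemma far_colors:
  assumes "i \<noteq> j" "i \<noteq> j + 1" "i \<noteq> j - (1::4)"
  shows "cartan_entry i j = 0" "cartan_entry j i = 0"
  using assms by (auto simp: cartan_entry_def)

lemma vanishes_far:
  assumes "i \<noteq> j" "i \<noteq> j + 1" "i \<noteq> j - (1::4)"
  shows "alg_act act (bracket (xgen s i r1) (xgen s j r2)) v = 0"
proof (rule vanish_on_signed[where s = s])
  fix L T :: int assume TL: "T \<le> L"
  have no: "\<not> (i = color s x \<and> j = color s (x + 1))" "\<not> (j = color s x \<and> i = color s (x + 1))" for x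
    using far_colors[OF assms] cartan_next[of s x] by auto
  have geq: "g (L - T + 1) = g (L - T)" if "i = color s L \<and> j = color s T \<or> j = color s L \<and> i = color s T"
  proof -
    have "cartan_entry (color s L) (color s T) = 0" using that far_colors[OF assms] by blast
    then have "(L - T) mod 4 = 2" unfolding cartan_color by (simp split: if_split_asm)
    then have "(L - T) mod 4 = 2" "(L - T + 1) mod 4 = 3" by presburger+
    then show ?thesis using TL by (simp add: g_23)
  qed
  have "LT s i r1 j r2 L T = LT s j r2 i r1 L T"
  proof (cases "i = color s L \<and> j = color s T \<or> j = color s L \<and> i = color s T")
    case True
    show ?thesis unfolding LT_eq geq[OF True] by (rule add.commute)
  next
    case False
    then have "(i = color s L \<and> j = color s T) = False" "(j = color s L \<and> i = color s T) = False" by blast+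
    then show ?thesis unfolding LT_eq by (simp only: if_False)
  qed
  moreover have "LL s i r1 j r2 L T = 0" "LL s j r2 i r1 L T = 0" "TT s i r1 j r2 L T = 0" "TT s j r2 i r1 L T = 0"
    using no[of L] no[of T] by (auto simp: LL_def TT_def lead_coeff_def trail_coeff_def)
  ultimately show "alg_act act (bracket (xgen s i r1) (xgen s j r2)) (signed pair_vec s L T) = 0"
    unfolding bracket_act act_simps x_act2[OF TL] by simp
qed

text \<open>The corresponding coefficients of a product of three generators, for three, two, one and no steps of the
  leading index.\<close>

definition L3 where "L3 s i r j r' l r'' L T = LL s j r' l r'' L T * lead_coeff s i r (L + 2)"
definition L2T where "L2T s i r j r' l r'' L T =
  LL s j r' l r'' L T * trail_coeff s i r (L + 2) T + LT s j r' l r'' L T * lead_coeff s i r (L + 1)"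
definition LT2 where "LT2 s i r j r' l r'' L T =
  LT s j r' l r'' L T * trail_coeff s i r (L + 1) (T + 1) + TT s j r' l r'' L T * lead_coeff s i r L"
definition T3 where "T3 s i r j r' l r'' L T = TT s j r' l r'' L T * trail_coeff s i r L (T + 2)"

lemma serre_L3: "i \<noteq> j \<Longrightarrow> L3 s i r i r' j r'' L T = 0 \<and> L3 s i r j r'' i r' L T = 0 \<and> L3 s j r'' i r i r' L T = 0"
  using color_next[of s L] by (auto simp: L3_def LL_def lead_coeff_def)

lemma serre_T3: "i \<noteq> j \<Longrightarrow> T3 s i r i r' j r'' L T = 0 \<and> T3 s i r j r'' i r' L T = 0 \<and> T3 s j r'' i r i r' L T = 0"
  using color_next[of s T] by (auto simp: T3_def TT_def trail_coeff_def add.assoc)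

text \<open>One summand for each position of the trailing step among the three.  The factor \<open>g\<close> records how many
  leading steps precede it.\<close>

lemma L2T_eq: "L2T s i r j r' l r'' L T =
    (if l = color s L \<and> j = color s (L + 1) \<and> i = color s T
      then g (L - T + 2) * q powi (param s L * r'') * q powi (param s (L + 1) * r') * q powi (param s (T - 2) * r) else 0)
  + (if l = color s L \<and> j = color s T \<and> i = color s (L + 1)
      then g (L - T + 1) * q powi (param s L * r'') * q powi (param s (L + 1) * r) * q powi (param s (T - 2) * r') else 0)
  + (if l = color s T \<and> j = color s L \<and> i = color s (L + 1)
      then g (L - T) * q powi (param s L * r') * q powi (param s (L + 1) * r) * q powi (param s (T - 2) * r'') else 0)"
proof -
  have "L + 1 - T = L - T + 1" "L + 2 - T = L - T + 2" by simp_all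
  then show ?thesis
    by (simp only: L2T_def LL_def LT_def lead_coeff_def trail_coeff_def if_of_bool of_bool_conj ring_distribs mult_ac add_ac)
qed

lemma L2T_eq_0:
  assumes "\<not> (l = color s L \<and> j = color s (L + 1) \<and> i = color s T)"
    "\<not> (l = color s L \<and> j = color s T \<and> i = color s (L + 1))"
    "\<not> (l = color s T \<and> j = color s L \<and> i = color s (L + 1))"
  shows "L2T s i r j r' l r'' L T = 0"
  unfolding L2T_eq by (simp only: assms if_False add_0_left)

text \<open>One summand for each position of the leading step; it raises the argument of the later factors \<open>g\<close>.\<close>

lemma LT2_eq: "LT2 s i r j r' l r'' L T =
    (if l = color s L \<and> j = color s T \<and> i = color s (T + 1)
      then g (L - T + 1) * g (L - T) * q powi (param s L * r'') * q powi (param s (T - 2) * r') * q powi (param s (T - 1) * r) else 0)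
  + (if l = color s T \<and> j = color s L \<and> i = color s (T + 1)
      then g (L - T) * g (L - T) * q powi (param s L * r') * q powi (param s (T - 2) * r'') * q powi (param s (T - 1) * r) else 0)
  + (if l = color s T \<and> j = color s (T + 1) \<and> i = color s L
      then g (L - T) * g (L - T - 1) * q powi (param s L * r) * q powi (param s (T - 2) * r'') * q powi (param s (T - 1) * r') else 0)"
proof -
  have "L + 1 - (T + 1) = L - T" "L - (T + 1) = L - T - 1" "T + 1 - 2 = T - 1" "L + 1 - T = L - T + 1" by simp_all
  then show ?thesis
    by (simp only: LT2_def TT_def LT_def lead_coeff_def trail_coeff_def if_of_bool of_bool_conj ring_distribs mult_ac add_ac)
qed

lemma LT2_eq_0:
  assumes "\<not> (l = color s L \<and> j = color s T \<and> i = color s (T + 1))"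
    "\<not> (l = color s T \<and> j = color s L \<and> i = color s (T + 1))"
    "\<not> (l = color s T \<and> j = color s (T + 1) \<and> i = color s L)"
  shows "LT2 s i r j r' l r'' L T = 0"
  unfolding LT2_eq by (simp only: assms if_False add_0_left)

text \<open>The steps of the leading index have adjacent colours, one of which is \<open>i\<close> and the other \<open>j\<close>; the
  trailing step has colour \<open>i\<close>.  Each of the two possibilities reduces to \<open>g_serre\<close>.\<close>

lemma serre_L2T:
  assumes "T \<le> L" "i \<noteq> j"
  shows "L2T s i r1 i r2 j r' L T - (q + 1 / q) * L2T s i r1 j r' i r2 L T + L2T s j r' i r1 i r2 L T
       + (L2T s i r2 i r1 j r' L T - (q + 1 / q) * L2T s i r2 j r' i r1 L T + L2T s j r' i r2 i r1 L T) = 0"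
proof -
  have c: "color s (L + 1) \<noteq> color s L" by (rule color_next)
  consider "i = color s T" "i = color s L" "j = color s (L + 1)" | "i = color s T" "i = color s (L + 1)" "j = color s L"
    | "\<not> (i = color s T \<and> i = color s L \<and> j = color s (L + 1))" "\<not> (i = color s T \<and> i = color s (L + 1) \<and> j = color s L)"
    by blast
  then show ?thesis
  proof cases
    case 1
    have m: "(L - T) mod 4 = 0" using 1 color_eq_iff[of s L T] by simp
    then have "(L - T + 2) mod 4 = 2" by presburger
    then have g2: "g (L - T + 2) = 1" using assms by (simp add: g_23)
    have g: "q + 1 / q = g (L - T) + g (L - T + 1)" using g_serre[OF _ m] assms by simp
    have ne: "color s T \<noteq> color s (L + 1)" using 1 assms by simp
    show ?thesis unfolding L2T_eq g2 g using 1(1,2) c ne assms(2)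
      by (simp add: 1(3) algebra_simps flip: 1(1)) 
  next
    case 2
    have m: "(L + 1 - T) mod 4 = 0" using 2 color_eq_iff[of s "L + 1" T] by simp
    then have m': "(L - T) mod 4 = 3" by presburger
    have g0: "g (L - T) = 1" using assms m' by (simp add: g_23)
    have g: "q + 1 / q = g (L - T + 1) + g (L - T + 2)" using g_serre[OF _ m] assms by (simp add: algebra_simps)
    show ?thesis unfolding L2T_eq g0 g using 2(1,2) c assms(2)
      by (simp add: 2(3) algebra_simps flip: 2(1)) 
  next
    case 3
    have "L2T s i r i r' j r'' L T = 0" "L2T s i r j r' i r'' L T = 0" "L2T s j r i r' i r'' L T = 0" for r r' r''
      by (rule L2T_eq_0; use 3 c assms(2) in metis)+
    then show ?thesis by simp
  qed
qed

lemma serre_LT2: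
  assumes "T \<le> L" "i \<noteq> j"
  shows "LT2 s i r1 i r2 j r' L T - (q + 1 / q) * LT2 s i r1 j r' i r2 L T + LT2 s j r' i r1 i r2 L T
       + (LT2 s i r2 i r1 j r' L T - (q + 1 / q) * LT2 s i r2 j r' i r1 L T + LT2 s j r' i r2 i r1 L T) = 0"
proof -
  have c: "color s (T + 1) \<noteq> color s T" by (rule color_next)
  consider "i = color s L" "i = color s T" "j = color s (T + 1)" | "i = color s L" "i = color s (T + 1)" "j = color s T"
    | "\<not> (i = color s L \<and> i = color s T \<and> j = color s (T + 1))" "\<not> (i = color s L \<and> i = color s (T + 1) \<and> j = color s T)"
    by blast
  then show ?thesis
  proof cases
    case 1
    have m: "(L - T) mod 4 = 0" using 1 color_eq_iff[of s L T] by simp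
    have g1: "g (L - T) * g (L - T - 1) = g (L - T)"
    proof (cases "L = T")
      case False
      have "(L - T - 1) mod 4 = 3" using m by presburger
      then show ?thesis using assms False by (simp add: g_23)
    qed simp
    have g: "q + 1 / q = g (L - T) + g (L - T + 1)" using g_serre[OF _ m] assms by simp
    show ?thesis unfolding LT2_eq g1 g using 1(1,2) c assms(2)
      by (simp add: 1(3) algebra_simps flip: 1(1))
  next
    case 2
    have m: "(L - (T + 1)) mod 4 = 0" using 2 color_eq_iff[of s L "T + 1"] by simp
    then have m0: "(L - T - 1) mod 4 = 0" "(L - T) mod 4 = 1" "(L - T + 1) mod 4 = 2" by presburger+
    then have "T \<noteq> L" by auto
    then have n: "0 \<le> L - T - 1" using assms by simp
    have g1: "g (L - T + 1) = 1" using n m0 by (simp add: g_23)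
    have g: "q + 1 / q = g (L - T - 1) + g (L - T)" using g_serre[OF n m0(1)] by simp
    show ?thesis unfolding LT2_eq g1 g using 2(1,2) c assms(2)
      by (simp add: 2(3) algebra_simps flip: 2(1)) 
  next
    case 3
    have "LT2 s i r i r' j r'' L T = 0" "LT2 s i r j r' i r'' L T = 0" "LT2 s j r i r' i r'' L T = 0" for r r' r''
      by (rule LT2_eq_0; use 3 c assms(2) in metis)+
    then show ?thesis by simp
  qed
qed

lemma vanishes_serre:
  assumes "j = i + 1 \<or> j = i - (1::4)"
  shows "alg_act act (serre t s i j r1 r2 r' + serre t s i j r2 r1 r') v = 0"
proof (rule vanish_on_signed[where s = s])
  fix L T :: int assume TL: "T \<le> L"
  have ij: "i \<noteq> j" using assms by auto
  have Q: "qpow t 1 + qpow t (- 1) = q + 1 / q" by (simp add: qpow_1 qpow_neg1 q_def divide_inverse)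
  have c3: "x_act s i r (x_act s j r' (x_act s l r'' (signed pair_vec s L T))) =
    fin_scale (L3 s i r j r' l r'' L T) (signed pair_vec s (L + 3) T)
    + fin_scale (L2T s i r j r' l r'' L T) (signed pair_vec s (L + 2) (T + 1))
    + fin_scale (LT2 s i r j r' l r'' L T) (signed pair_vec s (L + 1) (T + 2))
    + fin_scale (T3 s i r j r' l r'' L T) (signed pair_vec s L (T + 3))" for i j l r r' r''
    unfolding x_act3[OF TL] L3_def L2T_def LT2_def T3_def by simp
  let ?c = "\<lambda>F. F s i r1 i r2 j r' L T - (q + 1 / q) * F s i r1 j r' i r2 L T + F s j r' i r1 i r2 L T
       + (F s i r2 i r1 j r' L T - (q + 1 / q) * F s i r2 j r' i r1 L T + F s j r' i r2 i r1 L T)"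
  have "fin_scale (?c L2T) (signed pair_vec s (L + 2) (T + 1)) + fin_scale (?c LT2) (signed pair_vec s (L + 1) (T + 2)) + fin_scale 0 0 = 0"
    using serre_L2T[OF TL ij] serre_LT2[OF TL ij] by (intro three_terms_zero) simp_all
  then show "alg_act act (serre t s i j r1 r2 r' + serre t s i j r2 r1 r') (signed pair_vec s L T) = 0"
    unfolding serre_def Q act_simps c3 using serre_L3[OF ij] serre_T3[OF ij]
    by (simp only: poly_mapping_eq_iff fun_eq_iff) (simp add: lookup_add lookup_minus algebra_simps)
qed

section \<open>Cartan relations\<close>

lemma wt_pair_linear:
  "wt (pair_monomial a b) (h + h') = wt (pair_monomial a b) h + wt (pair_monomial a b) h'"
  "wt (pair_monomial a b) (cartan_scale c h) = c * wt (pair_monomial a b) h"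
  "wt (pair_monomial a b) (- h) = - wt (pair_monomial a b) h"
  "wt (pair_monomial a b) 0 = 0"
  by (simp_all add: pair_monomial_def box_weight_def cartan_scale_def algebra_simps)

lemmas wt_label = wt_pair_linear[of "high k" "low k" for k, folded label_def]

lemma vanishes_k:
  "alg_act act (kgen h * kgen h' - kgen (h + h')) v = 0"
  "alg_act act (kgen 0 - 1) v = 0"
  "alg_act act (bracket (kgen h) (hgen j m)) v = 0"
  "alg_act act (bracket (hgen i m) (hgen j m')) v = 0"
  by (rule poly_mapping_eqI, simp add: bracket_act act_simps lookup_minus lookup_diag wt_label qpow_add)+

lemma diag_signed: "diag (\<lambda>k. f (label k)) (signed pair_vec s L T) = fin_scale (f (signed pair_monomial s L T)) (signed pair_vec s L T)"
  by (cases s) (simp_all add: diag_pair_vec)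

lemma signed_wt_step:
  "wt (signed pair_monomial s (L + 1) T) h = wt (signed pair_monomial s L T) h + of_int (sg s) * simple_root (color s L) h"
  "wt (signed pair_monomial s L (T + 1)) h = wt (signed pair_monomial s L T) h + of_int (sg s) * simple_root (color s T) h"
  using box_weight_step[of L h] box_weight_step[of T h] box_weight_step[of "- L - 1" h] box_weight_step[of "- T - 1" h]
  by (cases s; simp add: pair_monomial_def)+

lemma wt_signed_uminus: "wt (signed pair_monomial s L T) (- h) = - wt (signed pair_monomial s L T) h"
  by (cases s) (simp_all add: wt_pair_linear)

lemma vanishes_kx:
  "alg_act act (kgen h * xgen s j r * kgen (- h) - scal (qpow t (of_int (sg s) * simple_root j h)) * xgen s j r) v = 0"
proof (rule vanish_on_signed[where s = s])
  fix L T :: int assume TL: "T \<le> L"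
  let ?w = "wt (signed pair_monomial s L T) h"
  let ?c = "qpow t (of_int (sg s) * simple_root j h)"
  have L: "lead_coeff s j r L * (qpow t (- ?w) * qpow t (?w + of_int (sg s) * simple_root (color s L) h)) = lead_coeff s j r L * ?c"
    unfolding qpow_add[symmetric] by (simp add: lead_coeff_def)
  have T: "trail_coeff s j r L T * (qpow t (- ?w) * qpow t (?w + of_int (sg s) * simple_root (color s T) h)) = trail_coeff s j r L T * ?c"
    unfolding qpow_add[symmetric] by (simp add: trail_coeff_def)
  have "alg_act act (kgen h * xgen s j r * kgen (- h)) (signed pair_vec s L T) =
    fin_scale (lead_coeff s j r L * (qpow t (- ?w) * qpow t (?w + of_int (sg s) * simple_root (color s L) h))) (signed pair_vec s (L + 1) T)
    + fin_scale (trail_coeff s j r L T * (qpow t (- ?w) * qpow t (?w + of_int (sg s) * simple_root (color s T) h))) (signed pair_vec s L (T + 1))"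
    unfolding act_simps diag_signed[of "\<lambda>m. qpow t (wt m h)" for h] x_act_lin x_act_signed[OF TL] step_def diag_lin signed_wt_step wt_signed_uminus
    by (rule poly_mapping_eqI) (simp add: lookup_add algebra_simps)
  also have "\<dots> = fin_scale ?c (step s j r L T)"
    unfolding L T step_def by (rule poly_mapping_eqI) (simp add: lookup_add algebra_simps)
  finally show "alg_act act (kgen h * xgen s j r * kgen (- h) - scal ?c * xgen s j r) (signed pair_vec s L T) = 0"
    unfolding alg_act_diff by (simp only: act_simps x_act_signed[OF TL] diff_self)
qed

text \<open>The contribution of \<open>Y\<^bsub>A,l\<^esub> Y\<^bsub>A-1,l+1\<^esub>\<^sup>-\<^sup>1\<close> to the power sum of colour \<open>i\<close>.\<close>

definition box_sum :: "4 \<Rightarrow> 4 \<Rightarrow> int \<Rightarrow> int \<Rightarrow> complex" where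
  "box_sum i A l n = (if i = A then q powi (l * n) else 0) - (if i = A - 1 then q powi ((l + 1) * n) else 0)"

lemma h_eigenvalue_pair: "h_eigenvalue i n (pair_monomial a b) =
   (box_sum i (of_int a) a n + box_sum i (of_int b) (b - 2) n) * qnum t n / of_int n"
  using expo_pair_sum[where P = "\<lambda>_. True" and a = a and b = b and i = i and f = "\<lambda>l. q powi (l * n)"]
  by (simp add: h_eigenvalue_def box_sum_def add_diff_eq)

lemma qnum_multiples: "qnum t (n * 2) = (q powi n + q powi (- n)) * qnum t n" "qnum t (n * - 1) = - qnum t n" "qnum t (n * 0) = 0"
proof -
  have "q powi (n * 2) = q powi n * q powi n" "q powi (- (n * 2)) = q powi (- n) * q powi (- n)"
    unfolding powi_add[symmetric] by (simp_all add: algebra_simps)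
  then show "qnum t (n * 2) = (q powi n + q powi (- n)) * qnum t n"
    unfolding qnum_eq by (simp add: algebra_simps diff_divide_distrib)
  show "qnum t (n * - 1) = - qnum t n" "qnum t (n * 0) = 0" by (simp_all add: qnum_eq diff_divide_distrib)
qed

text \<open>The power sum of colour \<open>i\<close> of \<open>A\<^bsub>A,0\<^esub>\<close>, which equals \<open>[n C\<^bsub>i,A\<^esub>]\<^sub>q / [n]\<^sub>q\<close>.\<close>

definition cartan_sum :: "4 \<Rightarrow> 4 \<Rightarrow> int \<Rightarrow> complex" where
  "cartan_sum i A n = (if i = A then q powi n + q powi (- n) else if i = A + 1 \<or> i = A - 1 then - 1 else 0)"

lemma color_distinct: "x + 1 \<noteq> (x::4)" "x + 1 \<noteq> x - 1" "x - 1 \<noteq> x"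
  using exhaust4[of x] by auto

lemma box_sum_step: "box_sum i (A + 1) (l + 1) n = box_sum i A l n - q powi ((l + 1) * n) * cartan_sum i A n"
proof -
  have p: "q powi ((l + 1) * n) * q powi n = q powi ((l + 1 + 1) * n)" "q powi ((l + 1) * n) * q powi (- n) = q powi (l * n)"
    unfolding powi_add[symmetric] by (simp_all add: algebra_simps)
  have A: "A + 1 - 1 = A" by simp
  consider "i = A" | "i = A + 1" | "i = A - 1" | "i \<noteq> A" "i \<noteq> A + 1" "i \<noteq> A - 1" by blast
  then show ?thesis unfolding box_sum_def cartan_sum_def A
    by cases (simp_all only: color_distinct color_distinct[symmetric] distrib_left p if_True if_False simp_thms refl, simp_all)
qed

lemma qnum_cartan: "qnum t (n * cartan_entry i A) = cartan_sum i A n * qnum t n"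
proof -
  have "(A = i + 1 \<or> A = i - 1) \<longleftrightarrow> (i = A + 1 \<or> i = A - 1)" by auto
  then show ?thesis unfolding cartan_entry_def cartan_sum_def
    using qnum_multiples by (cases "i = A"; cases "i = A + 1 \<or> i = A - 1") simp_all
qed

lemma collect_step:
  fixes X :: complex
  shows "(X - p * k + Y) * w / N = (X + Y) * w / N - k * w / N * p"
    and "(X + (Y - p * k)) * w / N = (X + Y) * w / N - k * w / N * p"
proof -
  have e: "k * w / N * p = (p * k * w) / N" by simp
  show "(X - p * k + Y) * w / N = (X + Y) * w / N - k * w / N * p"
    unfolding e diff_divide_distrib[symmetric]
    by (rule arg_cong[where f = "\<lambda>z. z / N"]) (simp add: algebra_simps)
  show "(X + (Y - p * k)) * w / N = (X + Y) * w / N - k * w / N * p"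
    unfolding e diff_divide_distrib[symmetric]
    by (rule arg_cong[where f = "\<lambda>z. z / N"]) (simp add: algebra_simps)
qed

lemma h_eigenvalue_step:
  "h_eigenvalue i n (pair_monomial (a + 1) b) = h_eigenvalue i n (pair_monomial a b) -
     qnum t (n * cartan_entry i (of_int a)) / of_int n * q powi ((a + 1) * n)"
  "h_eigenvalue i n (pair_monomial a (b + 1)) = h_eigenvalue i n (pair_monomial a b) -
     qnum t (n * cartan_entry i (of_int b)) / of_int n * q powi ((b - 1) * n)"
proof -
  have B: "b + 1 - 2 = b - 2 + 1" "b - 1 = b - 2 + 1" by simp_all
  show "h_eigenvalue i n (pair_monomial (a + 1) b) = h_eigenvalue i n (pair_monomial a b) -
     qnum t (n * cartan_entry i (of_int a)) / of_int n * q powi ((a + 1) * n)"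
    unfolding h_eigenvalue_pair qnum_cartan of_int_add of_int_1 box_sum_step by (rule collect_step)
  show "h_eigenvalue i n (pair_monomial a (b + 1)) = h_eigenvalue i n (pair_monomial a b) -
     qnum t (n * cartan_entry i (of_int b)) / of_int n * q powi ((b - 1) * n)"
    unfolding h_eigenvalue_pair qnum_cartan of_int_add of_int_1 B box_sum_step by (rule collect_step)
qed

lemma signed_h_step:
  "h_eigenvalue i n (signed pair_monomial s (L + 1) T) = h_eigenvalue i n (signed pair_monomial s L T) +
    of_int (sg s) * (1 / of_int n) * qnum t (n * cartan_entry i (color s L)) * q powi (param s L * n)"
  "h_eigenvalue i n (signed pair_monomial s L (T + 1)) = h_eigenvalue i n (signed pair_monomial s L T) +
    of_int (sg s) * (1 / of_int n) * qnum t (n * cartan_entry i (color s T)) * q powi (param s (T - 2) * n)"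
proof -
  have up: "x = y - Q / N * p \<Longrightarrow> y = x + of_int 1 * (1 / N) * Q * p"
    and down: "x = y - Q / N * p \<Longrightarrow> x = y + of_int (- 1) * (1 / N) * Q * p" for x y Q N p :: complex
    by (simp_all add: field_simps)
  have e: "- (L + 1) = - L - 1" "- (T + 1) = - T - 1" "- L - 1 + 1 = - L" "- T - 1 + 1 = - T"
    "- L - 1 - 1 = - L - 2" "- (T - 2) - 2 = - T" "T - 2 + 1 = T - 1"
    "(of_int (- L - 1) :: 4) = - of_int L - 1" "(of_int (- T - 1) :: 4) = - of_int T - 1" by simp_all
  show "h_eigenvalue i n (signed pair_monomial s (L + 1) T) = h_eigenvalue i n (signed pair_monomial s L T) +
    of_int (sg s) * (1 / of_int n) * qnum t (n * cartan_entry i (color s L)) * q powi (param s L * n)"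
  proof (cases s)
    case PlusS
    show ?thesis unfolding PlusS signed.simps color.simps param.simps sg.simps e(1)
      by (rule up) (rule h_eigenvalue_step(2)[of i n "- T" "- L - 1", unfolded e])
  next
    case MinusS
    show ?thesis unfolding MinusS signed.simps color.simps param.simps sg.simps
      by (rule down) (rule h_eigenvalue_step(1))
  qed
  show "h_eigenvalue i n (signed pair_monomial s L (T + 1)) = h_eigenvalue i n (signed pair_monomial s L T) +
    of_int (sg s) * (1 / of_int n) * qnum t (n * cartan_entry i (color s T)) * q powi (param s (T - 2) * n)"
  proof (cases s)
    case PlusS
    show ?thesis unfolding PlusS signed.simps color.simps param.simps sg.simps e(2,6)
      by (rule up) (rule h_eigenvalue_step(1)[of i n "- T - 1" "- L", unfolded e])
  next
    case MinusS
    show ?thesis unfolding MinusS signed.simps color.simps param.simps sg.simps e(7)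
      by (rule down) (rule h_eigenvalue_step(2))
  qed
qed

lemma vanishes_hx:
  "alg_act act (bracket (hgen i m) (xgen s j r)
    - scal (of_int (sg s) * (1 / of_int (Rep_nzint m)) * qnum t (Rep_nzint m * cartan_entry i j))
      * xgen s j (Rep_nzint m + r)) v = 0"
proof (rule vanish_on_signed[where s = s])
  fix L T :: int assume TL: "T \<le> L"
  define n where "n = Rep_nzint m"
  define c where "c = of_int (sg s) * (1 / of_int n) * qnum t (n * cartan_entry i j)"
  define w where "w = h_eigenvalue i n (signed pair_monomial s L T)"
  have L: "lead_coeff s j r L * h_eigenvalue i n (signed pair_monomial s (L + 1) T) = lead_coeff s j r L * w + c * lead_coeff s j (n + r) L"
    unfolding signed_h_step w_def[symmetric]
    by (simp add: lead_coeff_def c_def distrib_left powi_add)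
  have T: "trail_coeff s j r L T * h_eigenvalue i n (signed pair_monomial s L (T + 1)) = trail_coeff s j r L T * w + c * trail_coeff s j (n + r) L T"
    unfolding signed_h_step w_def[symmetric]
    by (simp add: trail_coeff_def c_def distrib_left powi_add)
  have hx: "alg_act act (hgen i m * xgen s j r) (signed pair_vec s L T) =
    fin_scale (lead_coeff s j r L * w + c * lead_coeff s j (n + r) L) (signed pair_vec s (L + 1) T)
    + fin_scale (trail_coeff s j r L T * w + c * trail_coeff s j (n + r) L T) (signed pair_vec s L (T + 1))"
    unfolding act_simps x_act_signed[OF TL] step_def diag_lin n_def[symmetric] diag_signed[of "h_eigenvalue i n"] L[symmetric] T[symmetric]
    by simp
  have xh: "alg_act act (xgen s j r * hgen i m) (signed pair_vec s L T) = fin_scale w (step s j r L T)"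
    unfolding act_simps n_def[symmetric] diag_signed[of "h_eigenvalue i n"] x_act_lin x_act_signed[OF TL] w_def ..
  have "alg_act act (bracket (hgen i m) (xgen s j r) - scal c * xgen s j (n + r)) (signed pair_vec s L T) = 0"
    unfolding bracket_def alg_act_diff hx xh
    unfolding act_simps x_act_signed[OF TL] step_def
    by (rule poly_mapping_eqI) (simp add: lookup_add lookup_minus algebra_simps)
  then show "alg_act act (bracket (hgen i m) (xgen s j r)
    - scal (of_int (sg s) * (1 / of_int (Rep_nzint m)) * qnum t (Rep_nzint m * cartan_entry i j))
      * xgen s j (Rep_nzint m + r)) (signed pair_vec s L T) = 0"
    by (simp only: c_def n_def)
qed

section \<open>Eigenvalues of \<open>\<phi>\<close>\<close>

definition scalar_at :: "nat \<Rightarrow> free_alg \<Rightarrow> complex \<Rightarrow> bool" where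
  "scalar_at k a c \<longleftrightarrow> alg_act act a (basis_vec k) = fin_scale c (basis_vec k)"

lemma scalar_at_mult: "scalar_at k a c \<Longrightarrow> scalar_at k b d \<Longrightarrow> scalar_at k (a * b) (c * d)"
  by (simp add: scalar_at_def alg_act_mult[OF lin_act] lin_scale[OF lin_alg] mult.commute)

lemma scalar_at_0: "scalar_at k 0 0"
  and scalar_at_1: "scalar_at k 1 1"
  and scalar_at_scal: "scalar_at k (scal c) c"
  by (simp_all add: scalar_at_def alg_act_scal alg_act_1)

lemma scalar_at_sum: "(\<And>x. x \<in> A \<Longrightarrow> scalar_at k (f x) (h x)) \<Longrightarrow> scalar_at k (sum f A) (sum h A)"
  by (simp add: scalar_at_def alg_act_sum fin.scale_sum_left)

definition scalar_series :: "nat \<Rightarrow> free_alg fps \<Rightarrow> complex fps \<Rightarrow> bool" where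
  "scalar_series k F f \<longleftrightarrow> (\<forall>n. scalar_at k (F $$ n) (f $$ n))"

lemma scalar_series_mult: "scalar_series k F f \<Longrightarrow> scalar_series k H h \<Longrightarrow> scalar_series k (F * H) (f * h)"
  by (auto simp: scalar_series_def fps_mult_nth intro!: scalar_at_sum scalar_at_mult)

lemma scalar_series_const: "scalar_at k a c \<Longrightarrow> scalar_series k (fps_const a) (fps_const c)"
  by (auto simp: scalar_series_def scalar_at_0)

lemma scalar_series_power: "scalar_series k F f \<Longrightarrow> scalar_series k (F ^ n) (f ^ n)"
proof (induction n)
  case 0
  have "scalar_series k (fps_const 1) (fps_const 1)" by (intro scalar_series_const scalar_at_1)
  then show ?case by simp
qed (simp add: scalar_series_mult)

lemma scalar_series_exp:
  assumes "scalar_series k F f"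
  shows "scalar_series k (series_exp F) (fexp f)"
  unfolding scalar_series_def series_exp_def fexp_nth fps_nth_Abs_fps
  by (intro allI scalar_at_sum scalar_at_mult scalar_at_scal)
    (use scalar_series_power[OF assms] in \<open>simp add: scalar_series_def\<close>)

text \<open>Series of operators with a common eigenvector can be multiplied, and exponentiated, by
  calculating with the series of eigenvalues.\<close>

lemma scalar_phi_series: "scalar_series k (phi_series t s i) (monomial_eigenvalue t s (label k) i)"
proof -
  have h: "scalar_at k (hgen i m) (h_eigenvalue i (Rep_nzint m) (label k))" for m
    by (simp add: scalar_at_def alg_act_gen diag_basis)
  have kk: "scalar_at k (kgen (cartan_scale (of_int (sg s)) (coroot i))) (qpow t (of_int (sg s) * wt (label k) (coroot i)))"
    by (simp add: scalar_at_def alg_act_gen diag_basis wt_label)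
  have rep: "Rep_nzint (Abs_nzint (sg s * int n)) = sg s * int n" if "n \<noteq> 0" for n
    using that by (intro Abs_nzint_inverse) simp
  have "log_eigenvalue s i (label k) = fps_const (of_int (sg s) * (qpow t 1 - qpow t (- 1))) *
     Abs_fps (\<lambda>n. if n = 0 then 0 else h_eigenvalue i (Rep_nzint (Abs_nzint (sg s * int n))) (label k))"
    by (rule fps_ext) (simp add: log_eigenvalue_def rep qpow_qq)
  moreover have "scalar_series k (Abs_fps (\<lambda>n. if n = 0 then 0 else hgen i (Abs_nzint (sg s * int n))))
     (Abs_fps (\<lambda>n. if n = 0 then 0 else h_eigenvalue i (Rep_nzint (Abs_nzint (sg s * int n))) (label k)))"
    using h by (simp add: scalar_series_def scalar_at_0)
  ultimately have "scalar_series k (fps_const (scal (of_int (sg s) * (qpow t 1 - qpow t (- 1)))) *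
       Abs_fps (\<lambda>n. if n = 0 then 0 else hgen i (Abs_nzint (sg s * int n)))) (log_eigenvalue s i (label k))"
    by (simp only:) (intro scalar_series_mult scalar_series_const scalar_at_scal)
  then show ?thesis
    unfolding phi_series_def
    by (subst monomial_eigenvalue_eq)
      (simp_all add: label_def pair_monomial_monomials, simp add: scalar_series_mult scalar_series_const scalar_series_exp kk[unfolded label_def])
qed

lemma scalar_phi: "scalar_at k (phi t s i n)
   (if sg s * n \<ge> 0 then monomial_eigenvalue t s (label k) i $$ nat (sg s * n) else 0)"
  using scalar_phi_series[of k s i] by (simp add: phi_def scalar_series_def scalar_at_0)

section \<open>Partial fractions\<close>

text \<open>The expansions of \<open>1 / (1 - p z)\<close> in \<open>z\<close> and in \<open>z\<^sup>-\<^sup>1\<close>.\<close>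

fun geo :: "sgn \<Rightarrow> complex \<Rightarrow> complex fps" where
  "geo PlusS p = Abs_fps (\<lambda>n. p ^ n)"
| "geo MinusS p = Abs_fps (\<lambda>n. if n = 0 then 0 else - (inverse p ^ n))"

lemma geo_Plus: "geo PlusS p * (1 - fps_const p * fps_X) = 1"
proof (rule fps_ext)
  fix n show "(geo PlusS p * (1 - fps_const p * fps_X)) $$ n = 1 $$ n"
    by (cases n) (simp_all add: right_diff_distrib mult.left_commute[of _ "fps_const p"])
qed

lemma geo_Minus: "p \<noteq> 0 \<Longrightarrow> geo MinusS p * (fps_X - fps_const p) = fps_X"
proof (rule fps_ext)
  fix n assume p: "p \<noteq> 0"
  show "(geo MinusS p * (fps_X - fps_const p)) $$ n = fps_X $$ n"
  proof (cases n)
    case (Suc k)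
    then show ?thesis using p by (cases k) (simp_all add: right_diff_distrib)
  qed (simp add: right_diff_distrib)
qed

text \<open>The partial fraction expansion of \<open>1 / ((1 - p\<^sub>1 z) (1 - p\<^sub>2 z))\<close>, valid in both expansions.\<close>

lemma geo_mult:
  assumes "p1 \<noteq> p2" "p1 \<noteq> 0" "p2 \<noteq> 0"
  shows "geo s p1 * geo s p2 = fps_const (p1 / (p1 - p2)) * geo s p1 - fps_const (p2 / (p1 - p2)) * geo s p2"
proof -
  have d: "fps_const (p1 - p2) \<noteq> (0 :: complex fps)" using assms by simp
  have c: "fps_const (p1 - p2) * fps_const (x / (p1 - p2)) = fps_const x" for x
    using assms by simp
  have c': "fps_const (p1 - p2) * (fps_const (p1 / (p1 - p2)) * geo s p1 - fps_const (p2 / (p1 - p2)) * geo s p2)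
     = fps_const p1 * geo s p1 - fps_const p2 * geo s p2"
    by (simp only: right_diff_distrib mult.assoc[symmetric] c)
  have "fps_const (p1 - p2) * (geo s p1 * geo s p2) = fps_const p1 * geo s p1 - fps_const p2 * geo s p2"
  proof (cases s)
    case PlusS
    let ?d = "(1 - fps_const p1 * fps_X) * (1 - fps_const p2 * fps_X)"
    have "fps_const (p1 - p2) * (geo s p1 * geo s p2) * ?d =
      fps_const (p1 - p2) * ((geo s p1 * (1 - fps_const p1 * fps_X)) * (geo s p2 * (1 - fps_const p2 * fps_X)))"
      by (simp only: mult_ac)
    also have "\<dots> = fps_const p1 - fps_const p2" unfolding PlusS geo_Plus by simp
    also have "\<dots> = fps_const p1 * (1 - fps_const p2 * fps_X) - fps_const p2 * (1 - fps_const p1 * fps_X)"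
      by (simp add: algebra_simps)
    also have "\<dots> = fps_const p1 * ((geo s p1 * (1 - fps_const p1 * fps_X)) * (1 - fps_const p2 * fps_X))
       - fps_const p2 * ((geo s p2 * (1 - fps_const p2 * fps_X)) * (1 - fps_const p1 * fps_X))"
      unfolding PlusS geo_Plus by simp
    also have "\<dots> = (fps_const p1 * geo s p1 - fps_const p2 * geo s p2) * ?d"
      by (simp only: left_diff_distrib mult_ac)
    finally have "fps_const (p1 - p2) * (geo s p1 * geo s p2) * ?d = (fps_const p1 * geo s p1 - fps_const p2 * geo s p2) * ?d" .
    moreover have "?d $$ 0 \<noteq> 0" by simp
    then have "?d \<noteq> 0" by (metis fps_zero_nth)
    ultimately show ?thesis by (simp only: mult_cancel_right) simp
  next
    case MinusS
    let ?d = "(fps_X - fps_const p1) * (fps_X - fps_const p2)"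
    note G = geo_Minus[OF assms(2)] geo_Minus[OF assms(3)]
    have "fps_const (p1 - p2) * (geo s p1 * geo s p2) * ?d =
      fps_const (p1 - p2) * ((geo s p1 * (fps_X - fps_const p1)) * (geo s p2 * (fps_X - fps_const p2)))"
      by (simp only: mult_ac)
    also have "\<dots> = (fps_const p1 - fps_const p2) * (fps_X * fps_X)" unfolding MinusS G by simp
    also have "\<dots> = fps_const p1 * (fps_X * (fps_X - fps_const p2)) - fps_const p2 * (fps_X * (fps_X - fps_const p1))"
      by (simp only: algebra_simps)
    also have "\<dots> = fps_const p1 * ((geo s p1 * (fps_X - fps_const p1)) * (fps_X - fps_const p2))
       - fps_const p2 * ((geo s p2 * (fps_X - fps_const p2)) * (fps_X - fps_const p1))"
      unfolding MinusS G by simp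
    also have "\<dots> = (fps_const p1 * geo s p1 - fps_const p2 * geo s p2) * ?d"
      by (simp only: left_diff_distrib mult_ac)
    finally have "fps_const (p1 - p2) * (geo s p1 * geo s p2) * ?d = (fps_const p1 * geo s p1 - fps_const p2 * geo s p2) * ?d" .
    moreover have "?d $$ 0 \<noteq> 0" using assms by simp
    then have "?d \<noteq> 0" by (metis fps_zero_nth)
    ultimately show ?thesis by (simp only: mult_cancel_right) simp
  qed
  then have "fps_const (p1 - p2) * (geo s p1 * geo s p2) = fps_const (p1 - p2) *
    (fps_const (p1 / (p1 - p2)) * geo s p1 - fps_const (p2 / (p1 - p2)) * geo s p2)"
    unfolding c' .
  then show ?thesis using d by (simp only: mult_cancel_left) simp
qed

text \<open>The coefficient of \<open>z\<^sup>n\<close> in the difference of the two expansions of a rational function.  Constants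
  cancel, and \<open>1 / (1 - p z)\<close> contributes \<open>p\<^sup>n\<close> for every integer \<open>n\<close>.\<close>

definition jump :: "(sgn \<Rightarrow> complex fps) \<Rightarrow> int \<Rightarrow> complex" where
  "jump F n = (if 0 \<le> n then F PlusS $$ nat n else 0) - (if n \<le> 0 then F MinusS $$ nat (- n) else 0)"

lemma jump_simple:
  assumes "p1 \<noteq> 0" "p2 \<noteq> 0"
  shows "jump (\<lambda>s. fps_const c + fps_const r1 * geo s p1 + fps_const r2 * geo s p2) n = r1 * p1 powi n + r2 * p2 powi n"
  by (cases n rule: int_cases4)
    (auto simp: jump_def power_int_def power_inverse)

lemma jump_product:
  assumes "p1 \<noteq> p2" "p1 \<noteq> 0" "p2 \<noteq> 0"
  shows "jump (\<lambda>s. (fps_const c1 + fps_const r1 * geo s p1) * (fps_const c2 + fps_const r2 * geo s p2)) n =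
     r1 * (c2 + r2 * (p1 / (p1 - p2))) * p1 powi n + r2 * (c1 - r1 * (p2 / (p1 - p2))) * p2 powi n"
proof -
  have "(fps_const c1 + fps_const r1 * geo s p1) * (fps_const c2 + fps_const r2 * geo s p2) =
    fps_const (c1 * c2) + fps_const (r1 * (c2 + r2 * (p1 / (p1 - p2)))) * geo s p1
      + fps_const (r2 * (c1 - r1 * (p2 / (p1 - p2)))) * geo s p2" for s
  proof -
    have "(fps_const c1 + fps_const r1 * geo s p1) * (fps_const c2 + fps_const r2 * geo s p2) =
      fps_const c1 * fps_const c2 + fps_const c2 * fps_const r1 * geo s p1 + fps_const c1 * fps_const r2 * geo s p2
       + fps_const r1 * fps_const r2 * (geo s p1 * geo s p2)"
      by (simp only: distrib_left distrib_right mult_ac add_ac)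
    also have "\<dots> = fps_const (c1 * c2) + fps_const (r1 * (c2 + r2 * (p1 / (p1 - p2)))) * geo s p1
      + fps_const (r2 * (c1 - r1 * (p2 / (p1 - p2)))) * geo s p2"
      unfolding geo_mult[OF assms] by (rule fps_ext) (simp add: algebra_simps)
    finally show ?thesis .
  qed
  then show ?thesis using jump_simple[OF assms(2,3)] by simp
qed

lemma fexp_flog_geo: "fexp (flog c) = geo PlusS c"
proof -
  let ?d = "1 - fps_const c * fps_X"
  have "?d $$ 0 \<noteq> 0" by simp
  then have "?d \<noteq> 0" by (metis fps_zero_nth)
  moreover have "fexp (flog c) * ?d = geo PlusS c * ?d" unfolding fexp_flog geo_Plus ..
  ultimately show ?thesis by (simp only: mult_cancel_right) simp
qed

lemma geometric_coefficient:
  assumes "c' = c * d" "w * d = w'"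
  shows "(fps_const w * (geo PlusS c * (1 - fps_const c' * fps_X))) $$ Suc k = c ^ Suc k * (w - w')"
proof -
  have "(fps_const w * (geo PlusS c * (1 - fps_const c' * fps_X))) $$ Suc k = w * (c ^ Suc k - c' * c ^ k)"
    by (simp add: right_diff_distrib mult.left_commute[of _ "fps_const c'"])
  also have "\<dots> = c ^ Suc k * (w - w * d)" unfolding assms(1) by (simp add: algebra_simps)
  finally show ?thesis unfolding assms(2) .
qed

text \<open>Each factor has at most one pole, at \<open>z = q\<^bsup>-(l + u)\<^esup>\<close>, and tends to \<open>q\<^bsup>-u\<^esup>\<close> as \<open>z\<close> tends to infinity.\<close>

lemma Y_powi_parts:
  assumes "u \<in> {- 1, 0, 1}"
  shows "Y_eigenvalue t s l powi u = fps_const (q powi (- u)) + fps_const (of_int u * qq) * geo s (q powi (l + u))"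
proof (cases "u = 0")
  case False
  then have u: "u = 1 \<or> u = - 1" using assms by auto
  have "of_int u * Y_log s l = flog (q powi (sg s * (l + u))) + - flog (q powi (sg s * (l - u)))"
    using u by (auto simp: Y_log_def)
  then have E: "fexp (of_int u * Y_log s l) = geo PlusS (q powi (sg s * (l + u))) * (1 - fps_const (q powi (sg s * (l - u))) * fps_X)"
    by (simp only: fexp_flog_geo fexp_minus_flog fexp_add[of "flog _" "- flog _"] flog_nth fps_neg_nth of_nat_0 div_by_0 minus_zero)
  show ?thesis
  proof (rule fps_ext)
    fix n
    show "(Y_eigenvalue t s l powi u) $$ n = (fps_const (q powi (- u)) + fps_const (of_int u * qq) * geo s (q powi (l + u))) $$ n"
    proof (cases n)
      case 0
      have "q powi (sg s * u) = q powi (- u) + of_int u * qq * (case s of PlusS \<Rightarrow> 1 | MinusS \<Rightarrow> 0)"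
        using u by (cases s) (auto simp: qq_def)
      then show ?thesis unfolding Y_eigenvalue_powi E 0 by (cases s) simp_all
    next
      case (Suc k)
      have "q powi (sg s * (l - u)) = q powi (sg s * (l + u)) * q powi (- (2 * (sg s * u)))"
        unfolding powi_add[symmetric] by (simp add: algebra_simps)
      moreover have "q powi (sg s * u) * q powi (- (2 * (sg s * u))) = q powi (- (sg s * u))"
        unfolding powi_add[symmetric] by simp
      ultimately have "(Y_eigenvalue t s l powi u) $$ n = (q powi (sg s * (l + u))) ^ Suc k * (q powi (sg s * u) - q powi (- (sg s * u)))"
        unfolding Y_eigenvalue_powi E Suc by (rule geometric_coefficient)
      also have "q powi (sg s * u) - q powi (- (sg s * u)) = of_int (sg s) * of_int u * qq"
        using u by (cases s) (auto simp: qq_def)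
      also have "(q powi (sg s * (l + u))) ^ Suc k * (of_int (sg s) * of_int u * qq) =
        (fps_const (q powi (- u)) + fps_const (of_int u * qq) * geo s (q powi (l + u))) $$ n"
        unfolding Suc by (cases s) (simp_all add: power_int_minus[of q "l + u", simplified])
      finally show ?thesis .
    qed
  qed
qed simp

text \<open>A box contributes to each colour at most one factor \<open>Y\<^bsub>i,l\<^esub>\<^bsup>u\<^esup>\<close>: \<open>box_sign\<close> gives \<open>u\<close>, and \<open>box_place\<close> gives
  \<open>l\<close>.  If \<open>u = 0\<close> the place is arbitrary; it is chosen such that the exponents \<open>l + u\<close> belonging to the two
  boxes always differ.\<close>

definition box_sign :: "4 \<Rightarrow> 4 \<Rightarrow> int" where
  "box_sign i A = (if i = A then 1 else if i = A - 1 then - 1 else 0)"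

definition box_place :: "4 \<Rightarrow> 4 \<Rightarrow> int \<Rightarrow> int" where
  "box_place i A l = (if i = A then l else l + 1)"

lemma box_collect:
  fixes f :: "int \<Rightarrow> 'a::comm_ring_1"
  shows "(if i = A then f l else 0) - (if i = A - 1 then f (l + 1) else 0) = of_int (box_sign i A) * f (box_place i A l)"
  using color_distinct(3)[of A] by (auto simp: box_sign_def box_place_def)

lemma eigenvalue_pair:
  "monomial_eigenvalue t s (pair_monomial a b) i =
     Y_eigenvalue t s (box_place i (of_int a) a) powi box_sign i (of_int a) *
     Y_eigenvalue t s (box_place i (of_int b) (b - 2)) powi box_sign i (of_int b)"
proof -
  let ?ua = "box_sign i (of_int a)" and ?ub = "box_sign i (of_int b)"
  have "wt (pair_monomial a b) (coroot i) =
      ((if i = of_int a then 1 else 0) - (if i = of_int a - 1 then 1 else 0)) + ((if i = of_int b then 1 else 0) - (if i = of_int b - 1 then 1 else 0))"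
    by (simp add: pair_monomial_def box_weight_def coroot_def axis_def)
  also have "\<dots> = of_int (?ua + ?ub)"
    using box_collect[of i _ "\<lambda>_. 1::rat"] by simp
  finally have w: "of_int (sg s) * wt (pair_monomial a b) (coroot i) = of_int (sg s * ?ua + sg s * ?ub)"
    by (simp add: algebra_simps)
  have "log_eigenvalue s i (pair_monomial a b) =
     of_int ?ua * Y_log s (box_place i (of_int a) a) + of_int ?ub * Y_log s (box_place i (of_int b) (b - 2))"
    using expo_pair_sum[where P = "\<lambda>_. True" and a = a and b = b and i = i and f = "Y_log s"]
    by (simp add: log_eigenvalue_sum box_collect[symmetric] add_diff_eq)
  moreover have "(of_int u * Y_log s l) $$ 0 = 0" for u l by simp
  ultimately show ?thesis
    unfolding monomial_eigenvalue_eq[OF pair_monomial_monomials] w qpow_int Y_eigenvalue_powi powi_add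
    by (simp add: fexp_add mult_ac flip: fps_const_mult)
qed

lemma pole_ratio:
  assumes "e1 \<noteq> e2"
  shows "q powi e1 / (q powi e1 - q powi e2) = q powi (e1 - e2) / (q powi (e1 - e2) - 1)"
    and "q powi e2 / (q powi e1 - q powi e2) = 1 / (q powi (e1 - e2) - 1)"
proof -
  have "q powi e1 = q powi (e1 - e2) * q powi e2" unfolding powi_add[symmetric] by simp
  moreover have "q powi (e1 - e2) \<noteq> 1" using assms by simp
  ultimately show "q powi e1 / (q powi e1 - q powi e2) = q powi (e1 - e2) / (q powi (e1 - e2) - 1)"
    "q powi e2 / (q powi e1 - q powi e2) = 1 / (q powi (e1 - e2) - 1)"
    by (simp_all add: divide_simps) (simp_all add: algebra_simps)
qed

text \<open>The value of one factor at the pole of the other, \<open>X\<close> being \<open>p\<^sub>1 / p\<^sub>2\<close> in the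
  notation of \<open>jump_product\<close>.\<close>

lemma residue_values:
  assumes "X \<noteq> 1"
  shows "q powi (- 1) + of_int 1 * qq * (X / (X - 1)) = (1 - X * q ^ 2) / (q * (1 - X))"
    and "q powi (- (- 1)) + of_int (- 1) * qq * (X / (X - 1)) = q * (1 - X / q ^ 2) / (1 - X)"
    and "q powi (- 1) - of_int 1 * qq * (1 / (X - 1)) = q * (1 - X / q ^ 2) / (1 - X)"
    and "q powi (- (- 1)) - of_int (- 1) * qq * (1 / (X - 1)) = (1 - X * q ^ 2) / (q * (1 - X))"
proof -
  have "X - 1 \<noteq> 0" "1 - X \<noteq> 0" using assms by auto
  then have "1 / q + qq * (X / (X - 1)) = (1 - X * q ^ 2) / (q * (1 - X))"
    "q - qq * (X / (X - 1)) = q * (1 - X / q ^ 2) / (1 - X)"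
    "1 / q - qq * (1 / (X - 1)) = q * (1 - X / q ^ 2) / (1 - X)"
    "q + qq * (1 / (X - 1)) = (1 - X * q ^ 2) / (q * (1 - X))"
    by (simp_all add: qq_def divide_simps) (simp_all add: algebra_simps eval_nat_numeral)
  moreover have "q powi (- 1) = 1 / q" "q powi (- (- 1)) = q" by (simp_all add: divide_inverse)
  ultimately show "q powi (- 1) + of_int 1 * qq * (X / (X - 1)) = (1 - X * q ^ 2) / (q * (1 - X))"
    "q powi (- (- 1)) + of_int (- 1) * qq * (X / (X - 1)) = q * (1 - X / q ^ 2) / (1 - X)"
    "q powi (- 1) - of_int 1 * qq * (1 / (X - 1)) = q * (1 - X / q ^ 2) / (1 - X)"
    "q powi (- (- 1)) - of_int (- 1) * qq * (1 / (X - 1)) = (1 - X * q ^ 2) / (q * (1 - X))"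
    by simp_all
qed

lemma g_residue:
  assumes "0 \<le> n"
  shows "n mod 4 = 0 \<Longrightarrow> g n = q * (1 - q powi (n + 2) / q ^ 2) / (1 - q powi (n + 2))"
    and "n mod 4 = 0 \<Longrightarrow> g (n + 1) = (1 - q powi (n + 2) * q ^ 2) / (q * (1 - q powi (n + 2)))"
    and "n mod 4 = 1 \<Longrightarrow> g n = (1 - q powi (n + 1) * q ^ 2) / (q * (1 - q powi (n + 1)))"
    and "n mod 4 = 3 \<Longrightarrow> g (n + 1) = q * (1 - q powi (n + 3) / q ^ 2) / (1 - q powi (n + 3))"
proof -
  have p: "q powi (k + 2) = q powi k * q ^ 2" for k by (simp add: powi_add)
  show "n mod 4 = 0 \<Longrightarrow> g n = q * (1 - q powi (n + 2) / q ^ 2) / (1 - q powi (n + 2))"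
    using assms by (simp add: g_0) (simp add: p)
  show "n mod 4 = 1 \<Longrightarrow> g n = (1 - q powi (n + 1) * q ^ 2) / (q * (1 - q powi (n + 1)))"
    using assms by (simp add: g_1) (simp add: p[symmetric])
  have "(n + 1) mod 4 = 1" if "n mod 4 = 0" using that by presburger
  then show "n mod 4 = 0 \<Longrightarrow> g (n + 1) = (1 - q powi (n + 2) * q ^ 2) / (q * (1 - q powi (n + 2)))"
    using assms by (simp add: g_1 add.assoc) (simp add: p[symmetric])
  have m: "(n + 1) mod 4 = 0" if "n mod 4 = 3" using that by presburger
  have "q powi (n + 3) / q ^ 2 = q powi (n + 1)" using p[of "n + 1"] by (simp add: add.assoc)
  then show "n mod 4 = 3 \<Longrightarrow> g (n + 1) = q * (1 - q powi (n + 3) / q ^ 2) / (1 - q powi (n + 3))"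
    using assms m by (simp add: g_0 add.assoc)
qed

lemma color_mod:
  "(of_int a :: 4) = of_int b \<longleftrightarrow> (a - b) mod 4 = 0"
  "(of_int a :: 4) = of_int b - 1 \<longleftrightarrow> (a - b) mod 4 = 3"
  "(of_int a - 1 :: 4) = of_int b \<longleftrightarrow> (a - b) mod 4 = 1"
proof -
  have m: "x mod 4 = y mod 4 \<longleftrightarrow> (x - y) mod 4 = 0" for x y :: int
    by (simp add: mod_eq_dvd_iff dvd_eq_mod_eq_0)
  have k1: "(k + 1) mod 4 = 0 \<longleftrightarrow> k mod 4 = 3" and k2: "(k - 1) mod 4 = 0 \<longleftrightarrow> k mod 4 = 1" for k :: int
    by presburger+
  show "(of_int a :: 4) = of_int b \<longleftrightarrow> (a - b) mod 4 = 0"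
    unfolding of_int4_eq_iff m ..
  have "(of_int b - 1 :: 4) = of_int (b - 1)" by simp
  moreover have "a mod 4 = (b - 1) mod 4 \<longleftrightarrow> (a - b) mod 4 = 3"
    unfolding m using k1[of "a - b"] by (simp add: algebra_simps)
  ultimately show "(of_int a :: 4) = of_int b - 1 \<longleftrightarrow> (a - b) mod 4 = 3"
    by (simp only: of_int4_eq_iff)
  have "(of_int a - 1 :: 4) = of_int (a - 1)" by simp
  moreover have "(a - 1) mod 4 = b mod 4 \<longleftrightarrow> (a - b) mod 4 = 1"
    unfolding m using k2[of "a - b"] by (simp add: algebra_simps)
  ultimately show "(of_int a - 1 :: 4) = of_int b \<longleftrightarrow> (a - b) mod 4 = 1"
    by (simp only: of_int4_eq_iff)
qed

definition commutator_eigenvalue :: "4 \<Rightarrow> int \<Rightarrow> int \<Rightarrow> int \<Rightarrow> complex" where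
  "commutator_eigenvalue i r a b =
     (if i = of_int a then g (a - b + 1) * q powi ((a + 1) * r) else 0)
   - (if i = of_int a - 1 then g (a - b) * q powi (a * r) else 0)
   + ((if i = of_int b then g (a - b) * q powi ((b - 1) * r) else 0)
   - (if i = of_int b - 1 then g (a - b + 1) * q powi ((b - 2) * r) else 0))"

text \<open>The eigenvalue of \<open>\<phi>\<^sub>i\<close> is a product of one factor for each box, with different poles.  The partial
  fraction at the pole of one factor has the coefficient \<open>\<plusminus>(q - q\<^sup>-\<^sup>1)\<close> times the
  value of the other factor there, and this value is \<open>g(n)\<close> or
  \<open>g(n + 1)\<close>.\<close>

lemma jump_pair:
  assumes "b \<le> a"
  shows "jump (\<lambda>s. monomial_eigenvalue t s (pair_monomial a b) i) r = qq * commutator_eigenvalue i r a b"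
proof -
  let ?A = "of_int a :: 4" and ?B = "of_int b :: 4"
  define n where "n = a - b"
  have n: "0 \<le> n" using assms by (simp add: n_def)
  define ua ub where "ua = box_sign i ?A" and "ub = box_sign i ?B"
  define ea eb where "ea = box_place i ?A a + ua" and "eb = box_place i ?B (b - 2) + ub"
  have u: "ua \<in> {- 1, 0, 1}" "ub \<in> {- 1, 0, 1}" by (auto simp: ua_def ub_def box_sign_def)
  have ea: "ea = (if i = ?A - 1 then a else a + 1)" and eb: "eb = (if i = ?B - 1 then b - 2 else b - 1)"
    using color_distinct(3)[of ?A] color_distinct(3)[of ?B] by (auto simp: ea_def eb_def ua_def ub_def box_sign_def box_place_def)
  have ne: "ea \<noteq> eb" using assms unfolding ea eb by auto
  have X: "q powi (ea - eb) \<noteq> 1" using ne by simp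
  have "jump (\<lambda>s. monomial_eigenvalue t s (pair_monomial a b) i) r =
     jump (\<lambda>s. (fps_const (q powi (- ua)) + fps_const (of_int ua * qq) * geo s (q powi ea)) *
       (fps_const (q powi (- ub)) + fps_const (of_int ub * qq) * geo s (q powi eb))) r"
    unfolding eigenvalue_pair ua_def[symmetric] ub_def[symmetric] Y_powi_parts[OF u(1)] Y_powi_parts[OF u(2)] ea_def eb_def ..
  also have "\<dots> = qq * (of_int ua * (q powi (- ub) + of_int ub * qq * (q powi (ea - eb) / (q powi (ea - eb) - 1))) * q powi (ea * r)
     + of_int ub * (q powi (- ua) - of_int ua * qq * (1 / (q powi (ea - eb) - 1))) * q powi (eb * r))"
    by (subst jump_product) (use ne in \<open>simp_all add: pole_ratio[OF ne] power_int_mult algebra_simps\<close>)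
  finally have J: "jump (\<lambda>s. monomial_eigenvalue t s (pair_monomial a b) i) r = \<dots>" .
  have Ra: "q powi (- ub) + of_int ub * qq * (q powi (ea - eb) / (q powi (ea - eb) - 1)) = g (n + 1)" if i: "i = ?A"
  proof -
    have e: "ea = a + 1" using i color_distinct(3)[of ?A] by (simp add: ea)
    consider "n mod 4 = 0" | "n mod 4 = 3" | "n mod 4 \<noteq> 0" "n mod 4 \<noteq> 3" by blast
    then show ?thesis
    proof cases
      case 1
      then have u: "ub = 1" and "eb = b - 1" using color_mod[of a b] i by (simp_all add: ub_def box_sign_def eb n_def)
      then have E: "ea - eb = n + 2" using e by (simp add: n_def)
      show ?thesis unfolding u E residue_values(1)[OF X[unfolded E]] g_residue(2)[OF n 1] ..
    next
      case 2
      then have u: "ub = - 1" and "eb = b - 2" using color_mod[of a b] i by (simp_all add: ub_def box_sign_def eb n_def)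
      then have E: "ea - eb = n + 3" using e by (simp add: n_def)
      show ?thesis unfolding u E residue_values(2)[OF X[unfolded E]] g_residue(4)[OF n 2] ..
    next
      case 3
      then have "ub = 0" using color_mod[of a b] i by (simp add: ub_def box_sign_def n_def)
      moreover have "(n + 1) mod 4 \<noteq> 0" "(n + 1) mod 4 \<noteq> 1" using 3 by presburger+
      then have "g (n + 1) = 1" using n by (simp add: g_23)
      ultimately show ?thesis by simp
    qed
  qed
  have Ra': "q powi (- ub) + of_int ub * qq * (q powi (ea - eb) / (q powi (ea - eb) - 1)) = g n" if i: "i = ?A - 1"
  proof -
    have e: "ea = a" using i by (simp add: ea)
    consider "n mod 4 = 1" | "n mod 4 = 0" | "n mod 4 \<noteq> 0" "n mod 4 \<noteq> 1" by blast
    then show ?thesis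
    proof cases
      case 1
      then have u: "ub = 1" and "eb = b - 1" using color_mod[of a b] i color_mod(1)[of a b] by (simp_all add: ub_def box_sign_def eb n_def)
      then have E: "ea - eb = n + 1" using e by (simp add: n_def)
      show ?thesis unfolding u E residue_values(1)[OF X[unfolded E]] g_residue(3)[OF n 1] ..
    next
      case 2
      then have u: "ub = - 1" and "eb = b - 2" using color_mod[of a b] i by (simp_all add: ub_def box_sign_def eb n_def)
      then have E: "ea - eb = n + 2" using e by (simp add: n_def)
      show ?thesis unfolding u E residue_values(2)[OF X[unfolded E]] g_residue(1)[OF n 2] ..
    next
      case 3
      then have "ub = 0" using color_mod[of a b] i by (simp add: ub_def box_sign_def n_def)
      then show ?thesis using 3 n by (simp add: g_23)
    qed
  qed
  have Rb: "q powi (- ua) - of_int ua * qq * (1 / (q powi (ea - eb) - 1)) = g n" if i: "i = ?B"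
  proof -
    have e: "eb = b - 1" using i color_distinct(3)[of ?B] by (simp add: eb)
    consider "n mod 4 = 0" | "n mod 4 = 1" | "n mod 4 \<noteq> 0" "n mod 4 \<noteq> 1" by blast
    then show ?thesis
    proof cases
      case 1
      then have AB: "?A = ?B" using color_mod(1)[of a b] by (simp add: n_def)
      then have u: "ua = 1" and "ea = a + 1" using i by (simp_all add: ua_def box_sign_def ea)
      then have E: "ea - eb = n + 2" using e by (simp add: n_def)
      show ?thesis unfolding u E residue_values(3)[OF X[unfolded E]] g_residue(1)[OF n 1] ..
    next
      case 2
      then have AB: "?A - 1 = ?B" "?A \<noteq> ?B" using color_mod[of a b] by (simp_all add: n_def)
      then have u: "ua = - 1" and "ea = a" using i by (simp_all add: ua_def box_sign_def ea)
      then have E: "ea - eb = n + 1" using e by (simp add: n_def)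
      show ?thesis unfolding u E residue_values(4)[OF X[unfolded E]] g_residue(3)[OF n 2] ..
    next
      case 3
      then have AB: "?A - 1 \<noteq> ?B" "?A \<noteq> ?B" using color_mod[of a b] by (simp_all add: n_def)
      then have "ua = 0" unfolding ua_def box_sign_def i by (simp only: AB[symmetric] if_False)
      then show ?thesis using 3 n by (simp add: g_23)
    qed
  qed
  have Rb': "q powi (- ua) - of_int ua * qq * (1 / (q powi (ea - eb) - 1)) = g (n + 1)" if i: "i = ?B - 1"
  proof -
    have e: "eb = b - 2" using i by (simp add: eb)
    consider "n mod 4 = 3" | "n mod 4 = 0" | "n mod 4 \<noteq> 0" "n mod 4 \<noteq> 3" by blast
    then show ?thesis
    proof cases
      case 1
      then have AB: "?A = ?B - 1" using color_mod(2)[of a b] by (simp add: n_def)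
      then have u: "ua = 1" and "ea = a + 1" unfolding ua_def box_sign_def ea i AB by simp_all
      then have E: "ea - eb = n + 3" using e by (simp add: n_def)
      show ?thesis unfolding u E residue_values(3)[OF X[unfolded E]] g_residue(4)[OF n 1] ..
    next
      case 2
      then have AB: "?A = ?B" using color_mod[of a b] by (simp_all add: n_def)
      then have u: "ua = - 1" and "ea = a" unfolding ua_def box_sign_def ea i AB by simp_all
      then have E: "ea - eb = n + 2" using e by (simp add: n_def)
      show ?thesis unfolding u E residue_values(4)[OF X[unfolded E]] g_residue(2)[OF n 2] ..
    next
      case 3
      then have AB: "?A \<noteq> ?B - 1" "?A \<noteq> ?B" using color_mod[of a b] by (simp_all add: n_def)
      then have "?B - 1 \<noteq> ?A" "?B - 1 \<noteq> ?A - 1" by auto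
      then have "ua = 0" unfolding ua_def box_sign_def i by simp
      moreover have "(n + 1) mod 4 \<noteq> 0" "(n + 1) mod 4 \<noteq> 1" using 3 by presburger+
      then have "g (n + 1) = 1" using n by (simp add: g_23)
      ultimately show ?thesis by simp
    qed
  qed
  have a: "of_int ua * (q powi (- ub) + of_int ub * qq * (q powi (ea - eb) / (q powi (ea - eb) - 1))) * q powi (ea * r) =
    (if i = ?A then g (n + 1) * q powi ((a + 1) * r) else 0) - (if i = ?A - 1 then g n * q powi (a * r) else 0)"
  proof -
    consider "i = ?A" "i \<noteq> ?A - 1" | "i = ?A - 1" "i \<noteq> ?A" | "i \<noteq> ?A" "i \<noteq> ?A - 1" using color_distinct(3)[of ?A] by metis
    then show ?thesis
    proof cases
      case 1
      have "ua = 1" "ea = a + 1" unfolding ua_def box_sign_def ea by (simp_all only: if_P[OF 1(1)] if_not_P[OF 1(2)])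
      then show ?thesis unfolding Ra[OF 1(1)] by (simp only: if_P[OF 1(1)] if_not_P[OF 1(2)]) simp
    next
      case 2
      have "ua = - 1" "ea = a" unfolding ua_def box_sign_def ea by (simp_all only: if_not_P[OF 2(2)] if_P[OF 2(1)])
      then show ?thesis unfolding Ra'[OF 2(1)] by (simp only: if_P[OF 2(1)] if_not_P[OF 2(2)]) simp
    next
      case 3
      have "ua = 0" unfolding ua_def box_sign_def by (simp only: 3 if_False)
      then show ?thesis by (simp only: if_not_P[OF 3(1)] if_not_P[OF 3(2)]) simp
    qed
  qed
  have b: "of_int ub * (q powi (- ua) - of_int ua * qq * (1 / (q powi (ea - eb) - 1))) * q powi (eb * r) =
    (if i = ?B then g n * q powi ((b - 1) * r) else 0) - (if i = ?B - 1 then g (n + 1) * q powi ((b - 2) * r) else 0)"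
  proof -
    consider "i = ?B" "i \<noteq> ?B - 1" | "i = ?B - 1" "i \<noteq> ?B" | "i \<noteq> ?B" "i \<noteq> ?B - 1" using color_distinct(3)[of ?B] by metis
    then show ?thesis
    proof cases
      case 1
      have "ub = 1" "eb = b - 1" unfolding ub_def box_sign_def eb by (simp_all only: if_P[OF 1(1)] if_not_P[OF 1(2)])
      then show ?thesis unfolding Rb[OF 1(1)] by (simp only: if_P[OF 1(1)] if_not_P[OF 1(2)]) simp
    next
      case 2
      have "ub = - 1" "eb = b - 2" unfolding ub_def box_sign_def eb by (simp_all only: if_not_P[OF 2(2)] if_P[OF 2(1)])
      then show ?thesis unfolding Rb'[OF 2(1)] by (simp only: if_P[OF 2(1)] if_not_P[OF 2(2)]) simp
    next
      case 3
      have "ub = 0" unfolding ub_def box_sign_def by (simp only: 3 if_False)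
      then show ?thesis by (simp only: if_not_P[OF 3(1)] if_not_P[OF 3(2)]) simp
    qed
  qed
  show ?thesis unfolding J a b commutator_eigenvalue_def n_def ..
qed

section \<open>The commutator of \<open>x\<^sup>+\<close> and \<open>x\<^sup>-\<close>\<close>

text \<open>The coefficients of the four moves \<open>a \<mapsto> a \<plusminus> 1\<close> and \<open>b \<mapsto> b \<plusminus> 1\<close>.\<close>

definition a_up where "a_up j r a = (if j = of_int a then q powi ((a + 1) * r) else 0)"
definition b_up where "b_up j r a b = (if j = of_int b then g (a - b) * q powi ((b - 1) * r) else 0)"
definition b_down where "b_down i r b = (if i = of_int b - 1 then q powi ((b - 2) * r) else 0)"
definition a_down where "a_down i r a b = (if i = of_int a - 1 then g (a - b) * q powi (a * r) else 0)"

lemma x_minus_pair: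
  "b \<le> a \<Longrightarrow> x_act MinusS j r (pair_vec a b) =
     fin_scale (a_up j r a) (pair_vec (a + 1) b) + fin_scale (b_up j r a b) (pair_vec a (b + 1))"
  using x_act_signed[of b a MinusS j r]
  by (simp add: step_def lead_coeff_def trail_coeff_def a_up_def b_up_def)

lemma x_plus_pair:
  "b \<le> a \<Longrightarrow> x_act PlusS i r (pair_vec a b) =
     fin_scale (b_down i r b) (pair_vec a (b - 1)) + fin_scale (a_down i r a b) (pair_vec (a - 1) b)"
proof -
  have "- (- b + 1) = b - 1" "- (- a + 1) = a - 1" "- b - - a = a - b" "param PlusS (- b) = b - 2" "param PlusS (- a - 2) = a"
    "color PlusS (- b) = of_int b - 1" "color PlusS (- a) = of_int a - 1" by simp_all
  then show "b \<le> a \<Longrightarrow> ?thesis"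
    using x_act_signed[of "- a" "- b" PlusS i r]
    by (simp only: step_def lead_coeff_def trail_coeff_def b_down_def a_down_def signed.simps minus_minus)
qed

lemma scaled_plus:
  assumes "b \<le> a"
  shows "fin_scale (b_up j r' a b) (x_act PlusS i r (pair_vec a (b + 1))) =
    fin_scale (b_up j r' a b) (fin_scale (b_down i r (b + 1)) (pair_vec a b) + fin_scale (a_down i r a (b + 1)) (pair_vec (a - 1) (b + 1)))"
proof (cases "a = b")
  case True
  then have "b_up j r' a b = 0" by (simp add: b_up_def)
  then show ?thesis by simp
next
  case False
  then show ?thesis using assms by (simp add: x_plus_pair)
qed

lemma scaled_minus:
  assumes "b \<le> a"
  shows "fin_scale (a_down i r a b) (x_act MinusS j r' (pair_vec (a - 1) b)) =
    fin_scale (a_down i r a b) (fin_scale (a_up j r' (a - 1)) (pair_vec a b) + fin_scale (b_up j r' (a - 1) b) (pair_vec (a - 1) (b + 1)))"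
proof (cases "a = b")
  case True
  then have "a_down i r a b = 0" by (simp add: a_down_def)
  then show ?thesis by simp
next
  case False
  then show ?thesis using assms by (simp add: x_minus_pair)
qed

lemma commutator_diagonal:
  "a_up j r' a * a_down i r (a + 1) b + b_up j r' a b * b_down i r (b + 1)
    - b_down i r b * b_up j r' a (b - 1) - a_down i r a b * a_up j r' (a - 1) =
   (if i = j then commutator_eigenvalue i (r + r') a b else 0)"
proof -
  have e: "a + 1 - b = a - b + 1" "a - (b - 1) = a - b + 1" "b - 1 - 1 = b - 2" "b + 1 - 2 = b - 1" "a - 1 + 1 = a"
    "(of_int (a + 1) - 1 :: 4) = of_int a" "(of_int (b + 1) - 1 :: 4) = of_int b"
    "(of_int (a - 1) :: 4) = of_int a - 1" "(of_int (b - 1) :: 4) = of_int b - 1" by simp_all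
  have p: "q powi (k * (r + r')) = q powi (k * r) * q powi (k * r')" for k
    by (simp add: distrib_left powi_add)
  have two: "(if j = c then x else 0) * (if i = c then y else 0) = (if i = j then if i = c then x * y else 0 else (0::complex))"
    "(if i = c then x else 0) * (if j = c then y else 0) = (if i = j then if i = c then x * y else 0 else (0::complex))" for c x y
    by auto
  show ?thesis
    unfolding a_up_def b_up_def a_down_def b_down_def commutator_eigenvalue_def e two p
    by (cases "i = j") (simp_all only: if_True if_False, simp_all add: if_of_bool algebra_simps)
qed

lemma commutator_off_diagonal:
  "a_up j r' a * b_down i r b = b_down i r b * a_up j r' a"
  "b_up j r' a b * a_down i r a (b + 1) = a_down i r a b * b_up j r' (a - 1) b"
proof -
  have e: "a - (b + 1) = a - b - 1" "a - 1 - b = a - b - 1" by simp_all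
  show "b_up j r' a b * a_down i r a (b + 1) = a_down i r a b * b_up j r' (a - 1) b"
    unfolding b_up_def a_down_def e by simp
qed (rule mult.commute)

lemma commutator_act:
  assumes "b \<le> a"
  shows "x_act PlusS i r (x_act MinusS j r' (pair_vec a b)) - x_act MinusS j r' (x_act PlusS i r (pair_vec a b)) =
    fin_scale (if i = j then commutator_eigenvalue i (r + r') a b else 0) (pair_vec a b)"
proof -
  have 1: "x_act PlusS i r (x_act MinusS j r' (pair_vec a b)) =
     fin_scale (a_up j r' a) (fin_scale (b_down i r b) (pair_vec (a + 1) (b - 1)) + fin_scale (a_down i r (a + 1) b) (pair_vec a b))
   + fin_scale (b_up j r' a b) (fin_scale (b_down i r (b + 1)) (pair_vec a b) + fin_scale (a_down i r a (b + 1)) (pair_vec (a - 1) (b + 1)))"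
    using assms by (simp add: x_minus_pair x_act_lin scaled_plus x_plus_pair[of b "a + 1"])
  have 2: "x_act MinusS j r' (x_act PlusS i r (pair_vec a b)) =
     fin_scale (b_down i r b) (fin_scale (a_up j r' a) (pair_vec (a + 1) (b - 1)) + fin_scale (b_up j r' a (b - 1)) (pair_vec a b))
   + fin_scale (a_down i r a b) (fin_scale (a_up j r' (a - 1)) (pair_vec a b) + fin_scale (b_up j r' (a - 1) b) (pair_vec (a - 1) (b + 1)))"
    using assms by (simp add: x_plus_pair x_act_lin scaled_minus x_minus_pair[of "b - 1" a])
  have "x_act PlusS i r (x_act MinusS j r' (pair_vec a b)) - x_act MinusS j r' (x_act PlusS i r (pair_vec a b)) =
     fin_scale (a_up j r' a * b_down i r b - b_down i r b * a_up j r' a) (pair_vec (a + 1) (b - 1))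
   + fin_scale (a_up j r' a * a_down i r (a + 1) b + b_up j r' a b * b_down i r (b + 1)
      - b_down i r b * b_up j r' a (b - 1) - a_down i r a b * a_up j r' (a - 1)) (pair_vec a b)
   + fin_scale (b_up j r' a b * a_down i r a (b + 1) - a_down i r a b * b_up j r' (a - 1) b) (pair_vec (a - 1) (b + 1))"
    unfolding 1 2 by (rule poly_mapping_eqI) (simp add: lookup_add lookup_minus algebra_simps)
  then show ?thesis
    unfolding commutator_diagonal commutator_off_diagonal(2) by simp
qed

lemma vanishes_xx:
  "alg_act act (bracket (xgen PlusS i r) (xgen MinusS j r')
    - (if i = j then scal (1 / (qpow t 1 - qpow t (-1))) * (phi t PlusS i (r + r') - phi t MinusS i (r + r')) else 0)) v = 0"
proof (rule vanish_on_basis)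
  fix k
  let ?a = "high k" and ?b = "low k"
  have c: "alg_act act (bracket (xgen PlusS i r) (xgen MinusS j r')) (basis_vec k) =
    fin_scale (if i = j then commutator_eigenvalue i (r + r') ?a ?b else 0) (basis_vec k)"
    unfolding bracket_act act_simps basis_vec_eq[of k] by (rule commutator_act) simp
  have "alg_act act (phi t PlusS i (r + r')) (basis_vec k) - alg_act act (phi t MinusS i (r + r')) (basis_vec k) =
    fin_scale (jump (\<lambda>s. monomial_eigenvalue t s (label k) i) (r + r')) (basis_vec k)"
    using scalar_phi[of k PlusS i "r + r'"] scalar_phi[of k MinusS i "r + r'"]
    by (simp add: scalar_at_def jump_def fin.scale_left_diff_distrib)
  then have p: "alg_act act (phi t PlusS i (r + r')) (basis_vec k) - alg_act act (phi t MinusS i (r + r')) (basis_vec k) =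
    fin_scale (qq * commutator_eigenvalue i (r + r') ?a ?b) (basis_vec k)"
    unfolding label_def jump_pair[OF low_le_high] .
  show "alg_act act (bracket (xgen PlusS i r) (xgen MinusS j r')
    - (if i = j then scal (1 / (qpow t 1 - qpow t (-1))) * (phi t PlusS i (r + r') - phi t MinusS i (r + r')) else 0)) (basis_vec k) = 0"
  proof (cases "i = j")
    case True
    then show ?thesis unfolding alg_act_diff[of act "bracket _ _"] c
      by (simp add: alg_act_mult[OF lin_act] alg_act_scal alg_act_diff p[unfolded True] qpow_qq)
  qed (simp add: c)
qed

sublocale generator_action t act
proof (rule generator_action.intro)
  show "lin (act x)" for x by (rule lin_act)
  fix a v assume "a \<in> toroidal_relations t"
  then show "alg_act act a v = 0"
  proof (induction rule: toroidal_relations.induct)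
    case (x_serre j i s r1 r2 r')
    then show ?case by (rule vanishes_serre)
  next
    case (x_far i j s r1 r2)
    then show ?case by (rule vanishes_far)
  qed (rule vanishes_k vanishes_kx vanishes_hx vanishes_xx vanishes_quad)+
qed

section \<open>Structure of the module\<close>

abbreviation rep :: "free_alg set \<Rightarrow> vec \<Rightarrow> vec" where
  "rep \<equiv> quotient_act t act"

lemma rep_kgen: "rep (cls t (kgen h)) v = diag (\<lambda>k. qpow t (wt (label k) h)) v"
  and rep_hgen: "rep (cls t (hgen i m)) v = diag (\<lambda>k. h_eigenvalue i (Rep_nzint m) (label k)) v"
  and rep_xgen: "rep (cls t (xgen s i r)) v = x_act s i r v"
  by (simp_all add: quotient_act_cls alg_act_gen)

lemma rep_phi: "rep (cls t (phi_series t s i $$ n)) v = diag (\<lambda>k. monomial_eigenvalue t s (label k) i $$ n) v"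
  unfolding quotient_act_cls
proof (rule lin_eqI[OF lin_alg lin_diag])
  fix k
  show "alg_act act (phi_series t s i $$ n) (basis_vec k) = diag (\<lambda>k. monomial_eigenvalue t s (label k) i $$ n) (basis_vec k)"
    unfolding diag_basis using scalar_phi_series[of k s i, unfolded scalar_series_def scalar_at_def] by (rule spec)
qed

lemma label_monomials: "label k \<in> monomials"
  by (simp add: label_def pair_monomial_monomials)

lemma label_weight: "wt (label k) \<in> weight_lattice"
  using label_monomials[of k] by (simp add: monomials_def)

lemma label_expo_inj: "expo (label k) = expo (label k') \<Longrightarrow> k = k'"
  unfolding label_def using pair_monomial_inj[OF low_le_high low_le_high] by (metis enc_high_low)

lemma range_label: "range label = Mbar"
proof -
  have "pair_monomial a b \<in> range label" if "b \<le> a" for a b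
    by (rule range_eqI[of _ _ "enc a b"]) (simp add: label_def that)
  then show ?thesis by (auto simp: Mbar_eq pair_monomials_def label_def intro: low_le_high)
qed

text \<open>The span of the basis vectors with label \<open>j\<close>.\<close>

definition labelled :: "(nat \<Rightarrow> 'j) \<Rightarrow> 'j \<Rightarrow> vec set" where
  "labelled lab j = {v. \<forall>k. lookup v k \<noteq> 0 \<longrightarrow> lab k = j}"

lemma is_direct_sum_labelled:
  assumes "\<And>k. lab k \<in> J" "\<And>j. j \<in> J \<Longrightarrow> U j = labelled lab j"
  shows "is_direct_sum fin_scale J U"
proof -
  have "fin.subspace (U j)" if "j \<in> J" for j
    unfolding assms(2)[OF that] labelled_def fin.subspace_def by (auto simp: lookup_add) (metis add_0)
  moreover have "fin.span (\<Union>j\<in>J. U j) = UNIV"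
  proof -
    have "basis_vec k \<in> fin.span (\<Union>j\<in>J. U j)" for k
      by (rule fin.span_base, rule UN_I[OF assms(1)[of k]])
        (simp add: assms(2)[OF assms(1)] labelled_def lookup_basis_vec)
    then have "v \<in> fin.span (\<Union>j\<in>J. U j)" for v
      by (subst vec_expand) (intro fin.span_sum fin.span_scale)
    then show ?thesis by auto
  qed
  moreover have "v j0 = 0" if "finite F" "F \<subseteq> J" "\<forall>j\<in>F. v j \<in> U j" "(\<Sum>j\<in>F. v j) = 0" "j0 \<in> F" for F v j0
  proof (rule poly_mapping_eqI)
    fix k
    show "lookup (v j0) k = lookup 0 k"
    proof (rule ccontr)
      assume n: "lookup (v j0) k \<noteq> lookup 0 k"
      have U: "v j \<in> labelled lab j" if "j \<in> F" for j using that \<open>F \<subseteq> J\<close> \<open>\<forall>j\<in>F. v j \<in> U j\<close> assms(2) by blast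
      have "lab k = j0" using n U[OF \<open>j0 \<in> F\<close>] by (simp add: labelled_def)
      then have "lookup (v j) k = (if j = j0 then lookup (v j0) k else 0)" if "j \<in> F" for j
        using U[OF that] by (auto simp: labelled_def)
      then have "(\<Sum>j\<in>F. lookup (v j) k) = (\<Sum>j\<in>F. if j = j0 then lookup (v j0) k else 0)"
        by (intro sum.cong refl)
      also have "\<dots> = lookup (v j0) k" using \<open>finite F\<close> \<open>j0 \<in> F\<close> by simp
      finally show False using \<open>(\<Sum>j\<in>F. v j) = 0\<close> n by (simp flip: lookup_sum)
    qed
  qed
  ultimately show ?thesis unfolding is_direct_sum_def by blast
qed

lemma diag_eq_scale_iff: "diag f v = fin_scale c v \<longleftrightarrow> (\<forall>k. lookup v k \<noteq> 0 \<longrightarrow> f k = c)"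
  by (auto simp: poly_mapping_eq_iff fun_eq_iff lookup_diag)

lemma weight_space_labelled:
  assumes "\<nu> \<in> weight_lattice"
  shows "weight_space t fin_scale rep \<nu> = labelled (\<lambda>k. wt (label k)) \<nu>"
  using weight_inj[OF label_weight assms]
  by (auto simp: weight_space_def labelled_def rep_kgen diag_eq_scale_iff)

lemma lookup_diag_power:
  "lookup (((\<lambda>w. diag f w - fin_scale c w) ^^ N) v) k = (f k - c) ^ N * lookup v k"
  by (induction N) (simp_all add: lookup_minus lookup_diag algebra_simps)

text \<open>Since the operators are diagonal, a generalised eigenvector is an eigenvector; its coordinates are supported on
  the basis vectors whose eigenvalues agree, hence whose monomial is \<open>m\<close>.\<close>

lemma monomial_space_labelled:
  assumes "m \<in> monomials"
  shows "monomial_space t fin_scale rep m = labelled label m"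
proof (intro equalityI subsetI)
  fix v assume v: "v \<in> monomial_space t fin_scale rep m"
  have W: "wt m \<in> weight_lattice" using assms by (simp add: monomials_def)
  show "v \<in> labelled label m"
    unfolding labelled_def
  proof (intro CollectI allI impI)
    fix k assume k: "lookup v k \<noteq> 0"
    have "v \<in> weight_space t fin_scale rep (wt m)" using v by (simp add: monomial_space_def)
    then have "wt (label k) = wt m" unfolding weight_space_labelled[OF W] using k by (simp add: labelled_def)
    moreover have "monomial_eigenvalue t PlusS (label k) i $$ n = monomial_eigenvalue t PlusS m i $$ n" for i n
    proof -
      obtain N where "((\<lambda>w. diag (\<lambda>k. monomial_eigenvalue t PlusS (label k) i $$ n) w
         - fin_scale (monomial_eigenvalue t PlusS m i $$ n) w) ^^ N) v = 0"
        using v unfolding monomial_space_def rep_phi by blast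
      from arg_cong[OF this, of "\<lambda>u. lookup u k"] show ?thesis using k by (simp add: lookup_diag_power)
    qed
    ultimately show "label k = m" by (intro monomial_determined[OF label_monomials assms]) simp_all
  qed
next
  fix v assume v: "v \<in> labelled label m"
  have "wt m \<in> weight_lattice" using assms by (simp add: monomials_def)
  then have "v \<in> weight_space t fin_scale rep (wt m)"
    using v by (simp add: weight_space_labelled) (auto simp: labelled_def)
  moreover have "((\<lambda>w. diag (\<lambda>k. monomial_eigenvalue t s (label k) i $$ n) w
         - fin_scale (monomial_eigenvalue t s m i $$ n) w) ^^ 1) v = 0" for s i n
    by (rule poly_mapping_eqI, subst lookup_diag_power) (use v in \<open>auto simp: labelled_def\<close>)
  ultimately show "v \<in> monomial_space t fin_scale rep m"
    unfolding monomial_space_def rep_phi by blast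
qed

lemma fin_dim_line: "fin.dim (fin.span {basis_vec k}) = 1"
proof -
  have "basis_vec k \<noteq> 0" by (metis lookup_single_eq lookup_zero one_neq_zero)
  then show ?thesis by (subst fin.dim_span_eq_card_independent) simp_all
qed

lemma supported_at: "{v. \<forall>k. lookup v k \<noteq> 0 \<longrightarrow> k = k0} = fin.span {basis_vec k0}"
proof -
  have "v = fin_scale (lookup v k0) (basis_vec k0)" if "\<forall>k. lookup v k \<noteq> 0 \<longrightarrow> k = k0" for v
    by (rule poly_mapping_eqI) (use that in \<open>auto simp: lookup_basis_vec\<close>)
  then show ?thesis by (auto simp: fin.span_singleton lookup_basis_vec split: if_splits)
qed

lemma label_line: "labelled label (label k) = fin.span {basis_vec k}"
  unfolding supported_at[symmetric] labelled_def using label_expo_inj by auto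

lemma q_character: "has_q_character t fin_scale rep (\<lambda>m. if m \<in> Mbar then 1 else 0)"
  unfolding has_q_character_def
proof (intro conjI ballI allI impI)
  show "is_direct_sum fin_scale monomials (monomial_space t fin_scale rep)"
    by (rule is_direct_sum_labelled[OF label_monomials monomial_space_labelled])
next
  fix m assume "m \<notin> monomials"
  then have "m \<notin> Mbar" unfolding range_label[symmetric] using label_monomials by auto
  then show "(if m \<in> Mbar then 1 else 0) = 0" by simp
next
  fix m assume m: "m \<in> monomials"
  have empty: "labelled label m = fin.span {}" if "m \<notin> range label"
  proof -
    have "v = 0" if "v \<in> labelled label m" for v
      using that \<open>m \<notin> range label\<close> by (intro poly_mapping_eqI) (auto simp: labelled_def)
    moreover have "0 \<in> labelled label m" by (simp add: labelled_def)
    ultimately show ?thesis by auto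
  qed
  show "\<exists>B. finite B \<and> monomial_space t fin_scale rep m \<subseteq> fin.span B"
  proof (cases "m \<in> range label")
    case True
    then obtain k where "m = label k" by auto
    then show ?thesis using m label_line[of k] by (intro exI[of _ "{basis_vec k}"]) (simp add: monomial_space_labelled)
  next
    case False
    then show ?thesis using m empty by (intro exI[of _ "{}"]) (simp add: monomial_space_labelled)
  qed
  show "fin.dim (monomial_space t fin_scale rep m) = (if m \<in> Mbar then 1 else 0)"
  proof (cases "m \<in> range label")
    case True
    then obtain k where k: "m = label k" by auto
    have "m \<in> Mbar" using True by (simp only: range_label)
    then show ?thesis unfolding monomial_space_labelled[OF m] by (simp only: k label_line fin_dim_line if_True)
  next
    case False
    then have "fin.dim (monomial_space t fin_scale rep m) = fin.dim (fin.span {})" using m empty by (simp add: monomial_space_labelled)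
    also have "\<dots> = 0" by (subst fin.dim_span_eq_card_independent) (simp_all add: fin.independent_empty)
    finally show ?thesis using False by (simp add: range_label)
  qed
qed

text \<open>After a step of colour \<open>i\<close> a box no longer has this colour, and there are only two boxes.\<close>

lemma x_act_cube: "x_act s i r (x_act s i r (x_act s i r v)) = 0"
proof -
  have l: "lin (\<lambda>v. x_act s i r (x_act s i r (x_act s i r v)))"
    unfolding lin_iff by (simp add: x_act_lin)
  have "x_act s i r (x_act s i r (x_act s i r (signed pair_vec s L T))) = 0" if TL: "T \<le> L" for L T
  proof -
    have c: "\<not> (i = color s x \<and> i = color s (x + 1))" for x using color_next(1)[of s x] by metis
    have l: "lead_coeff s i r L * lead_coeff s i r (L + 1) = 0" for L
    proof (cases "i = color s L")
      case True
      then have "i \<noteq> color s (L + 1)" using c[of L] by blast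
      then have "lead_coeff s i r (L + 1) = 0" unfolding lead_coeff_def by (rule if_not_P)
      then show ?thesis by simp
    next
      case False
      then have "lead_coeff s i r L = 0" unfolding lead_coeff_def by (rule if_not_P)
      then show ?thesis by simp
    qed
    have tt: "trail_coeff s i r L T * trail_coeff s i r L' (T + 1) = 0" for L L' T
    proof (cases "i = color s T")
      case True
      then have "i \<noteq> color s (T + 1)" using c[of T] by blast
      then have "trail_coeff s i r L' (T + 1) = 0" unfolding trail_coeff_def by (rule if_not_P)
      then show ?thesis by simp
    next
      case False
      then have "trail_coeff s i r L T = 0" unfolding trail_coeff_def by (rule if_not_P)
      then show ?thesis by simp
    qed
    have z1: "LL s i r i r L T = 0" unfolding LL_def by (rule l)
    have z2: "TT s i r i r L T = 0" unfolding TT_def by (rule tt)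
    have "LT s i r i r L T * lead_coeff s i r (L + 1) =
      (trail_coeff s i r (L + 1) T + trail_coeff s i r L T) * (lead_coeff s i r L * lead_coeff s i r (L + 1))"
      unfolding LT_def by (simp only: algebra_simps)
    then have z3: "LT s i r i r L T * lead_coeff s i r (L + 1) = 0" unfolding l by simp
    have "LT s i r i r L T * trail_coeff s i r (L + 1) (T + 1) =
      lead_coeff s i r L * (trail_coeff s i r (L + 1) T * trail_coeff s i r (L + 1) (T + 1))
      + lead_coeff s i r L * (trail_coeff s i r L T * trail_coeff s i r (L + 1) (T + 1))"
      unfolding LT_def by (simp only: algebra_simps)
    then have z4: "LT s i r i r L T * trail_coeff s i r (L + 1) (T + 1) = 0" unfolding tt by simp
    show ?thesis unfolding x_act3[OF TL] z1 z2 z3 z4 by simp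
  qed
  then have "x_act s i r (x_act s i r (x_act s i r (basis_vec k))) = 0" for k
    unfolding basis_vec_signed[of k s] using trail_le_lead by blast
  moreover have "lin (\<lambda>_. 0)" by (simp add: lin_iff)
  ultimately show ?thesis using lin_eqI[OF l] by blast
qed

lemma integrable: "integrable_rep t fin_scale rep"
  unfolding integrable_rep_def
proof (intro conjI allI)
  show "is_direct_sum fin_scale weight_lattice (weight_space t fin_scale rep)"
    by (rule is_direct_sum_labelled[OF label_weight weight_space_labelled])
  fix s i v
  have "(rep (cls t (xgen s i 0)) ^^ 3) v = 0"
    by (simp add: numeral_3_eq_3 rep_xgen x_act_cube)
  then show "\<exists>N. (rep (cls t (xgen s i 0)) ^^ N) v = 0" ..
qed

lemma cls_uminus: "\<ominus>\<^bsub>toroidal t\<^esub> cls t a = cls t (- a)"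
proof -
  interpret ring "toroidal t" by (rule ring_toroidal)
  have "cls t 0 = toroidal_ideal t" by (auto simp: cls_def a_r_coset_def')
  then have "cls t (- a) \<oplus>\<^bsub>toroidal t\<^esub> cls t a = \<zero>\<^bsub>toroidal t\<^esub>"
    by (simp add: toroidal_ops) (simp add: toroidal_def FactRing_def)
  then show ?thesis by (intro minus_equality) (simp_all add: carrier_toroidal)
qed

lemma cartan_diag:
  assumes "X \<in> toroidal_cartan t"
  shows "\<exists>a f. X = cls t a \<and> (\<forall>v. alg_act act a v = diag f v)"
  using assms unfolding toroidal_cartan_def
proof induction
  case one
  show ?case
    by (intro exI[of _ 1] exI[of _ "\<lambda>_. 1"])
      (auto simp: toroidal_ops alg_act_1 poly_mapping_eq_iff fun_eq_iff lookup_diag)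
next
  case (incl X)
  then consider c where "X = cls t (scal c)" | h where "X = cls t (kgen h)" | i m where "X = cls t (hgen i m)"
    by auto
  then show ?case
  proof cases
    case 1
    have "\<forall>v. alg_act act (scal c) v = diag (\<lambda>_. c) v"
      by (auto simp: alg_act_scal poly_mapping_eq_iff fun_eq_iff lookup_diag)
    then show ?thesis using 1 by blast
  next
    case 2
    have "\<forall>v. alg_act act (kgen h) v = diag (\<lambda>k. qpow t (wt (label k) h)) v"
      by (simp add: alg_act_gen)
    then show ?thesis using 2 by blast
  next
    case 3
    have "\<forall>v. alg_act act (hgen i m) v = diag (\<lambda>k. h_eigenvalue i (Rep_nzint m) (label k)) v"
      by (simp add: alg_act_gen)
    then show ?thesis using 3 by blast
  qed
next
  case (a_inv X)
  then obtain a f where "X = cls t a" "\<forall>v. alg_act act a v = diag f v" by blast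
  then show ?case
    by (intro exI[of _ "- a"] exI[of _ "\<lambda>k. - f k"])
      (auto simp: cls_uminus alg_act_uminus poly_mapping_eq_iff fun_eq_iff lookup_diag)
next
  case (eng_add X Y)
  then obtain a f b h where "X = cls t a" "\<forall>v. alg_act act a v = diag f v" "Y = cls t b" "\<forall>v. alg_act act b v = diag h v" by blast
  then show ?case
    by (intro exI[of _ "a + b"] exI[of _ "\<lambda>k. f k + h k"])
      (auto simp: toroidal_ops alg_act_add poly_mapping_eq_iff fun_eq_iff lookup_diag lookup_add algebra_simps)
next
  case (eng_mult X Y)
  then obtain a f b h where "X = cls t a" "\<forall>v. alg_act act a v = diag f v" "Y = cls t b" "\<forall>v. alg_act act b v = diag h v" by blast
  then show ?case
    by (intro exI[of _ "a * b"] exI[of _ "\<lambda>k. f k * h k"])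
      (auto simp: toroidal_ops alg_act_mult[OF lin_act] poly_mapping_eq_iff fun_eq_iff lookup_diag algebra_simps)
qed

lemma rep_cartan:
  assumes "X \<in> toroidal_cartan t"
  obtains f where "rep X = diag f"
proof -
  obtain a f where "X = cls t a" "\<forall>v. alg_act act a v = diag f v" using cartan_diag[OF assms] by blast
  then have "rep X = diag f" by (simp add: quotient_act_cls fun_eq_iff)
  then show thesis by (rule that)
qed

lemma diagonalizable_diag: "diagonalizable fin_scale (diag f)"
proof -
  have "basis_vec k \<in> fin.span {v. \<exists>c. diag f v = fin_scale c v}" for k
    using diag_basis[of f k] by (intro fin.span_base) blast
  then have "v \<in> fin.span {v. \<exists>c. diag f v = fin_scale c v}" for v
    by (subst vec_expand) (intro fin.span_sum fin.span_scale)
  then show ?thesis by (auto simp: diagonalizable_def)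
qed

text \<open>Two basis vectors in the support of joint eigenvectors for the same character have the same
  eigenvalues of all \<open>h\<^bsub>i,n\<^esub>\<close>, hence the same monomial.\<close>

lemma joint_eigenspace_line:
  assumes "v \<in> joint_eigenspace t fin_scale rep \<theta>" "lookup v k \<noteq> 0"
  shows "joint_eigenspace t fin_scale rep \<theta> = fin.span {basis_vec k}"
proof -
  have eig: "f k' = \<theta> X" if "X \<in> toroidal_cartan t" "rep X = diag f" "w \<in> joint_eigenspace t fin_scale rep \<theta>" "lookup w k' \<noteq> 0" for X f w k'
    using that by (auto simp: joint_eigenspace_def diag_eq_scale_iff)
  have "k' = k" if w: "w \<in> joint_eigenspace t fin_scale rep \<theta>" "lookup w k' \<noteq> 0" for w k'
  proof (rule label_expo_inj, intro ext)
    fix i l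
    show "expo (label k') i l = expo (label k) i l"
    proof (rule h_eigenvalue_inj)
      fix n :: int assume n: "n > 0"
      define m where "m = Abs_nzint n"
      have m: "Rep_nzint m = n" unfolding m_def by (rule Abs_nzint_inverse) (use n in simp)
      have "cls t (hgen i m) \<in> toroidal_cartan t"
        unfolding toroidal_cartan_def by (rule generate_ring.incl) auto
      moreover have "rep (cls t (hgen i m)) = diag (\<lambda>k. h_eigenvalue i n (label k))"
        by (simp add: fun_eq_iff rep_hgen m)
      ultimately show "h_eigenvalue i n (label k') = h_eigenvalue i n (label k)"
        using eig[OF _ _ w] eig[OF _ _ assms] by metis
    qed (use label_monomials monomials_finite in auto)
  qed
  then have "joint_eigenspace t fin_scale rep \<theta> \<subseteq> fin.span {basis_vec k}"
    unfolding supported_at[symmetric] by blast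
  moreover have "c \<in> joint_eigenspace t fin_scale rep \<theta>" if c: "c \<in> fin.span {basis_vec k}" for c
    unfolding joint_eigenspace_def
  proof (intro CollectI ballI)
    fix X assume X: "X \<in> toroidal_cartan t"
    then obtain f where f: "rep X = diag f" by (rule rep_cartan)
    have "\<forall>k'. lookup c k' \<noteq> 0 \<longrightarrow> k' = k" using c unfolding supported_at[symmetric] by blast
    then show "rep X c = fin_scale (\<theta> X) c"
      unfolding f diag_eq_scale_iff using eig[OF X f assms] by blast
  qed
  ultimately show ?thesis by blast
qed

lemma thin: "thin t fin_scale rep"
  unfolding thin_def
proof (intro conjI ballI allI impI)
  fix X assume "X \<in> toroidal_cartan t"
  then obtain f where "rep X = diag f" by (rule rep_cartan)
  then show "diagonalizable fin_scale (rep X)" using diagonalizable_diag by simp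
next
  fix \<theta> assume nz: "joint_eigenspace t fin_scale rep \<theta> \<noteq> {0}"
  have "rep X 0 = fin_scale (\<theta> X) 0" if "X \<in> toroidal_cartan t" for X
    by (rule rep_cartan[OF that]) (simp add: lin_0[OF lin_diag])
  then have "0 \<in> joint_eigenspace t fin_scale rep \<theta>" by (simp add: joint_eigenspace_def)
  then obtain v where v: "v \<in> joint_eigenspace t fin_scale rep \<theta>" "v \<noteq> 0" using nz by blast
  then obtain k where "lookup v k \<noteq> 0" by (metis lookup_zero poly_mapping_eqI)
  then show "fin.dim (joint_eigenspace t fin_scale rep \<theta>) = 1"
    using joint_eigenspace_line[OF v(1)] fin_dim_line by simp
qed

end

theorem theorem5p6:
  fixes t :: complex
  assumes "\<forall>n::nat. n > 0 \<longrightarrow> exp t ^ n \<noteq> 1"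
  shows "\<exists>\<rho> :: free_alg set \<Rightarrow> (nat \<Rightarrow>\<^sub>0 complex) \<Rightarrow> (nat \<Rightarrow>\<^sub>0 complex).
    representation t fin_scale \<rho> \<and> thin t fin_scale \<rho> \<and> integrable_rep t fin_scale \<rho> \<and>
    has_q_character t fin_scale \<rho> (\<lambda>m. if m \<in> Mbar then 1 else 0)"
proof -
  interpret generic t by standard (rule assms)
  show ?thesis
    using representation_quotient_act thin integrable q_character by blast
qed

end
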